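(* Consider the hierarchical $g$-prior model with the Zellner–Siow hyperprior $g\sim\mathrm{InverseGamma}(1/2,n/2)$ and true parameters $\{(\beta_{0n},\sigma_0^2),n\ge1\}$, as described in the context. Posterior consistency under the $\ell_\infty$ norm occurs, i.e. $P_M(\|\beta_n-\beta_{0n}\|_\infty>\epsilon\mid\hat\beta_n,S_n)\to0$ almost surely under $P_0$ for every $\epsilon>0$, if either $\alpha=0$ or there do not exist a subsequence $k_n$ of $n$ and a constant $A>0$ such that $\|\gamma_{k_n}-\beta_{0k_n}\|_2^2\to A$ and $\|\gamma_{k_n}-\beta_{0k_n}\|_\infty\nrightarrow0$.
   Context: Linear model: for each $n\ge1$, $Y_n=X_n\beta_n+e_n$, where $X_n$ is a nonrandom $n\times p_n$ matrix of full column rank, $\beta_n\in\mathbb{R}^{p_n}$, and $e_n\sim N_n(0,\sigma^2 I_n)$. The sequence $p_n$ is nondecreasing with $p_n<n$ and $p_n/n\to\alpha$, where $0\le\alpha<1$. The eigenvalues $\lambda_{n,1},\dots,\lambda_{n,p_n}$ of $n(X_n^TX_n)^{-1}$ satisfy $0<\lambda_{\min}\le\inf_{n,i}\lambda_{n,i}\le\sup_{n,i}\lambda_{n,i}\le\lambda_{\max}<\infty$ for some constants $\lambda_{\min},\lambda_{\max}$. Let $\hat\beta_n=(X_n^TX_n)^{-1}X_n^TY_n$ and $S_n=\|Y_n-X_n\hat\beta_n\|_2^2$; given $(\beta_n,\sigma^2)$ these are independent with $\hat\beta_n\sim N_{p_n}(\beta_n,\sigma^2(X_n^TX_n)^{-1})$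 and $S_n\sim\sigma^2\chi^2_{n-p_n}$. Norms: $\|x\|_\infty=\max_i|x_i|$, $\|x\|_2=(\sum_i x_i^2)^{1/2}$. Hierarchical $g$-prior model $P_M$ with the Zellner–Siow hyperprior: given $(\beta_n,\sigma^2)$, the data $\hat\beta_n$ and $S_n$ are independent with $\hat\beta_n\sim N_{p_n}(\beta_n,\sigma^2(X_n^TX_n)^{-1})$ and $S_n\sim\sigma^2\chi^2_{n-p_n}$, with priors $\beta_n\mid\sigma^2,g\sim N_{p_n}(\gamma_n,g\sigma^2(X_n^TX_n)^{-1})$, $\sigma^2\sim\mathrm{InverseGamma}(a/2,b/2)$ (density proportional to $(\sigma^2)^{-a/2-1}e^{-b/(2\sigma^2)}$) independently of $g$, and $g\sim\mathrm{InverseGamma}(1/2,n/2)$, i.e. $\pi_n(g)\propto g^{-3/2}\exp(-n/(2g))$ on $(0,\infty)$. Here $a\ge-2$, $b\ge0$ are constants (an improper prior on $\sigma^2$ is allowed, the posterior being defined by Bayes' formula; asymptotic statements concern $n$ large enough that it is proper) and $\gamma_n\in\mathbb{R}^{p_n}$ is a known nonrandom sequence. True distribution $P_0$: $\beta_{0n}\in\mathbb{R}^{p_n}$ ($n\ge1$) and $\sigma_0^2>0$ are fixed, and $P_0$ is the distribution of $\{(\hat\beta_n,S_n),n\ge1\}$ under $Y_n=X_n\beta_{0n}+e_n$, $e_n\sim N_n(0,\sigma_0^2I_n)$, for each $n\ge1$. *)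

theory Defs
  imports
    "HOL-Probability.Probability"
    "Jordan_Normal_Form.Gauss_Jordan_Elimination"
    "Jordan_Normal_Form.Char_Poly"
    "Jordan_Normal_Form.DL_Rank"
begin

(* The dimension p n varies with n, so vectors and matrices are the carrier-based ones of
   Jordan_Normal_Form; several of their names and symbols also exist in HOL-Analysis, hence
   the qualified names. *)

definition l2norm :: "real Matrix.vec \<Rightarrow> real" where
  "l2norm x = sqrt (\<Sum>i<dim_vec x. (vec_index x i)\<^sup>2)"

(* The inserted 0 only matters for the empty vector (p 1 = 0 is forced by p 1 < 1). *)
definition linfnorm :: "real Matrix.vec \<Rightarrow> real" where
  "linfnorm x = Max (insert 0 ((\<lambda>i. \<bar>vec_index x i\<bar>) ` {..<dim_vec x}))"

(* Meaningful for invertible square matrices only. *)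
definition minv :: "real Matrix.mat \<Rightarrow> real Matrix.mat" where
  "minv A = the (mat_inverse A)"

definition gram :: "real Matrix.mat \<Rightarrow> real Matrix.mat" where
  "gram X = transpose_mat X * X"

definition ls_estimator :: "real Matrix.mat \<Rightarrow> real Matrix.vec \<Rightarrow> real Matrix.vec" where
  "ls_estimator X Y = minv (gram X) *\<^sub>v (transpose_mat X *\<^sub>v Y)"

definition rss :: "real Matrix.mat \<Rightarrow> real Matrix.vec \<Rightarrow> real" where
  "rss X Y = (l2norm (Y - X *\<^sub>v ls_estimator X Y))\<^sup>2"

(* Density at x of N(mu, Sigma), for Sigma positive definite. *)
definition mvn_density ::
  "real Matrix.vec \<Rightarrow> real Matrix.mat \<Rightarrow> real Matrix.vec \<Rightarrow> real" where
  "mvn_density \<mu> \<Sigma> x =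
     exp (- scalar_prod (x - \<mu>) (minv \<Sigma> *\<^sub>v (x - \<mu>)) / 2)
       / sqrt ((2 * pi) ^ dim_vec x * Determinant.det \<Sigma>)"

(* Density at s of v times a chi-squared variable with k degrees of freedom. *)
definition scaled_chisq_density :: "nat \<Rightarrow> real \<Rightarrow> real \<Rightarrow> real" where
  "scaled_chisq_density k v s =
     (if s > 0
      then s powr (real k / 2 - 1) * exp (- s / (2 * v)) / ((2 * v) powr (real k / 2) * Gamma (real k / 2))
      else 0)"

(* Unnormalised density of InverseGamma(c, d). The normalising constant cancels in Bayes' formula,
   and it does not exist for the improper choices of the prior on sigma^2. *)
definition inv_gamma_kernel :: "real \<Rightarrow> real \<Rightarrow> real \<Rightarrow> real" where
  "inv_gamma_kernel c d x = (if x > 0 then x powr (- c - 1) * exp (- d / x) else 0)"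

(* In the next four definitions v is the variance sigma^2, and (bh, s) is the observed value of the
   least squares estimator and of the residual sum of squares. *)
definition likelihood ::
  "real Matrix.mat \<Rightarrow> real Matrix.vec \<Rightarrow> real \<Rightarrow> real Matrix.vec \<Rightarrow> real \<Rightarrow> real" where
  "likelihood X \<beta> v bh s =
     mvn_density \<beta> (v \<cdot>\<^sub>m minv (gram X)) bh
     * scaled_chisq_density (dim_row X - dim_col X) v s"

definition zs_prior ::
  "real \<Rightarrow> real \<Rightarrow> real Matrix.mat \<Rightarrow> real Matrix.vec \<Rightarrow> real Matrix.vec \<Rightarrow> real \<Rightarrow> real \<Rightarrow> real" where
  "zs_prior a b X \<gamma> \<beta> v g =
     mvn_density \<gamma> ((g * v) \<cdot>\<^sub>m minv (gram X)) \<beta>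
     * inv_gamma_kernel (a / 2) (b / 2) v
     * inv_gamma_kernel (1 / 2) (real (dim_row X) / 2) g"

(* Integral of likelihood times prior over the parameters with beta in B. *)
definition joint_mass ::
  "real \<Rightarrow> real \<Rightarrow> real Matrix.mat \<Rightarrow> real Matrix.vec \<Rightarrow> real Matrix.vec \<Rightarrow> real
    \<Rightarrow> real Matrix.vec set \<Rightarrow> ennreal" where
  "joint_mass a b X \<gamma> bh s B =
     (\<integral>\<^sup>+ g. (\<integral>\<^sup>+ v. (\<integral>\<^sup>+ f.
         ennreal (likelihood X (Matrix.vec (dim_col X) f) v bh s
                  * zs_prior a b X \<gamma> (Matrix.vec (dim_col X) f) v g)
         * indicator B (Matrix.vec (dim_col X) f)
       \<partial>(\<Pi>\<^sub>M i\<in>{..<dim_col X}. lborel)) \<partial>lborel) \<partial>lborel)"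

(* Posterior probability of beta in B by Bayes' formula; left unspecified when the posterior is
   improper, so that no statement about it can hold merely by improperness. *)
definition posterior_prob ::
  "real \<Rightarrow> real \<Rightarrow> real Matrix.mat \<Rightarrow> real Matrix.vec \<Rightarrow> real Matrix.vec \<Rightarrow> real
    \<Rightarrow> real Matrix.vec set \<Rightarrow> real" where
  "posterior_prob a b X \<gamma> bh s B =
     (if joint_mass a b X \<gamma> bh s UNIV \<in> {0, \<infinity>} then undefined
      else enn2real (joint_mass a b X \<gamma> bh s B / joint_mass a b X \<gamma> bh s UNIV))"

end

theory Submission
  imports Defs "HOL-Real_Asymp.Real_Asymp"
begin

text \<open>
  Integrating out \<open>\<beta>\<close> and then \<open>\<sigma>\<^sup>2\<close> leaves a one-dimensional posterior for \<open>g\<close>, proportional to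
  \<open>(1 + g)\<^bsup>-p/2\<^esup> U(g)\<^bsup>-(n+a)/2\<^esup> g\<^bsup>-3/2\<^esup> e\<^bsup>-n/(2g)\<^esup>\<close> with \<open>U(g) = S + b + T / (1 + g)\<close> and
  \<open>T = \<parallel>X (\<beta>\<^sub>h - \<gamma>)\<parallel>\<^sup>2\<close>. All normalising constants cancel in Bayes' formula, so only the scaling behaviour of the
  Gaussian and inverse Gamma integrals matters. Given \<open>g\<close>, a Chernoff bound for \<open>\<beta>\<close> merely adds a term of
  order \<open>n\<close> to \<open>U(g)\<close>, which costs an exponentially small factor as long as \<open>U(g) = O(n)\<close>.

  It remains to discard the values of \<open>g\<close> for which \<open>U(g)\<close> is too large or the bias
  \<open>(\<gamma> - \<beta>\<^sub>0) / (1 + g)\<close> of the conditional posterior mean is not small. On this set the substitution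
  \<open>g \<mapsto> 2 g\<close> multiplies the density by an exponentially large factor: if \<open>T / (1 + g)\<close> dominates \<open>S + b\<close>,
  then \<open>U\<close> is almost halved and \<open>p/n \<rightarrow> \<alpha> < 1\<close> leaves a gain; if \<open>\<alpha> = 0\<close> and \<open>g\<close> is bounded, the factor
  \<open>e\<^bsup>-n/(2g)\<^esup>\<close> provides it. The hypothesis on subsequences says that for \<open>\<alpha> \<noteq> 0\<close> no other case occurs.

  On the data side, \<open>S > 0\<close> almost surely, and \<open>\<parallel>e\<parallel>\<^sup>2 = O(n)\<close> and \<open>\<parallel>\<beta>\<^sub>h - \<beta>\<^sub>0\<parallel>\<^sub>\<infinity> \<rightarrow> 0\<close> almost surely by exponential
  moments and the Borel-Cantelli lemma; no joint distribution over different \<open>n\<close> is needed.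
\<close>

section \<open>Positive semidefinite matrices and the Gram matrix\<close>

text \<open>The obstacle is that \<gamma> is arbitrary, so \<open>T\<close> can be of any order:
  \<open>U(g)\<close> has no bound of order \<open>n\<close> uniformly in \<open>g\<close>, and
  where the posterior of \<open>g\<close> concentrates is not known. Bounding a numerator from above
  and the normalising integral from below would need a case analysis in \<open>T\<close>. Doubling
  avoids this. The integral of \<open>2 * f (2 * g)\<close> equals that of \<open>f\<close>, so a
  pointwise inequality \<open>G * f g \<le> 2 * f (2 * g)\<close> on a set bounds the posterior
  probability of that set by \<open>1 / G\<close>, and the normalising integral is never estimated.
  The discarded set compares \<open>T / (1 + g)\<close> with a multiple \<open>Q\<close> of
  \<open>S + b\<close>, not with a multiple of \<open>n\<close>. Off this set \<open>U(g)\<close> is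
  below \<open>(1 + Q) * (S + b)\<close>, hence of order \<open>n\<close>, and \<open>1 + g\<close>
  exceeds \<open>T / (Q * (S + b))\<close>. The second fact also controls the bias: if the Euclidean
  distance \<open>D\<close> of \<gamma> from the truth is large, then \<open>T\<close> is at least
  of order \<open>n\<close> times the square of \<open>D\<close>, so \<open>1 + g\<close> is at
  least of the order of that square and the bias, at most \<open>D / (1 + g)\<close>, is at most of
  order \<open>1 / D\<close>. A large \<open>D\<close> is therefore as harmless as a small maximum
  norm.\<close>

lemma minv_unique:
  assumes A: "A \<in> carrier_mat n n" and B: "B \<in> carrier_mat n n" and AB: "A * B = 1\<^sub>m n"
  shows "minv A = B"
proof -
  have BA: "B * A = 1\<^sub>m n" using mat_mult_left_right_inverse[OF A B AB] .
  have U: "A \<in> Units (ring_mat TYPE(real) n ())"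
    unfolding Units_def ring_mat_def using A B AB BA by auto
  then obtain C where C: "mat_inverse A = Some C"
    using mat_inverse(1)[OF A, of "()"] by (cases "mat_inverse A") auto
  from mat_inverse(2)[OF A C] have CA: "C * A = 1\<^sub>m n" and Cc: "C \<in> carrier_mat n n" by auto
  have "C = C * (A * B)" using AB Cc by simp
  also have "\<dots> = (C * A) * B" using A B Cc by (simp add: assoc_mult_mat)
  also have "\<dots> = B" using CA B by simp
  finally show ?thesis unfolding minv_def C by simp
qed

lemma minv_inverse:
  assumes A: "A \<in> carrier_mat n n" and det: "Determinant.det A \<noteq> 0"
  shows "minv A \<in> carrier_mat n n" "A * minv A = 1\<^sub>m n" "minv A * A = 1\<^sub>m n"
proof -
  from det_non_zero_imp_unit[OF A det] have "A \<in> Units (ring_mat TYPE(real) n ())" .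
  then obtain B where B: "B \<in> carrier_mat n n" "A * B = 1\<^sub>m n"
    unfolding Units_def ring_mat_def by auto
  have "minv A = B" by (rule minv_unique[OF A B])
  then show "minv A \<in> carrier_mat n n" "A * minv A = 1\<^sub>m n" "minv A * A = 1\<^sub>m n"
    using B mat_mult_left_right_inverse[OF A B] by auto
qed

lemma minv_smult:
  assumes A: "A \<in> carrier_mat n n" and det: "Determinant.det A \<noteq> 0" and c: "c \<noteq> 0"
  shows "minv (c \<cdot>\<^sub>m A) = (1 / c) \<cdot>\<^sub>m minv A"
proof (rule minv_unique)
  note I = minv_inverse[OF A det]
  show "c \<cdot>\<^sub>m A \<in> carrier_mat n n" "(1 / c) \<cdot>\<^sub>m minv A \<in> carrier_mat n n"
    using A I by auto
  have "c \<cdot>\<^sub>m A * ((1 / c) \<cdot>\<^sub>m minv A) = c \<cdot>\<^sub>m (A * ((1 / c) \<cdot>\<^sub>m minv A))"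
    by (rule mult_smult_assoc_mat[OF A, of _ n]) (use I in auto)
  also have "A * ((1 / c) \<cdot>\<^sub>m minv A) = (1 / c) \<cdot>\<^sub>m (A * minv A)"
    by (rule mult_smult_distrib[OF A I(1)])
  also have "c \<cdot>\<^sub>m ((1 / c) \<cdot>\<^sub>m (A * minv A)) = 1\<^sub>m n"
    unfolding I(2) by (rule eq_matI) (use c in auto)
  finally show "c \<cdot>\<^sub>m A * ((1 / c) \<cdot>\<^sub>m minv A) = 1\<^sub>m n" .
qed

lemma full_rank_kernel:
  assumes X: "X \<in> carrier_mat n k" and r: "vec_space.rank n X = k"
    and v: "(v :: real Matrix.vec) \<in> carrier_vec k" "X *\<^sub>v v = 0\<^sub>v n"
  shows "v = 0\<^sub>v k"
proof (rule ccontr)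
  interpret vec_space "TYPE(real)" n .
  assume "v \<noteq> 0\<^sub>v k"
  \<comment> \<open>Independence concerns the set of columns, so repetitions must be excluded first:
    a repeated column would leave fewer than \<open>k\<close> vectors and push the rank below
    \<open>k\<close>.\<close>
  have d: "distinct (cols X)"
  proof (rule ccontr)
    assume "\<not> distinct (cols X)"
    then have lt: "card (set (cols X)) < k"
      using X card_length[of "cols X"] card_distinct[of "cols X"] by (auto simp: less_le)
    obtain S where S: "maximal S (\<lambda>T. T \<subseteq> set (cols X) \<and> lin_indpt T)"
      using maximal_exists[of "(\<lambda>T. T \<subseteq> set (cols X) \<and> lin_indpt T)" "card (set (cols X))" "{}"]
      by (meson List.finite_set card_mono empty_iff empty_subsetI finite_lin_indpt2 rev_finite_subset)
    then have "card S \<le> card (set (cols X))" by (simp add: card_mono maximal_def)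
    with lt rank_card_indpt[OF X S] r show False by simp
  qed
  show False using lin_depI[OF X v(1) \<open>v \<noteq> 0\<^sub>v k\<close> v(2) d] full_rank_lin_indpt[OF X _ d] r by auto
qed

lemma scalar_prod_self_eq_0:
  "(v :: real Matrix.vec) \<in> carrier_vec n \<Longrightarrow> scalar_prod v v = 0 \<Longrightarrow> v = 0\<^sub>v n"
  using conjugate_square_eq_0_vec[of v n] by (simp add: conjugate_vec_def conjugate_real_def)

lemma gram_carrier: "X \<in> carrier_mat n k \<Longrightarrow> gram X \<in> carrier_mat k k"
  unfolding gram_def by auto

lemma gram_form:
  assumes X: "X \<in> carrier_mat n k" and v: "v \<in> carrier_vec k" "w \<in> carrier_vec k"
  shows "scalar_prod v (gram X *\<^sub>v w) = scalar_prod (X *\<^sub>v v) (X *\<^sub>v w)"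
proof -
  have "gram X *\<^sub>v w = transpose_mat X *\<^sub>v (X *\<^sub>v w)"
    unfolding gram_def using assoc_mult_mat_vec[of "transpose_mat X" k n X k w] X v by auto
  then show ?thesis
    using transpose_vec_mult_scalar[OF X v(1), of "X *\<^sub>v w"] X v
    by (metis comm_scalar_prod mult_mat_vec_carrier transpose_carrier_mat)
qed

lemma det_gram_nonzero:
  assumes X: "X \<in> carrier_mat n k" and r: "vec_space.rank n X = k"
  shows "Determinant.det (gram X) \<noteq> 0"
proof
  assume "Determinant.det (gram X) = 0"
  then obtain v where v: "v \<in> carrier_vec k" "v \<noteq> 0\<^sub>v k" "gram X *\<^sub>v v = 0\<^sub>v k"
    using det_0_iff_vec_prod_zero[OF gram_carrier[OF X]] by auto
  have "scalar_prod (X *\<^sub>v v) (X *\<^sub>v v) = 0"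
    using gram_form[OF X v(1) v(1)] v by simp
  then have "X *\<^sub>v v = 0\<^sub>v n"
    by (rule scalar_prod_self_eq_0[rotated]) (use X v in auto)
  with full_rank_kernel[OF X r v(1)] v show False by auto
qed

section \<open>Quadratic forms and eigenvalue bounds\<close>

lemma discriminant_le:
  fixes A B C :: real
  assumes nn: "\<And>t. A + 2 * t * B + t\<^sup>2 * C \<ge> 0"
  shows "B\<^sup>2 \<le> A * C"
proof (cases "C = 0")
  case True
  have "B = 0"
  proof (rule ccontr)
    assume "B \<noteq> 0"
    then show False using nn[of "- (A + 1) / (2 * B)"] True by (simp add: field_simps)
  qed
  then show ?thesis using True by simp
next
  case False
  have "C > 0"
  proof (rule ccontr)
    assume "\<not> C > 0"
    with False have C: "C < 0" by simp
    \<comment> \<open>Large enough for the quadratic term to outweigh the other two: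
      \<open>t * C\<close> equals \<open>C - (\<bar>A\<bar> + 2 * \<bar>B\<bar>)\<close>.\<close>
    define t where "t = 1 + (\<bar>A\<bar> + 2 * \<bar>B\<bar>) / \<bar>C\<bar>"
    have t: "t \<ge> 1" unfolding t_def by simp
    have "t * C = C - (\<bar>A\<bar> + 2 * \<bar>B\<bar>)" unfolding t_def using C by (simp add: field_simps)
    then have "t\<^sup>2 * C = t * (C - (\<bar>A\<bar> + 2 * \<bar>B\<bar>))"
      by (simp add: power2_eq_square mult.assoc)
    also have "\<dots> = t * C - t * (\<bar>A\<bar> + 2 * \<bar>B\<bar>)"
      by (simp add: right_diff_distrib)
    also have "\<dots> \<le> t * C - \<bar>A\<bar> - 2 * t * \<bar>B\<bar>"
      using t mult_right_mono[of 1 t "\<bar>A\<bar>"] by (simp add: algebra_simps)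
    finally have "t\<^sup>2 * C \<le> t * C - \<bar>A\<bar> - 2 * t * \<bar>B\<bar>" .
    moreover have "t * C < 0" using t C by (simp add: mult_pos_neg)
    moreover have "t * B \<le> t * \<bar>B\<bar>" using t by (simp add: mult_left_mono)
    ultimately show False using nn[of t] by simp
  qed
  have "A + 2 * (- B / C) * B + (- B / C)\<^sup>2 * C = A - B\<^sup>2 / C"
    using False by (simp add: power2_eq_square field_simps)
  with nn[of "- B / C"] have "B\<^sup>2 / C \<le> A" by simp
  then show ?thesis using \<open>C > 0\<close> by (simp add: field_simps)
qed

lemma scalar_prod_self_nonneg: "scalar_prod (v :: real Matrix.vec) v \<ge> 0"
  unfolding scalar_prod_def by (intro sum_nonneg) simp

text \<open>The form is nonnegative along the line through \<open>y\<close> in direction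
  \<open>x\<close>; the claim is the discriminant condition of this quadratic in \<open>t\<close>.
  \<open>B\<close> may be singular.\<close>

lemma psd_Cauchy_Schwarz:
  fixes B :: "real Matrix.mat"
  assumes B: "B \<in> carrier_mat k k" and sym: "transpose_mat B = B"
    and psd: "\<And>x :: real Matrix.vec. x \<in> carrier_vec k \<Longrightarrow> scalar_prod x (B *\<^sub>v x) \<ge> 0"
    and x: "x \<in> carrier_vec k" and y: "y \<in> carrier_vec k"
  shows "(scalar_prod y (B *\<^sub>v x))\<^sup>2 \<le> scalar_prod y (B *\<^sub>v y) * scalar_prod x (B *\<^sub>v x)"
proof (rule discriminant_le)
  fix t :: real
  have Bx: "B *\<^sub>v x \<in> carrier_vec k" and By: "B *\<^sub>v y \<in> carrier_vec k" using B x y by auto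
  have s: "scalar_prod x (B *\<^sub>v y) = scalar_prod y (B *\<^sub>v x)"
    using transpose_vec_mult_scalar[OF B x y] sym comm_scalar_prod[OF y Bx] comm_scalar_prod[OF x By]
    by simp
  have e: "B *\<^sub>v (y + t \<cdot>\<^sub>v x) = B *\<^sub>v y + t \<cdot>\<^sub>v (B *\<^sub>v x)"
    using B x y by (simp add: mult_add_distrib_mat_vec mult_mat_vec)
  have "0 \<le> scalar_prod (y + t \<cdot>\<^sub>v x) (B *\<^sub>v (y + t \<cdot>\<^sub>v x))"
    by (rule psd) (use x y in auto)
  also have "\<dots> = scalar_prod y (B *\<^sub>v y) + 2 * t * scalar_prod y (B *\<^sub>v x) + t\<^sup>2 * scalar_prod x (B *\<^sub>v x)"
    unfolding e using x y Bx By s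
    by (simp add: scalar_prod_add_distrib[of _ k] add_scalar_prod_distrib[of _ k]
        power2_eq_square algebra_simps)
  finally show "0 \<le> scalar_prod y (B *\<^sub>v y) + 2 * t * scalar_prod y (B *\<^sub>v x) + t\<^sup>2 * scalar_prod x (B *\<^sub>v x)" .
qed

lemma mat_vec_bounded:
  fixes B :: "real Matrix.mat"
  assumes B: "B \<in> carrier_mat k k"
  shows "\<exists>K>0. \<forall>x\<in>(carrier_vec k :: real Matrix.vec set). scalar_prod (B *\<^sub>v x) (B *\<^sub>v x) \<le> K * scalar_prod x x"
proof (intro exI conjI ballI)
  define K where "K = (\<Sum>i<k. \<Sum>j<k. (B $$ (i,j))\<^sup>2)"
  \<comment> \<open>\<open>K\<close> is the squared Frobenius norm and may vanish; adding 1 keeps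
    the constant positive.\<close>
  show "K + 1 > 0" unfolding K_def by (smt (verit) sum_nonneg zero_le_power2)
  fix x :: "real Matrix.vec" assume x: "x \<in> carrier_vec k"
  have xx: "scalar_prod x x = (\<Sum>j<k. (vec_index x j)\<^sup>2)"
    using x by (simp add: scalar_prod_def power2_eq_square atLeast0LessThan)
  have "scalar_prod (B *\<^sub>v x) (B *\<^sub>v x) = (\<Sum>i<k. (\<Sum>j<k. B $$ (i,j) * vec_index x j)\<^sup>2)"
    using B x by (simp add: scalar_prod_def power2_eq_square atLeast0LessThan)
  also have "\<dots> \<le> (\<Sum>i<k. (\<Sum>j<k. (B $$ (i,j))\<^sup>2) * (\<Sum>j<k. (vec_index x j)\<^sup>2))"
    by (intro sum_mono Cauchy_Schwarz_ineq_sum)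
  also have "\<dots> = K * scalar_prod x x" by (simp add: K_def xx sum_distrib_right)
  also have "\<dots> \<le> (K + 1) * scalar_prod x x"
    using scalar_prod_self_nonneg[of x] by (simp add: algebra_simps)
  finally show "scalar_prod (B *\<^sub>v x) (B *\<^sub>v x) \<le> (K + 1) * scalar_prod x x" .
qed

text \<open>Put \<open>z = B x\<close>. Cauchy-Schwarz for the form bounds the fourth power of the
  norm of \<open>z\<close> by the form at \<open>z\<close> times the form at \<open>x\<close>;
  boundedness of \<open>B\<close> removes one factor, and boundedness of the inverse passes from
  \<open>z\<close> back to \<open>x\<close>. Neither compactness of the sphere nor diagonalisation
  enters.\<close>

lemma psd_nonsingular_coercive:
  fixes B :: "real Matrix.mat"
  assumes B: "B \<in> carrier_mat k k" and sym: "transpose_mat B = B"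
    and psd: "\<And>x :: real Matrix.vec. x \<in> carrier_vec k \<Longrightarrow> scalar_prod x (B *\<^sub>v x) \<ge> 0"
    and det: "Determinant.det B \<noteq> 0"
  shows "\<exists>K>0. \<forall>x\<in>(carrier_vec k :: real Matrix.vec set). scalar_prod x x \<le> K * scalar_prod x (B *\<^sub>v x)"
proof -
  note C = minv_inverse[OF B det]
  obtain K1 where K1: "K1 > 0" "\<And>x :: real Matrix.vec. x \<in> carrier_vec k \<Longrightarrow> scalar_prod (B *\<^sub>v x) (B *\<^sub>v x) \<le> K1 * scalar_prod x x"
    using mat_vec_bounded[OF B] by auto
  obtain K2 where K2: "K2 > 0" "\<And>x :: real Matrix.vec. x \<in> carrier_vec k \<Longrightarrow> scalar_prod (minv B *\<^sub>v x) (minv B *\<^sub>v x) \<le> K2 * scalar_prod x x"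
    using mat_vec_bounded[OF C(1)] by auto
  show ?thesis
  proof (intro exI conjI ballI)
    show "K2 * (K1 + 1) > 0" using K1 K2 by simp
    fix x :: "real Matrix.vec" assume x: "x \<in> carrier_vec k"
    define z where "z = B *\<^sub>v x"
    have z: "z \<in> carrier_vec k" and Bz: "B *\<^sub>v z \<in> carrier_vec k" unfolding z_def using B x by auto
    have xz: "minv B *\<^sub>v z = x"
      unfolding z_def using assoc_mult_mat_vec[OF C(1) B x] C(3) x by simp
    have zB: "scalar_prod z (B *\<^sub>v z) \<le> (K1 + 1) * scalar_prod z z"
    proof -
      have "0 \<le> scalar_prod (z - B *\<^sub>v z) (z - B *\<^sub>v z)" by (rule scalar_prod_self_nonneg)
      also have "\<dots> = scalar_prod z z - 2 * scalar_prod z (B *\<^sub>v z) + scalar_prod (B *\<^sub>v z) (B *\<^sub>v z)"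
        using z Bz comm_scalar_prod[OF z Bz]
        by (simp add: minus_scalar_prod_distrib[of _ k] scalar_prod_minus_distrib[of _ k])
      finally show ?thesis using K1(2)[OF z] scalar_prod_self_nonneg[of z] psd[OF z] by (simp add: algebra_simps)
    qed
    have "(scalar_prod z z)\<^sup>2 \<le> scalar_prod z (B *\<^sub>v z) * scalar_prod x (B *\<^sub>v x)"
      using psd_Cauchy_Schwarz[OF B sym psd x z] by (simp add: z_def)
    also have "\<dots> \<le> (K1 + 1) * scalar_prod z z * scalar_prod x (B *\<^sub>v x)"
      by (rule mult_right_mono[OF zB psd[OF x]])
    finally have zz: "scalar_prod z z * scalar_prod z z \<le> ((K1 + 1) * scalar_prod x (B *\<^sub>v x)) * scalar_prod z z"
      by (simp add: power2_eq_square algebra_simps)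
    have "scalar_prod z z \<le> (K1 + 1) * scalar_prod x (B *\<^sub>v x)"
    proof (cases "scalar_prod z z = 0")
      case True
      then show ?thesis using K1 psd[OF x] by simp
    next
      case False
      then have "scalar_prod z z > 0" using scalar_prod_self_nonneg[of z] by linarith
      with zz show ?thesis by (rule mult_right_le_imp_le)
    qed
    with K2(2)[OF z] K2(1) show "scalar_prod x x \<le> K2 * (K1 + 1) * scalar_prod x (B *\<^sub>v x)"
      unfolding xz by (smt (verit) mult_left_mono mult.assoc)
  qed
qed

text \<open>With \<open>\<mu>\<close> the supremum of the quadratic form on the unit sphere, \<open>\<mu> I - A\<close> is positive
  semidefinite but not coercive, hence singular; so \<open>\<mu>\<close> is an eigenvalue.\<close>

lemma quadratic_form_le_eigenvalue_bound:
  fixes A :: "real Matrix.mat"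
  assumes A: "A \<in> carrier_mat k k" and sym: "transpose_mat A = A"
    and ev: "\<And>l. eigenvalue A l \<Longrightarrow> l \<le> L"
    and y: "y \<in> carrier_vec k"
  shows "scalar_prod y (A *\<^sub>v y) \<le> L * scalar_prod y y"
proof (rule ccontr)
  assume neg: "\<not> ?thesis"
  have y0: "scalar_prod y y > 0"
  proof (rule ccontr)
    assume "\<not> scalar_prod y y > 0"
    then have "scalar_prod y y = 0" using scalar_prod_self_nonneg[of y] by linarith
    with y have "y = 0\<^sub>v k" by (rule scalar_prod_self_eq_0)
    with neg A show False by simp
  qed
  define R where "R = (\<lambda>x. scalar_prod x (A *\<^sub>v x)) ` {x \<in> (carrier_vec k :: real Matrix.vec set). scalar_prod x x = 1}"
  define \<mu> where "\<mu> = Sup R"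
  obtain K where K: "K > 0" "\<And>x :: real Matrix.vec. x \<in> carrier_vec k \<Longrightarrow> scalar_prod (A *\<^sub>v x) (A *\<^sub>v x) \<le> K * scalar_prod x x"
    using mat_vec_bounded[OF A] by auto
  have bdd: "bdd_above R"
  proof (rule bdd_aboveI)
    fix r assume "r \<in> R"
    then obtain x where x: "x \<in> carrier_vec k" "scalar_prod x x = 1" "r = scalar_prod x (A *\<^sub>v x)"
      unfolding R_def by auto
    have Ax: "A *\<^sub>v x \<in> carrier_vec k" using A x by auto
    have "0 \<le> scalar_prod (x - A *\<^sub>v x) (x - A *\<^sub>v x)" by (rule scalar_prod_self_nonneg)
    also have "\<dots> = scalar_prod x x - 2 * scalar_prod x (A *\<^sub>v x) + scalar_prod (A *\<^sub>v x) (A *\<^sub>v x)"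
      using x Ax comm_scalar_prod[OF x(1) Ax]
      by (simp add: minus_scalar_prod_distrib[of _ k] scalar_prod_minus_distrib[of _ k])
    finally show "r \<le> (1 + K) / 2" using K(2)[OF x(1)] x by simp
  qed
  have scale: "\<exists>r\<in>R. scalar_prod x (A *\<^sub>v x) = r * scalar_prod x x"
    if x: "x \<in> carrier_vec k" and pos: "scalar_prod x x > 0" for x :: "real Matrix.vec"
  proof -
    define c where "c = 1 / sqrt (scalar_prod x x)"
    have c2: "c * c * scalar_prod x x = 1" unfolding c_def using pos by simp
    have cx: "c \<cdot>\<^sub>v x \<in> carrier_vec k" using x by simp
    have "scalar_prod (c \<cdot>\<^sub>v x) (c \<cdot>\<^sub>v x) = 1" using x c2 by (simp add: mult.assoc)
    then have m: "scalar_prod (c \<cdot>\<^sub>v x) (A *\<^sub>v (c \<cdot>\<^sub>v x)) \<in> R" unfolding R_def using cx by auto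
    have "A *\<^sub>v x \<in> carrier_vec k" using A x by auto
    then have "scalar_prod (c \<cdot>\<^sub>v x) (A *\<^sub>v (c \<cdot>\<^sub>v x)) = c * c * scalar_prod x (A *\<^sub>v x)"
      using A x by (simp add: mult_mat_vec)
    then show ?thesis using m c2
      by (intro bexI[OF _ m]) (metis mult.assoc mult.commute mult.left_neutral)
  qed
  have "\<mu> > L"
  proof -
    obtain r where r: "r \<in> R" "scalar_prod y (A *\<^sub>v y) = r * scalar_prod y y" using scale[OF y y0] by auto
    with neg have "r > L" using y0 by simp
    with cSup_upper[OF r(1) bdd] show ?thesis unfolding \<mu>_def by simp
  qed
  define B where "B = \<mu> \<cdot>\<^sub>m 1\<^sub>m k - A"
  have B: "B \<in> carrier_mat k k" unfolding B_def using A by auto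
  have Bsym: "transpose_mat B = B"
    using sym A unfolding B_def
    by (subst transpose_minus[of _ k k]) (auto intro!: eq_matI)
  have Bv: "B *\<^sub>v x = \<mu> \<cdot>\<^sub>v x - A *\<^sub>v x" if "x \<in> carrier_vec k" for x :: "real Matrix.vec"
  proof -
    have "(\<mu> \<cdot>\<^sub>m 1\<^sub>m k) *\<^sub>v x = \<mu> \<cdot>\<^sub>v x"
      using that by (intro eq_vecI)
        (auto simp: scalar_prod_def if_distrib if_distribR sum.delta cong: if_cong)
    then show ?thesis
      unfolding B_def using minus_mult_distrib_mat_vec[of "\<mu> \<cdot>\<^sub>m 1\<^sub>m k" k k A x] that A by simp
  qed
  have Bf: "scalar_prod x (B *\<^sub>v x) = \<mu> * scalar_prod x x - scalar_prod x (A *\<^sub>v x)"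
    if x: "x \<in> carrier_vec k" for x :: "real Matrix.vec"
  proof -
    have "A *\<^sub>v x \<in> carrier_vec k" using A x by auto
    then show ?thesis unfolding Bv[OF x] using x by (simp add: scalar_prod_minus_distrib[of _ k])
  qed
  have psd: "scalar_prod x (B *\<^sub>v x) \<ge> 0" if x: "x \<in> carrier_vec k" for x :: "real Matrix.vec"
  proof (cases "scalar_prod x x = 0")
    case True
    with x have "x = 0\<^sub>v k" by (rule scalar_prod_self_eq_0)
    then show ?thesis using B by simp
  next
    case False
    then have pos: "scalar_prod x x > 0" using scalar_prod_self_nonneg[of x] by linarith
    obtain r where r: "r \<in> R" "scalar_prod x (A *\<^sub>v x) = r * scalar_prod x x" using scale[OF x pos] by auto
    have "r \<le> \<mu>" unfolding \<mu>_def by (rule cSup_upper[OF r(1) bdd])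
    then show ?thesis unfolding Bf[OF x] r(2) using pos by simp
  qed
  have det: "Determinant.det B \<noteq> 0"
  proof
    assume "Determinant.det B = 0"
    then obtain v where v: "v \<in> carrier_vec k" "v \<noteq> 0\<^sub>v k" "B *\<^sub>v v = 0\<^sub>v k"
      using det_0_iff_vec_prod_zero[OF B] by auto
    have Av: "A *\<^sub>v v \<in> carrier_vec k" using A v by auto
    have "A *\<^sub>v v = \<mu> \<cdot>\<^sub>v v"
    proof (rule eq_vecI)
      fix i assume "i < dim_vec (\<mu> \<cdot>\<^sub>v v)"
      then have i: "i < k" using v by simp
      have "vec_index (B *\<^sub>v v) i = 0" using v i by simp
      then show "vec_index (A *\<^sub>v v) i = vec_index (\<mu> \<cdot>\<^sub>v v) i"
        unfolding Bv[OF v(1)] using i v A by (simp del: index_mult_mat_vec)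
    qed (use v A in auto)
    then have "eigenvalue A \<mu>" unfolding eigenvalue_def eigenvector_def using v A by auto
    with ev \<open>\<mu> > L\<close> show False by force
  qed
  obtain C where C: "C > 0" "\<And>x :: real Matrix.vec. x \<in> carrier_vec k \<Longrightarrow> scalar_prod x x \<le> C * scalar_prod x (B *\<^sub>v x)"
    using psd_nonsingular_coercive[OF B Bsym psd det] by auto
  \<comment> \<open>Coercivity of \<open>B\<close> keeps the form of \<open>A\<close> at least
    \<open>1 / C\<close> below \<mu> on the whole unit sphere, against the choice of \<mu> as a
    supremum.\<close>
  have "\<mu> \<le> \<mu> - 1 / C"
    unfolding \<mu>_def
  proof (rule cSup_least)
    show "R \<noteq> {}" using scale[OF y y0] by auto
    fix r assume "r \<in> R"
    then obtain x where x: "x \<in> carrier_vec k" "scalar_prod x x = 1" "r = scalar_prod x (A *\<^sub>v x)"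
      unfolding R_def by auto
    show "r \<le> Sup R - 1 / C" using C(2)[OF x(1)] C(1) Bf[OF x(1)] x
      by (simp add: field_simps \<mu>_def)
  qed
  with C(1) show False by simp
qed

section \<open>The Gram form in coordinates\<close>

definition fitted :: "real Matrix.mat \<Rightarrow> (nat \<Rightarrow> real) \<Rightarrow> nat \<Rightarrow> real" where
  "fitted X f i = (\<Sum>j<dim_col X. X $$ (i, j) * f j)"

text \<open>The quadratic form of \<open>gram X\<close>. Coefficient vectors are plain functions
  here because the integrals run over a product measure on functions; \<open>Matrix.vec\<close>
  links them to the carrier-based vectors.\<close>

definition gform :: "real Matrix.mat \<Rightarrow> (nat \<Rightarrow> real) \<Rightarrow> real" where
  "gform X f = (\<Sum>i<dim_row X. (fitted X f i)\<^sup>2)"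

text \<open>The functions \<open>dual X j\<close> represent the coordinate functionals with respect to the
  inner product \<open>gform X\<close>.\<close>

definition dual :: "real Matrix.mat \<Rightarrow> nat \<Rightarrow> nat \<Rightarrow> real" where
  "dual X j l = minv (gram X) $$ (l, j)"

lemma gform_nonneg: "gform X f \<ge> 0"
  unfolding gform_def by (intro sum_nonneg) simp

lemma mult_mat_vec_fitted:
  "X *\<^sub>v Matrix.vec (dim_col X) f = Matrix.vec (dim_row X) (fitted X f)"
  by (rule eq_vecI) (auto simp: fitted_def scalar_prod_def atLeast0LessThan)

lemma gform_scalar_prod:
  "gform X f = scalar_prod (X *\<^sub>v Matrix.vec (dim_col X) f) (X *\<^sub>v Matrix.vec (dim_col X) f)"
  unfolding mult_mat_vec_fitted gform_def
  by (simp add: scalar_prod_def power2_eq_square atLeast0LessThan)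

lemma fitted_scalar_prod:
  "(\<Sum>i<dim_row X. fitted X f i * fitted X h i)
    = scalar_prod (X *\<^sub>v Matrix.vec (dim_col X) f) (X *\<^sub>v Matrix.vec (dim_col X) h)"
  unfolding mult_mat_vec_fitted
  by (simp add: scalar_prod_def atLeast0LessThan)

lemma smult_mat_mult_vec:
  fixes A :: "real Matrix.mat"
  assumes A: "A \<in> carrier_mat n k" and x: "x \<in> carrier_vec k"
  shows "(c \<cdot>\<^sub>m A) *\<^sub>v x = c \<cdot>\<^sub>v (A *\<^sub>v x)"
proof (rule eq_vecI)
  fix i assume "i < dim_vec (c \<cdot>\<^sub>v (A *\<^sub>v x))"
  then have i: "i < n" using A by simp
  have "vec_index ((c \<cdot>\<^sub>m A) *\<^sub>v x) i = (\<Sum>j<k. c * A $$ (i, j) * vec_index x j)"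
    using i A x by (simp add: scalar_prod_def atLeast0LessThan)
  also have "\<dots> = c * (\<Sum>j<k. A $$ (i, j) * vec_index x j)"
    by (simp add: sum_distrib_left mult.assoc)
  also have "(\<Sum>j<k. A $$ (i, j) * vec_index x j) = vec_index (A *\<^sub>v x) i"
    using i A x by (simp add: scalar_prod_def atLeast0LessThan)
  finally show "vec_index ((c \<cdot>\<^sub>m A) *\<^sub>v x) i = vec_index (c \<cdot>\<^sub>v (A *\<^sub>v x)) i"
    using i A by simp
qed (use A in simp)

context
  fixes X :: "real Matrix.mat" and n k :: nat
  assumes X: "X \<in> carrier_mat n k" and rank: "vec_space.rank n X = k"
begin

lemmas gram_c = gram_carrier[OF X]
lemmas inv_gram = minv_inverse[OF gram_c det_gram_nonzero[OF X rank]]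

lemma gram_symmetric: "transpose_mat (gram X) = gram X"
  unfolding gram_def using X transpose_mult[of "transpose_mat X" k n X k] by auto

lemma inv_gram_symmetric: "transpose_mat (minv (gram X)) = minv (gram X)"
proof -
  have "transpose_mat (minv (gram X) * gram X) = gram X * transpose_mat (minv (gram X))"
    using transpose_mult[OF inv_gram(1) gram_c] gram_symmetric by simp
  then have "gram X * transpose_mat (minv (gram X)) = 1\<^sub>m k"
    unfolding inv_gram(3) by simp
  from minv_unique[OF gram_c _ this] inv_gram(1) show ?thesis by simp
qed

lemma det_inv_gram_nonzero: "Determinant.det (minv (gram X)) \<noteq> 0"
  using det_mult[OF gram_c inv_gram(1)] inv_gram(2) by auto

lemma gram_inv_apply:
  assumes x: "x \<in> carrier_vec k"
  shows "gram X *\<^sub>v (minv (gram X) *\<^sub>v x) = x" "minv (gram X) *\<^sub>v (gram X *\<^sub>v x) = x"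
  using assoc_mult_mat_vec[OF gram_c inv_gram(1) x] assoc_mult_mat_vec[OF inv_gram(1) gram_c x]
    inv_gram x by simp_all

lemma inv_gram_form:
  assumes x: "x \<in> carrier_vec k"
  shows "scalar_prod x (minv (gram X) *\<^sub>v x)
    = scalar_prod (X *\<^sub>v (minv (gram X) *\<^sub>v x)) (X *\<^sub>v (minv (gram X) *\<^sub>v x))"
proof -
  have c: "minv (gram X) *\<^sub>v x \<in> carrier_vec k" using inv_gram(1) x by auto
  show ?thesis
    using gram_form[OF X c c] gram_inv_apply(1)[OF x] comm_scalar_prod[OF x c] by simp
qed

lemma dual_vec: "j < k \<Longrightarrow> Matrix.vec k (dual X j) = minv (gram X) *\<^sub>v unit_vec k j"
  using inv_gram(1) by (intro eq_vecI) (auto simp: dual_def)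

lemma fitted_dual:
  assumes j: "j < k"
  shows "(\<Sum>i<n. fitted X f i * fitted X (dual X j) i) = f j"
proof -
  have c: "Matrix.vec k f \<in> carrier_vec k" "Matrix.vec k (dual X j) \<in> carrier_vec k" by auto
  have "(\<Sum>i<n. fitted X f i * fitted X (dual X j) i)
    = scalar_prod (Matrix.vec k f) (gram X *\<^sub>v Matrix.vec k (dual X j))"
    using fitted_scalar_prod[of X f "dual X j"] gram_form[OF X c] X by simp
  also have "\<dots> = scalar_prod (Matrix.vec k f) (unit_vec k j)"
    unfolding dual_vec[OF j] by (simp add: gram_inv_apply)
  also have "\<dots> = f j" using j by simp
  finally show ?thesis .
qed

lemma gform_dual: "j < k \<Longrightarrow> gform X (dual X j) = dual X j j"
  using fitted_dual[of j "dual X j"] X by (simp add: gform_def power2_eq_square)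

lemma ls_estimator_carrier: "ls_estimator X y \<in> carrier_vec k"
  unfolding ls_estimator_def using inv_gram(1) by (intro carrier_vecI) simp

lemma ls_estimator_index:
  assumes y: "y \<in> carrier_vec n" and j: "j < k"
  shows "vec_index (ls_estimator X y) j = (\<Sum>i<n. fitted X (dual X j) i * vec_index y i)"
proof -
  have Xy: "transpose_mat X *\<^sub>v y \<in> carrier_vec k" using X y by auto
  have "vec_index (ls_estimator X y) j
    = scalar_prod (unit_vec k j) (minv (gram X) *\<^sub>v (transpose_mat X *\<^sub>v y))"
    unfolding ls_estimator_def[symmetric] using j ls_estimator_carrier[of y] by simp
  also have "\<dots> = scalar_prod (minv (gram X) *\<^sub>v unit_vec k j) (transpose_mat X *\<^sub>v y)"
    using transpose_vec_mult_scalar[OF inv_gram(1) Xy, of "unit_vec k j"] inv_gram_symmetric Xy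
    by simp
  also have "\<dots> = scalar_prod (Matrix.vec k (dual X j)) (transpose_mat X *\<^sub>v y)"
    unfolding dual_vec[OF j] ..
  also have "\<dots> = scalar_prod (X *\<^sub>v Matrix.vec k (dual X j)) y"
    using transpose_vec_mult_scalar[OF X, of "Matrix.vec k (dual X j)" y] X y
    by (simp add: comm_scalar_prod[of _ k] comm_scalar_prod[of _ n])
  also have "\<dots> = (\<Sum>i<n. fitted X (dual X j) i * vec_index y i)"
    using mult_mat_vec_fitted[of X "dual X j"] X y by (simp add: scalar_prod_def atLeast0LessThan)
  finally show ?thesis .
qed

lemma mvn_exponent:
  assumes v: "v \<noteq> 0" and x: "x \<in> carrier_vec k" "m \<in> carrier_vec k"
  shows "scalar_prod (x - m) (minv (v \<cdot>\<^sub>m minv (gram X)) *\<^sub>v (x - m))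
    = gform X (\<lambda>j. vec_index x j - vec_index m j) / v"
proof -
  have xm: "x - m \<in> carrier_vec k" using x by auto
  have e: "x - m = Matrix.vec k (\<lambda>j. vec_index x j - vec_index m j)" using x by auto
  have "minv (minv (gram X)) = gram X"
    by (rule minv_unique[OF inv_gram(1) gram_c inv_gram(3)])
  then have "minv (v \<cdot>\<^sub>m minv (gram X)) = (1 / v) \<cdot>\<^sub>m gram X"
    using minv_smult[OF inv_gram(1) det_inv_gram_nonzero v] by simp
  moreover have "((1 / v) \<cdot>\<^sub>m gram X) *\<^sub>v (x - m) = (1 / v) \<cdot>\<^sub>v (gram X *\<^sub>v (x - m))"
    by (rule smult_mat_mult_vec[OF gram_c xm])
  moreover have "gram X *\<^sub>v (x - m) \<in> carrier_vec k" using gram_c xm by auto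
  ultimately have "scalar_prod (x - m) (minv (v \<cdot>\<^sub>m minv (gram X)) *\<^sub>v (x - m))
    = (1 / v) * scalar_prod (x - m) (gram X *\<^sub>v (x - m))"
    using xm by simp
  also have "scalar_prod (x - m) (gram X *\<^sub>v (x - m)) = gform X (\<lambda>j. vec_index x j - vec_index m j)"
    unfolding gform_scalar_prod using gram_form[OF X xm xm] e X by simp
  finally show ?thesis by simp
qed

lemma inv_gram_form_le:
  assumes n: "n > 0" and ev: "\<And>l. eigenvalue (real n \<cdot>\<^sub>m minv (gram X)) l \<Longrightarrow> l \<le> L"
    and x: "x \<in> carrier_vec k"
  shows "scalar_prod x (minv (gram X) *\<^sub>v x) \<le> L / real n * scalar_prod x x"
proof -
  let ?M = "real n \<cdot>\<^sub>m minv (gram X)"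
  have M: "?M \<in> carrier_mat k k" using inv_gram(1) by auto
  have sym: "transpose_mat ?M = ?M"
  proof (rule eq_matI)
    fix i j assume "i < dim_row ?M" "j < dim_col ?M"
    then have ij: "i < k" "j < k" using inv_gram(1) by auto
    have "minv (gram X) $$ (j, i) = transpose_mat (minv (gram X)) $$ (i, j)"
      using ij inv_gram(1) by auto
    then show "transpose_mat ?M $$ (i, j) = ?M $$ (i, j)"
      using ij inv_gram(1) inv_gram_symmetric by auto
  qed (use inv_gram(1) in auto)
  have "?M *\<^sub>v x = real n \<cdot>\<^sub>v (minv (gram X) *\<^sub>v x)"
    by (rule smult_mat_mult_vec[OF inv_gram(1) x])
  moreover have "minv (gram X) *\<^sub>v x \<in> carrier_vec k" using inv_gram(1) x by auto
  ultimately have "scalar_prod x (?M *\<^sub>v x) = real n * scalar_prod x (minv (gram X) *\<^sub>v x)"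
    using x by simp
  with quadratic_form_le_eigenvalue_bound[OF M sym ev x] n show ?thesis by (simp add: field_simps)
qed

text \<open>Up to the noise level, \<open>dual X j j\<close> is the variance of the
  \<open>j\<close>-th coefficient, for the least squares estimator as well as (with further factors)
  for the conditional posterior. Its order \<open>1 / n\<close> is what makes the tail bounds of
  both exponentially small in \<open>n\<close>.\<close>

lemma dual_diag_le:
  assumes n: "n > 0" and ev: "\<And>l. eigenvalue (real n \<cdot>\<^sub>m minv (gram X)) l \<Longrightarrow> l \<le> L"
    and j: "j < k"
  shows "dual X j j \<le> L / real n"
proof -
  have "scalar_prod (unit_vec k j) (minv (gram X) *\<^sub>v unit_vec k j) = dual X j j"
    unfolding dual_vec[OF j, symmetric] using j by simp
  then show ?thesis using inv_gram_form_le[OF n ev, of "unit_vec k j"] j by simp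
qed

text \<open>An upper bound for the inverse of \<open>gram X\<close> is turned into a lower bound for
  \<open>gram X\<close>: with \<open>w = gram X x\<close>, Cauchy-Schwarz for the inverse form
  applied to \<open>x\<close> and \<open>w\<close> has the squared norm of \<open>x\<close> on its
  left side and \<open>gform X f\<close> as one factor on its right.\<close>

lemma sum_squares_le_gform:
  assumes n: "n > 0" and ev: "\<And>l. eigenvalue (real n \<cdot>\<^sub>m minv (gram X)) l \<Longrightarrow> l \<le> L"
  shows "(\<Sum>j<k. (f j)\<^sup>2) \<le> L / real n * gform X f"
proof -
  define x where "x = Matrix.vec k f"
  have x: "x \<in> carrier_vec k" unfolding x_def by simp
  define w where "w = gram X *\<^sub>v x"
  have w: "w \<in> carrier_vec k" unfolding w_def using gram_c x by auto
  have xx: "scalar_prod x x = (\<Sum>j<k. (f j)\<^sup>2)"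
    unfolding x_def by (simp add: scalar_prod_def power2_eq_square atLeast0LessThan)
  have psd: "scalar_prod y (minv (gram X) *\<^sub>v y) \<ge> 0" if "y \<in> carrier_vec k" for y
    unfolding inv_gram_form[OF that] by (rule scalar_prod_self_nonneg)
  have q: "scalar_prod w (minv (gram X) *\<^sub>v w) = gform X f"
    unfolding gform_scalar_prod w_def gram_inv_apply(2)[OF x]
    using gram_form[OF X x x] comm_scalar_prod[OF x w] X by (simp add: w_def x_def)
  have "(scalar_prod x (minv (gram X) *\<^sub>v w))\<^sup>2
    \<le> scalar_prod x (minv (gram X) *\<^sub>v x) * scalar_prod w (minv (gram X) *\<^sub>v w)"
    by (rule psd_Cauchy_Schwarz[OF inv_gram(1) inv_gram_symmetric psd w x])
  also have "minv (gram X) *\<^sub>v w = x" unfolding w_def by (rule gram_inv_apply(2)[OF x])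
  also have "scalar_prod x (minv (gram X) *\<^sub>v x) * scalar_prod w x
    \<le> (L / real n * scalar_prod x x) * scalar_prod w x"
    using inv_gram_form_le[OF n ev x] q gform_nonneg[of X f]
    by (intro mult_right_mono) (auto simp: w_def gram_inv_apply(2)[OF x])
  finally have le: "scalar_prod x x * scalar_prod x x \<le> (L / real n * gform X f) * scalar_prod x x"
    using q by (simp add: w_def gram_inv_apply(2)[OF x] power2_eq_square algebra_simps)
  show ?thesis
  proof (cases "scalar_prod x x = 0")
    case True
    then have "x = 0\<^sub>v k" by (rule scalar_prod_self_eq_0[OF x])
    then have "X *\<^sub>v x = 0\<^sub>v n" using X by (intro eq_vecI) auto
    then have "gform X f = 0"
      unfolding gform_scalar_prod using X by (simp add: x_def)
    then show ?thesis using True xx by simp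
  next
    case False
    then have "scalar_prod x x > 0" using scalar_prod_self_nonneg[of x] by linarith
    with le have "scalar_prod x x \<le> L / real n * gform X f" by (rule mult_right_le_imp_le)
    then show ?thesis unfolding xx .
  qed
qed

end

section \<open>Affine substitution in product and inverse Gamma integrals\<close>

text \<open>A product measure is determined by its values on boxes, where each side contributes one
  factor \<open>c\<close>.\<close>

lemma PiM_lborel_affine:
  fixes c :: real and t :: "nat \<Rightarrow> real"
  assumes I: "finite I" and c: "c > 0"
  shows "density (distr (PiM I (\<lambda>_. lborel)) (PiM I (\<lambda>_. lborel)) (\<lambda>x. \<lambda>i\<in>I. t i + c * x i))
           (\<lambda>_. ennreal (c ^ card I)) = PiM I (\<lambda>_. lborel)" (is "?D = _")
proof -
  interpret product_sigma_finite "\<lambda>_::nat. lborel :: real measure" ..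
  have m[measurable]: "(\<lambda>x. \<lambda>i\<in>I. t i + c * x i) \<in> measurable (PiM I (\<lambda>_. lborel)) (PiM I (\<lambda>_. lborel))"
    by (intro measurable_restrict) simp
  show ?thesis
  proof (rule PiM_eqI[OF I])
    show "sets ?D = sets (PiM I (\<lambda>_. lborel))" by simp
    fix A :: "nat \<Rightarrow> real set" assume A: "\<And>i. i \<in> I \<Longrightarrow> A i \<in> sets lborel"
    have box: "Pi\<^sub>E I A \<in> sets (PiM I (\<lambda>_. lborel))"
      by (rule sets_PiM_I_finite[OF I A])
    let ?B = "\<lambda>i. (\<lambda>x. t i + c * x) -` A i"
    have B: "?B i \<in> sets lborel" if "i \<in> I" for i
      using measurable_sets_borel[of "\<lambda>x. t i + c * x" borel "A i"] A[OF that] by simp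
    have pre: "(\<lambda>x. \<lambda>i\<in>I. t i + c * x i) -` Pi\<^sub>E I A \<inter> space (PiM I (\<lambda>_. lborel)) = Pi\<^sub>E I ?B"
      by (auto simp: space_PiM PiE_def Pi_def)
    have "emeasure ?D (Pi\<^sub>E I A) = ennreal (c ^ card I) * emeasure (PiM I (\<lambda>_. lborel)) (Pi\<^sub>E I ?B)"
      using box by (simp add: emeasure_density_const emeasure_distr pre)
    also have "\<dots> = (\<Prod>i\<in>I. ennreal c) * (\<Prod>i\<in>I. emeasure lborel (?B i))"
      using c by (subst emeasure_PiM[OF I B]) (simp_all add: ennreal_power)
    also have "\<dots> = (\<Prod>i\<in>I. ennreal c * emeasure lborel (?B i))"
      by (rule prod.distrib[symmetric])
    also have "\<dots> = (\<Prod>i\<in>I. emeasure lborel (A i))"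
    proof (rule prod.cong[OF refl])
      fix i assume i: "i \<in> I"
      have "emeasure lborel (A i) = emeasure (density (distr lborel borel (\<lambda>x. t i + c * x)) (\<lambda>_. ennreal (abs c))) (A i)"
        using lborel_real_affine[of c "t i"] c by simp
      also have "\<dots> = ennreal c * emeasure lborel (?B i)"
        using A[OF i] c by (simp add: emeasure_density_const emeasure_distr)
      finally show "ennreal c * emeasure lborel (?B i) = emeasure lborel (A i)" by simp
    qed
    finally show "emeasure ?D (Pi\<^sub>E I A) = (\<Prod>i\<in>I. emeasure lborel (A i))" .
  qed
qed

lemma nn_integral_PiM_lborel_affine:
  fixes c :: real and t :: "nat \<Rightarrow> real"
  assumes I: "finite I" and c: "c > 0" and f: "f \<in> borel_measurable (PiM I (\<lambda>_. lborel))"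
  shows "(\<integral>\<^sup>+x. f x \<partial>PiM I (\<lambda>_. lborel))
    = ennreal (c ^ card I) * (\<integral>\<^sup>+x. f (\<lambda>i\<in>I. t i + c * x i) \<partial>PiM I (\<lambda>_. lborel))"
proof -
  have m[measurable]: "(\<lambda>x. \<lambda>i\<in>I. t i + c * x i) \<in> measurable (PiM I (\<lambda>_. lborel)) (PiM I (\<lambda>_. lborel))"
    by (intro measurable_restrict) simp
  note f[measurable]
  show ?thesis
    by (subst PiM_lborel_affine[OF I c, of t, symmetric])
       (simp add: nn_integral_density nn_integral_distr nn_integral_cmult)
qed

text \<open>Substitution of \<open>U * v\<close> for \<open>v\<close>. The remaining integral is
  free of \<open>U\<close>, hence later of \<open>g\<close>, so it cancels in Bayes' formula without
  being evaluated.\<close>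

lemma nn_integral_inv_gamma_scale:
  assumes N: "N > (0::real)" and U: "U > 0"
  shows "(\<integral>\<^sup>+v\<in>{0<..}. ennreal (v powr (- N - 1) * exp (- U / (2 * v))) \<partial>lborel)
       = ennreal (U powr (- N)) * (\<integral>\<^sup>+v\<in>{0<..}. ennreal (v powr (- N - 1) * exp (- 1 / (2 * v))) \<partial>lborel)"
proof -
  have "(\<integral>\<^sup>+v\<in>{0<..}. ennreal (v powr (- N - 1) * exp (- U / (2 * v))) \<partial>lborel)
     = ennreal U * (\<integral>\<^sup>+v. ennreal ((0 + U * v) powr (- N - 1) * exp (- U / (2 * (0 + U * v)))) * indicator {0<..} (0 + U * v) \<partial>lborel)"
    using U by (subst nn_integral_real_affine[of _ U 0]) (auto simp: abs_of_pos)
  also have "\<dots> = ennreal U * (\<integral>\<^sup>+v. ennreal (U powr (- N - 1)) * (ennreal (v powr (- N - 1) * exp (- 1 / (2 * v))) * indicator {0<..} v) \<partial>lborel)"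
  proof (rule arg_cong2[where f="(*)", OF refl nn_integral_cong])
    fix v :: real
    show "ennreal ((0 + U * v) powr (- N - 1) * exp (- U / (2 * (0 + U * v)))) * indicator {0<..} (0 + U * v)
      = ennreal (U powr (- N - 1)) * (ennreal (v powr (- N - 1) * exp (- 1 / (2 * v))) * indicator {0<..} v)"
    proof (cases "v > 0")
      case True
      then have "(0 + U * v) powr (- N - 1) * exp (- U / (2 * (0 + U * v)))
        = U powr (- N - 1) * (v powr (- N - 1) * exp (- 1 / (2 * v)))"
        using U by (simp add: powr_mult)
      then show ?thesis using True U by (simp add: ennreal_mult mult.assoc)
    next
      case False
      then show ?thesis using U by (simp add: zero_less_mult_iff)
    qed
  qed
  also have "\<dots> = ennreal U * (ennreal (U powr (- N - 1)) * (\<integral>\<^sup>+v\<in>{0<..}. ennreal (v powr (- N - 1) * exp (- 1 / (2 * v))) \<partial>lborel))"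
    by (subst nn_integral_cmult) auto
  also have "\<dots> = ennreal (U * U powr (- N - 1)) * (\<integral>\<^sup>+v\<in>{0<..}. ennreal (v powr (- N - 1) * exp (- 1 / (2 * v))) \<partial>lborel)"
    using U by (simp add: ennreal_mult mult.assoc)
  also have "U * U powr (- N - 1) = U powr (- N)" using U by (simp add: powr_diff)
  finally show ?thesis .
qed

text \<open>Near 0 the exponential beats the power, so the integrand is below 1 there; away from 0
  the power alone is integrable because \<open>N > 0\<close>.\<close>

lemma nn_integral_inv_gamma_finite:
  assumes N: "N > (0::real)"
  shows "(\<integral>\<^sup>+v\<in>{0<..}. ennreal (v powr (- N - 1) * exp (- 1 / (2 * v))) \<partial>lborel) < \<infinity>"
proof -
  have lim: "((\<lambda>v::real. v powr (- N - 1) * exp (- 1 / (2 * v))) \<longlongrightarrow> 0) (at_right 0)"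
    by real_asymp
  then have "eventually (\<lambda>v::real. v powr (- N - 1) * exp (- 1 / (2 * v)) < 1) (at_right 0)"
    by (rule order_tendstoD) simp
  then obtain d where d: "d > 0" "\<And>v. 0 < v \<Longrightarrow> v < d \<Longrightarrow> v powr (- N - 1) * exp (- 1 / (2 * v)) < 1"
    unfolding eventually_at_right_field by auto
  have "(\<integral>\<^sup>+v\<in>{0<..}. ennreal (v powr (- N - 1) * exp (- 1 / (2 * v))) \<partial>lborel)
     \<le> (\<integral>\<^sup>+v. indicator {0..d} v + ennreal (v powr (- N - 1)) * indicator {d..} v \<partial>lborel)"
  proof (rule nn_integral_mono)
    fix v :: real
    consider "v \<le> 0" | "0 < v" "v < d" | "d \<le> v" by linarith
    then show "ennreal (v powr (- N - 1) * exp (- 1 / (2 * v))) * indicator {0<..} v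
       \<le> indicator {0..d} v + ennreal (v powr (- N - 1)) * indicator {d..} v"
    proof cases
      case 2
      then show ?thesis using d(2)[of v] by (simp add: ennreal_le_1)
    next
      case 3
      then have "v powr (- N - 1) * exp (- 1 / (2 * v)) \<le> v powr (- N - 1) * 1"
        using d by (intro mult_left_mono) auto
      then have "ennreal (v powr (- N - 1) * exp (- 1 / (2 * v))) \<le> indicator {0..d} v + ennreal (v powr (- N - 1))"
        by (intro add_increasing ennreal_leI) auto
      then show ?thesis using 3 d by simp
    qed auto
  qed
  also have "\<dots> = ennreal d + (\<integral>\<^sup>+v. ennreal (v powr (- N - 1)) * indicator {d..} v \<partial>lborel)"
    using d by (subst nn_integral_add) auto
  also have "(\<integral>\<^sup>+v. ennreal (v powr (- N - 1)) * indicator {d..} v \<partial>lborel) = ennreal (- (d powr (- N)) / (- N))"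
  proof -
    have "((\<lambda>v. v powr (- N - 1)) has_integral - (d powr (- N - 1 + 1)) / (- N - 1 + 1)) {d..}"
      using N d by (intro has_integral_powr_to_inf) auto
    then have "(\<integral>\<^sup>+v. ennreal (indicator {d..} v * v powr (- N - 1)) \<partial>lborel) = ennreal (- (d powr (- N)) / (- N))"
      using nn_integral_has_integral_lebesgue[of "{d..}" "\<lambda>v. v powr (- N - 1)" "- (d powr (- N)) / (- N)"] d
      by (simp add: nn_integral_completion)
    moreover have "ennreal (indicator {d..} v * v powr (- N - 1)) = ennreal (v powr (- N - 1)) * indicator {d..} v" for v
      by (simp add: indicator_def)
    ultimately show ?thesis by simp
  qed
  also have "ennreal d + ennreal (- (d powr (- N)) / (- N)) < \<infinity>" by simp
  finally show ?thesis .
qed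

lemma nn_integral_inv_gamma_pos:
  "(\<integral>\<^sup>+v\<in>{0<..}. ennreal (v powr (- N - 1) * exp (- 1 / (2 * v))) \<partial>lborel) > 0"
proof -
  have "(\<integral>\<^sup>+v\<in>{0<..}. ennreal (v powr (- N - 1) * exp (- 1 / (2 * v))) \<partial>lborel) \<noteq> 0"
  proof
    assume "(\<integral>\<^sup>+v\<in>{0<..}. ennreal (v powr (- N - 1) * exp (- 1 / (2 * v))) \<partial>lborel) = 0"
    then have "AE v in lborel. ennreal (v powr (- N - 1) * exp (- 1 / (2 * v))) * indicator {0<..} v = 0"
      by (subst (asm) nn_integral_0_iff_AE) auto
    then have "AE v in lborel. v \<notin> {0<..(1::real)}"
      by eventually_elim (auto simp: indicator_def split: if_splits)
    then have "{0<..(1::real)} \<in> null_sets lborel"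
      by (subst AE_iff_null_sets) auto
    then show False by (simp add: null_sets_def)
  qed
  then show ?thesis by (simp add: zero_less_iff_neq_zero)
qed

section \<open>Gaussian integrals with respect to the Gram form\<close>

lemma fitted_affine:
  assumes "I = {..<dim_col X}"
  shows "fitted X (\<lambda>i\<in>I. t i + c * f i) i = fitted X t i + c * fitted X f i"
  unfolding fitted_def sum_distrib_left sum.distrib[symmetric] assms
  by (intro sum.cong refl) (simp add: algebra_simps)

lemma fitted_linear: "fitted X (\<lambda>j. f j + c * g j) i = fitted X f i + c * fitted X g i"
  unfolding fitted_def sum_distrib_left sum.distrib[symmetric]
  by (intro sum.cong refl) (simp add: algebra_simps)

lemma fitted_diff: "fitted X (\<lambda>j. f j - g j) i = fitted X f i - fitted X g i"
  using fitted_linear[of X f "-1" g i] by simp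

lemma gform_measurable [measurable]:
  assumes "I = {..<dim_col X}"
  shows "(\<lambda>f. gform X (\<lambda>j. f j - m j)) \<in> borel_measurable (PiM I (\<lambda>_. lborel))"
  unfolding gform_def fitted_def assms by measurable

text \<open>The normalising integral of a Gaussian with precision matrix \<open>2 * c\<close> times
  \<open>gram X\<close>. Its closed form is never computed: invariance under shifts, scaling in
  \<open>c\<close>, positivity and finiteness are enough.\<close>

definition gauss_mass :: "real Matrix.mat \<Rightarrow> real \<Rightarrow> ennreal" where
  "gauss_mass X c = (\<integral>\<^sup>+f. ennreal (exp (- c * gform X f)) \<partial>(\<Pi>\<^sub>M i\<in>{..<dim_col X}. lborel))"

lemma gauss_mass_shift:
  "(\<integral>\<^sup>+f. ennreal (exp (- c * gform X (\<lambda>j. f j - m j))) \<partial>(\<Pi>\<^sub>M i\<in>{..<dim_col X}. lborel))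
    = gauss_mass X c"
proof -
  have "fitted X (\<lambda>j. (\<lambda>i\<in>{..<dim_col X}. m i + 1 * f i) j - m j) i = fitted X f i" for f i
    unfolding fitted_diff by (subst fitted_affine) auto
  then have e: "gform X (\<lambda>j. (\<lambda>i\<in>{..<dim_col X}. m i + 1 * f i) j - m j) = gform X f" for f
    unfolding gform_def by simp
  have m: "(\<lambda>f. ennreal (exp (- c * gform X (\<lambda>j. f j - m j)))) \<in> borel_measurable (\<Pi>\<^sub>M i\<in>{..<dim_col X}. lborel)"
    by measurable
  show ?thesis
    by (subst nn_integral_PiM_lborel_affine[OF _ _ m, of 1 m]) (simp_all only: e gauss_mass_def, simp_all)
qed

lemma gauss_mass_scale:
  assumes c: "c > 0"
  shows "gauss_mass X c = ennreal (c powr (- real (dim_col X) / 2)) * gauss_mass X 1"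
proof -
  define s where "s = 1 / sqrt c"
  have s: "s > 0" and cs: "c * s\<^sup>2 = 1" unfolding s_def using c by (auto simp: power_divide)
  have e: "gform X (\<lambda>i\<in>{..<dim_col X}. 0 + s * f i) = s\<^sup>2 * gform X f" for f
  proof -
    have "fitted X (\<lambda>i\<in>{..<dim_col X}. 0 + s * f i) i = s * fitted X f i" for i
      using fitted_affine[of "{..<dim_col X}" X "\<lambda>_. 0" s f i] by (simp add: fitted_def)
    then show ?thesis unfolding gform_def by (simp add: power_mult_distrib sum_distrib_left)
  qed
  have ee: "exp (- c * gform X (\<lambda>i\<in>{..<dim_col X}. 0 + s * f i)) = exp (- 1 * gform X f)" for f
    unfolding e using cs by (simp add: mult.assoc[symmetric])
  have m: "(\<lambda>f. ennreal (exp (- c * gform X f))) \<in> borel_measurable (\<Pi>\<^sub>M i\<in>{..<dim_col X}. lborel)"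
    using gform_measurable[OF refl, of X "\<lambda>_. 0"] by simp
  have "s ^ dim_col X = c powr (- real (dim_col X) / 2)"
  proof -
    have "s = c powr (- 1 / 2)" unfolding s_def using c by (simp add: powr_minus_divide powr_half_sqrt)
    then show ?thesis using c by (simp add: powr_realpow[symmetric] powr_powr)
  qed
  moreover have "gauss_mass X c = ennreal (s ^ dim_col X) * gauss_mass X 1"
    unfolding gauss_mass_def
    by (subst nn_integral_PiM_lborel_affine[OF _ s m, of "\<lambda>_. 0"]) (simp_all only: ee, simp_all)
  ultimately show ?thesis by simp
qed

lemma gauss_mass_pos: "gauss_mass X c > 0"
proof -
  interpret product_sigma_finite "\<lambda>_::nat. lborel :: real measure" ..
  let ?P = "\<Pi>\<^sub>M i\<in>{..<dim_col X}. (lborel :: real measure)"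
  have m: "(\<lambda>f. ennreal (exp (- c * gform X f))) \<in> borel_measurable ?P"
    using gform_measurable[OF refl, of X "\<lambda>_. 0"] by simp
  have "gauss_mass X c \<noteq> 0"
  proof
    assume "gauss_mass X c = 0"
    then have "AE f in ?P. False"
      unfolding gauss_mass_def using m by (subst (asm) nn_integral_0_iff_AE) auto
    then have "emeasure ?P (space ?P) = 0" by (subst (asm) AE_iff_measurable[OF _ refl]) auto
    moreover have "emeasure ?P (Pi\<^sub>E {..<dim_col X} (\<lambda>_. {0..1})) \<le> emeasure ?P (space ?P)"
      by (rule emeasure_space)
    moreover have "emeasure ?P (Pi\<^sub>E {..<dim_col X} (\<lambda>_. {0..1})) = 1"
      by (subst emeasure_PiM) auto
    ultimately show False by simp
  qed
  then show ?thesis by (simp add: zero_less_iff_neq_zero)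
qed

lemma gauss_mass_finite:
  assumes K: "K > 0" and le: "\<And>f. (\<Sum>j<dim_col X. (f j)\<^sup>2) \<le> K * gform X f" and c: "c > 0"
  shows "gauss_mass X c < \<infinity>"
proof -
  interpret product_sigma_finite "\<lambda>_::nat. lborel :: real measure" ..
  let ?P = "\<Pi>\<^sub>M i\<in>{..<dim_col X}. (lborel :: real measure)"
  \<comment> \<open>Standard deviation of the dominating product of normal densities, chosen so that
    \<open>c / K = 1 / (2 * s\<^sup>2)\<close>.\<close>
  define s where "s = sqrt (K / (2 * c))"
  have s: "s > 0" "2 * s\<^sup>2 = K / c" unfolding s_def using K c by auto
  define C where "C = sqrt (2 * pi * s\<^sup>2)"
  have C: "C > 0" unfolding C_def using s by simp
  have "gauss_mass X c \<le> (\<integral>\<^sup>+f. (\<Prod>j<dim_col X. ennreal (C * normal_density 0 s (f j))) \<partial>?P)"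
    unfolding gauss_mass_def
  proof (rule nn_integral_mono)
    fix f :: "nat \<Rightarrow> real"
    have "exp (- c * gform X f) \<le> exp (- (\<Sum>j<dim_col X. (f j)\<^sup>2) * c / K)"
      using le[of f] K c by (simp add: field_simps)
    also have "\<dots> = (\<Prod>j<dim_col X. exp (- (f j)\<^sup>2 / (2 * s\<^sup>2)))"
      using K c unfolding s(2) by (simp add: exp_sum[symmetric] sum_distrib_right sum_negf sum_divide_distrib)
    also have "\<dots> = (\<Prod>j<dim_col X. C * normal_density 0 s (f j))"
      using C s by (simp add: normal_density_def C_def)
    finally have "ennreal (exp (- c * gform X f)) \<le> ennreal (\<Prod>j<dim_col X. C * normal_density 0 s (f j))"
      by (rule ennreal_leI)
    also have "\<dots> = (\<Prod>j<dim_col X. ennreal (C * normal_density 0 s (f j)))"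
      using C by (subst prod_ennreal) auto
    finally show "ennreal (exp (- c * gform X f)) \<le> (\<Prod>j<dim_col X. ennreal (C * normal_density 0 s (f j)))" .
  qed
  also have "\<dots> = (\<Prod>j<dim_col X. \<integral>\<^sup>+x. ennreal (C * normal_density 0 s x) \<partial>lborel)"
    by (rule product_nn_integral_prod) auto
  also have "(\<integral>\<^sup>+x. ennreal (C * normal_density 0 s x) \<partial>lborel) = ennreal C"
  proof -
    have "(\<integral>\<^sup>+x. ennreal (normal_density 0 s x) \<partial>lborel) = 1"
      using s by (subst nn_integral_eq_integral) auto
    then show ?thesis using C by (simp add: ennreal_mult' nn_integral_cmult)
  qed
  also have "(\<Prod>j<dim_col X. ennreal C) < \<infinity>" by (simp add: ennreal_power C less_imp_le)
  finally show ?thesis .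
qed

text \<open>Chernoff bound: the tilt \<open>t \<cdot> (f j - m j)\<close> is absorbed by a shift along \<open>dual X j\<close>, so no
  marginal distribution is needed.\<close>

lemma gauss_tail_tilt:
  assumes X: "X \<in> carrier_mat n k" and rank: "vec_space.rank n X = k" and j: "j < k"
    and c: "c > 0"
  shows "(\<integral>\<^sup>+f. ennreal (exp (- c * gform X (\<lambda>j. f j - m j))) * ennreal (exp (t * (f j - m j)))
           \<partial>(\<Pi>\<^sub>M i\<in>{..<dim_col X}. lborel))
       = ennreal (exp (t\<^sup>2 * dual X j j / (4 * c))) * gauss_mass X c"
proof -
  define h where "h = (\<lambda>l. m l + t / (2 * c) * dual X j l)"
  have e: "- c * gform X (\<lambda>j. f j - m j) + t * (f j - m j)
    = t\<^sup>2 * dual X j j / (4 * c) + (- c * gform X (\<lambda>j. f j - h j))" for f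
  proof -
    let ?d = "\<lambda>j. f j - m j"
    have fit: "fitted X (\<lambda>j. f j - h j) i = fitted X ?d i + (- t / (2 * c)) * fitted X (dual X j) i" for i
      by (subst fitted_linear[symmetric]) (simp add: h_def algebra_simps)
    have sq: "(x + (- t / (2 * c)) * y)\<^sup>2 = x\<^sup>2 - (t / c) * (x * y) + (t / (2 * c))\<^sup>2 * y\<^sup>2" for x y
      using c by (simp add: power2_eq_square field_simps)
    have "gform X (\<lambda>j. f j - h j)
      = (\<Sum>i<n. (fitted X ?d i)\<^sup>2 - (t / c) * (fitted X ?d i * fitted X (dual X j) i)
           + (t / (2 * c))\<^sup>2 * (fitted X (dual X j) i)\<^sup>2)"
      unfolding gform_def fit sq using X by simp
    also have "\<dots> = gform X ?d - (t / c) * (\<Sum>i<n. fitted X ?d i * fitted X (dual X j) i)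
        + (t / (2 * c))\<^sup>2 * gform X (dual X j)"
      unfolding gform_def using X by (simp add: sum.distrib sum_subtractf sum_distrib_left)
    also have "(\<Sum>i<n. fitted X ?d i * fitted X (dual X j) i) = ?d j"
      by (rule fitted_dual[OF X rank j])
    also have "gform X (dual X j) = dual X j j" by (rule gform_dual[OF X rank j])
    finally show ?thesis using c by (simp add: power2_eq_square field_simps)
  qed
  have "(\<integral>\<^sup>+f. ennreal (exp (- c * gform X (\<lambda>j. f j - m j))) * ennreal (exp (t * (f j - m j)))
           \<partial>(\<Pi>\<^sub>M i\<in>{..<dim_col X}. lborel))
     = (\<integral>\<^sup>+f. ennreal (exp (t\<^sup>2 * dual X j j / (4 * c))) * ennreal (exp (- c * gform X (\<lambda>j. f j - h j)))
           \<partial>(\<Pi>\<^sub>M i\<in>{..<dim_col X}. lborel))"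
    by (intro nn_integral_cong) (simp only: ennreal_mult'[symmetric] exp_ge_zero exp_add[symmetric] e)
  also have "\<dots> = ennreal (exp (t\<^sup>2 * dual X j j / (4 * c))) * gauss_mass X c"
    unfolding gauss_mass_shift[where c = c and X = X and m = h, symmetric] by (intro nn_integral_cmult) measurable
  finally show ?thesis .
qed

text \<open>Exponential Markov bound for both tails of every coordinate; the union costs only
  \<open>2 * real k\<close>. The exponent is linear in \<open>c\<close>, which is proportional to
  the inverse variance, so the bound can later be merged with the variance integral.\<close>

lemma gauss_tail:
  assumes X: "X \<in> carrier_mat n k" and rank: "vec_space.rank n X = k"
    and c: "c > 0" and r: "r > 0" and K: "K > 0" and diag: "\<And>j. j < k \<Longrightarrow> dual X j j \<le> K"
    and B: "\<And>f. f \<in> B \<Longrightarrow> \<exists>j<k. \<bar>f j - m j\<bar> > r"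
  shows "(\<integral>\<^sup>+f. ennreal (exp (- c * gform X (\<lambda>j. f j - m j))) * indicator B f
           \<partial>(\<Pi>\<^sub>M i\<in>{..<dim_col X}. lborel))
       \<le> ennreal (2 * real k * exp (- c * r\<^sup>2 / K)) * gauss_mass X c"
proof -
  let ?P = "\<Pi>\<^sub>M i\<in>{..<dim_col X}. (lborel :: real measure)"
  \<comment> \<open>Minimises the exponent \<open>- t * r + t\<^sup>2 * K / (4 * c)\<close>; the
    minimum is \<open>- c * r\<^sup>2 / K\<close>.\<close>
  define t where "t = 2 * c * r / K"
  have t: "t > 0" unfolding t_def using c r K by simp
  let ?G = "\<lambda>f. ennreal (exp (- c * gform X (\<lambda>j. f j - m j)))"
  let ?T = "\<lambda>s j f. ennreal (exp (- t * r)) * (?G f * ennreal (exp (s * (f j - m j))))"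
  have kc: "k = dim_col X" using X by simp
  have mT: "?T s j \<in> borel_measurable ?P" if "j < k" for s j
  proof -
    have [measurable]: "(\<lambda>f. f j) \<in> borel_measurable ?P"
      using measurable_component_singleton[of j "{..<dim_col X}" "\<lambda>_. lborel :: real measure"] that kc
      by simp
    show ?thesis by measurable
  qed
  have "(\<integral>\<^sup>+f. ?G f * indicator B f \<partial>?P) \<le> (\<integral>\<^sup>+f. (\<Sum>j<k. ?T t j f + ?T (- t) j f) \<partial>?P)"
  proof (rule nn_integral_mono)
    fix f
    show "?G f * indicator B f \<le> (\<Sum>j<k. ?T t j f + ?T (- t) j f)"
    proof (cases "f \<in> B")
      case True
      then obtain j where j: "j < k" "\<bar>f j - m j\<bar> > r" using B by blast
      define u where "u = (if f j - m j > 0 then t else - t)"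
      have "u * (f j - m j) = t * \<bar>f j - m j\<bar>" unfolding u_def by (auto simp: algebra_simps abs_if)
      then have "- t * r + u * (f j - m j) \<ge> 0" using j t mult_left_mono[of r "\<bar>f j - m j\<bar>" t] by simp
      then have "1 \<le> exp (- t * r) * exp (u * (f j - m j))" by (simp add: exp_add[symmetric])
      then have "ennreal (exp (- c * gform X (\<lambda>j. f j - m j)) * 1)
        \<le> ennreal (exp (- c * gform X (\<lambda>j. f j - m j)) * (exp (- t * r) * exp (u * (f j - m j))))"
        by (intro ennreal_leI mult_left_mono) auto
      then have "?G f \<le> ?T u j f" by (simp add: ennreal_mult' mult_ac)
      also have "\<dots> \<le> ?T t j f + ?T (- t) j f" unfolding u_def by auto
      also have "\<dots> \<le> (\<Sum>j<k. ?T t j f + ?T (- t) j f)"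
        using j by (intro member_le_sum) auto
      finally show ?thesis using True by simp
    qed simp
  qed
  also have "\<dots> = (\<Sum>j<k. (\<integral>\<^sup>+f. ?T t j f \<partial>?P) + (\<integral>\<^sup>+f. ?T (- t) j f \<partial>?P))"
  proof (subst nn_integral_sum)
    show "(\<lambda>f. ?T t j f + ?T (- t) j f) \<in> borel_measurable ?P" if "j \<in> {..<k}" for j
      using mT[of j t] mT[of j "- t"] that by (intro borel_measurable_add) auto
    show "(\<Sum>j<k. \<integral>\<^sup>+f. ?T t j f + ?T (- t) j f \<partial>?P) = (\<Sum>j<k. (\<integral>\<^sup>+f. ?T t j f \<partial>?P) + (\<integral>\<^sup>+f. ?T (- t) j f \<partial>?P))"
    proof (intro sum.cong refl nn_integral_add)
      fix j assume "j \<in> {..<k}"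
      then show "?T t j \<in> borel_measurable ?P" "?T (- t) j \<in> borel_measurable ?P"
        using mT[of j t] mT[of j "- t"] by blast+
    qed
  qed
  also have "\<dots> \<le> (\<Sum>j<k. ennreal (exp (- c * r\<^sup>2 / K)) * gauss_mass X c + ennreal (exp (- c * r\<^sup>2 / K)) * gauss_mass X c)"
  proof (intro sum_mono add_mono)
    have main: "(\<integral>\<^sup>+f. ?T s j f \<partial>?P) \<le> ennreal (exp (- c * r\<^sup>2 / K)) * gauss_mass X c"
      if j: "j < k" and s: "s\<^sup>2 = t\<^sup>2" for s j
    proof -
      have "(\<integral>\<^sup>+f. ?T s j f \<partial>?P)
        = ennreal (exp (- t * r)) * (\<integral>\<^sup>+f. ?G f * ennreal (exp (s * (f j - m j))) \<partial>?P)"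
      proof (intro nn_integral_cmult)
        have [measurable]: "(\<lambda>f. f j) \<in> borel_measurable ?P"
          using measurable_component_singleton[of j "{..<dim_col X}" "\<lambda>_. lborel :: real measure"] j kc
          by simp
        show "(\<lambda>f. ?G f * ennreal (exp (s * (f j - m j)))) \<in> borel_measurable ?P" by measurable
      qed
      also have "(\<integral>\<^sup>+f. ?G f * ennreal (exp (s * (f j - m j))) \<partial>?P)
        = ennreal (exp (s\<^sup>2 * dual X j j / (4 * c))) * gauss_mass X c"
        by (rule gauss_tail_tilt[OF X rank j c])
      also have "ennreal (exp (- t * r)) * (ennreal (exp (s\<^sup>2 * dual X j j / (4 * c))) * gauss_mass X c)
        = ennreal (exp (- t * r) * exp (t\<^sup>2 * dual X j j / (4 * c))) * gauss_mass X c"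
        unfolding s by (subst ennreal_mult) (simp_all add: mult.assoc)
      also have "\<dots> \<le> ennreal (exp (- c * r\<^sup>2 / K)) * gauss_mass X c"
      proof (intro mult_right_mono ennreal_leI)
        have "t\<^sup>2 * dual X j j / (4 * c) \<le> t\<^sup>2 * K / (4 * c)"
          using diag[OF j] c by (intro divide_right_mono mult_left_mono) auto
        also have "\<dots> = c * r\<^sup>2 / K" unfolding t_def using c K by (simp add: power2_eq_square)
        finally have "- t * r + t\<^sup>2 * dual X j j / (4 * c) \<le> - c * r\<^sup>2 / K"
          unfolding t_def using K by (simp add: power2_eq_square field_simps)
        then show "exp (- t * r) * exp (t\<^sup>2 * dual X j j / (4 * c)) \<le> exp (- c * r\<^sup>2 / K)"
          by (simp add: exp_add[symmetric])
      qed simp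
      finally show ?thesis .
    qed
    show "(\<integral>\<^sup>+f. ?T t j f \<partial>?P) \<le> ennreal (exp (- c * r\<^sup>2 / K)) * gauss_mass X c" if "j \<in> {..<k}" for j
      using main that by simp
    show "(\<integral>\<^sup>+f. ?T (- t) j f \<partial>?P) \<le> ennreal (exp (- c * r\<^sup>2 / K)) * gauss_mass X c" if "j \<in> {..<k}" for j
      using main[of j "- t"] that by simp
  qed
  also have "\<dots> = of_nat k * (2 * ennreal (exp (- c * r\<^sup>2 / K))) * gauss_mass X c"
    by (simp add: mult.assoc mult_2 distrib_right)
  also have "of_nat k * (2 * ennreal (exp (- c * r\<^sup>2 / K))) = ennreal (2 * real k * exp (- c * r\<^sup>2 / K))"
    by (simp add: ennreal_mult' ennreal_of_nat_eq_real_of_nat mult_ac flip: ennreal_numeral)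
  finally show ?thesis .
qed

section \<open>The marginal posterior density of the scale parameter\<close>

text \<open>Mean of the conditional posterior of the coefficients given \<open>g\<close>. It does
  not involve the variance, so a tail event around it is the same for all \<open>v\<close> and the
  variance can be integrated out afterwards.\<close>

definition post_mean :: "real Matrix.vec \<Rightarrow> real Matrix.vec \<Rightarrow> real \<Rightarrow> nat \<Rightarrow> real" where
  "post_mean \<gamma> bh g j = (g * vec_index bh j + vec_index \<gamma> j) / (1 + g)"

definition discrepancy :: "real Matrix.mat \<Rightarrow> real Matrix.vec \<Rightarrow> real Matrix.vec \<Rightarrow> real" where
  "discrepancy X \<gamma> bh = gform X (\<lambda>j. vec_index bh j - vec_index \<gamma> j)"

text \<open>The identity holds in each fitted coordinate separately, where it is the completion of a
  scalar square.\<close>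

lemma complete_square:
  assumes g: "g > 0"
  shows "gform X (\<lambda>j. vec_index bh j - f j) + gform X (\<lambda>j. f j - vec_index \<gamma> j) / g
    = (1 + 1 / g) * gform X (\<lambda>j. f j - post_mean \<gamma> bh g j) + discrepancy X \<gamma> bh / (1 + g)"
proof -
  let ?A = "fitted X (vec_index bh)" and ?F = "fitted X f" and ?G = "fitted X (vec_index \<gamma>)"
  have pm: "fitted X (\<lambda>j. f j - post_mean \<gamma> bh g j) i = ?F i - (g * ?A i + ?G i) / (1 + g)" for i
  proof -
    have "fitted X (post_mean \<gamma> bh g) i = (g * ?A i + ?G i) / (1 + g)"
      unfolding fitted_def post_mean_def sum_distrib_left sum.distrib[symmetric] sum_divide_distrib
      by (intro sum.cong refl) (simp add: algebra_simps)
    then show ?thesis unfolding fitted_diff by simp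
  qed
  have sq: "(x - y)\<^sup>2 + (y - z)\<^sup>2 / g = (1 + 1 / g) * (y - (g * x + z) / (1 + g))\<^sup>2 + (x - z)\<^sup>2 / (1 + g)"
    for x y z :: real
  proof -
    have "y - (g * x + z) / (1 + g) = ((1 + g) * y - (g * x + z)) / (1 + g)" using g by (simp add: field_simps)
    moreover have "(1 + 1 / g) = (1 + g) / g" using g by (simp add: field_simps)
    ultimately have "(1 + 1 / g) * (y - (g * x + z) / (1 + g))\<^sup>2 = ((1 + g) * y - (g * x + z))\<^sup>2 / (g * (1 + g))"
      using g by (simp add: power2_eq_square)
    then show ?thesis using g by (simp add: divide_simps) (simp add: power2_eq_square algebra_simps)
  qed
  show ?thesis
    unfolding gform_def discrepancy_def fitted_diff pm sum_divide_distrib sum_distrib_left sum.distrib[symmetric]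
    by (intro sum.cong refl) (use sq pm in \<open>simp add: fitted_diff\<close>)
qed

text \<open>All factors free of \<open>g\<close>, of the variance and of the coefficients. The
  absolute value arises from multiplying the square roots in the likelihood and in the prior, so a
  nonzero determinant suffices.\<close>

definition mass_const :: "real Matrix.mat \<Rightarrow> real \<Rightarrow> real" where
  "mass_const X s = (let \<nu> = real (dim_row X - dim_col X) / 2 in
     s powr (\<nu> - 1) / (2 powr \<nu> * Gamma \<nu>)
       / ((2 * pi) ^ dim_col X * \<bar>Determinant.det (minv (gram X))\<bar>))"

definition data_scale ::
  "real Matrix.mat \<Rightarrow> real \<Rightarrow> real \<Rightarrow> real Matrix.vec \<Rightarrow> real Matrix.vec \<Rightarrow> real \<Rightarrow> real" where
  "data_scale X b s \<gamma> bh g = s + b + discrepancy X \<gamma> bh / (1 + g)"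

text \<open>The unnormalised marginal posterior of \<open>g\<close>, with the scale as a separate
  argument: it is evaluated at \<open>data_scale\<close> and also at an enlarged scale that encodes
  the Chernoff bound.\<close>

definition g_density :: "nat \<Rightarrow> nat \<Rightarrow> real \<Rightarrow> real \<Rightarrow> real \<Rightarrow> real" where
  "g_density n k a S g = (1 + g) powr (- real k / 2) * (g powr (- 3 / 2) * exp (- real n / (2 * g)))
     * S powr (- (real n + a) / 2)"

lemma g_density_nonneg: "g_density n k a S g \<ge> 0"
  unfolding g_density_def by simp

context
  fixes X :: "real Matrix.mat" and n k :: nat and a b s :: real and \<gamma> bh :: "real Matrix.vec"
  assumes X: "X \<in> carrier_mat n k" and rank: "vec_space.rank n X = k" and kn: "k < n"
    and s: "s > 0" and \<gamma>: "\<gamma> \<in> carrier_vec k" and bh: "bh \<in> carrier_vec k"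
begin

abbreviation "marg S g \<equiv> g_density n k a S g"

abbreviation "scale_at g \<equiv> data_scale X b s \<gamma> bh g"

lemma mass_const_pos: "mass_const X s > 0"
proof -
  have "Gamma (real (n - k) / 2) > 0" using kn by (intro Gamma_real_pos) auto
  then show ?thesis unfolding mass_const_def Let_def
    using s det_inv_gram_nonzero[OF X rank] X
    by (intro divide_pos_pos mult_pos_pos) auto
qed

text \<open>The part of likelihood times prior that is free of the coefficients. \<open>S\<close>
  stays a parameter because the Chernoff factor will be absorbed into it.\<close>

definition kernel_weight :: "real \<Rightarrow> real \<Rightarrow> real \<Rightarrow> real" where
  "kernel_weight S g v = mass_const X s
     * (g powr (- real k / 2) * v powr (- (real n + real k + a) / 2 - 1)
        * exp (- S / (2 * v)) * (g powr (- 3 / 2) * exp (- real n / (2 * g))))"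

abbreviation "prec g v \<equiv> (1 + 1 / g) / (2 * v)"

lemma density_product:
  assumes g: "g > 0" and v: "v > 0"
  shows "likelihood X (Matrix.vec k f) v bh s * zs_prior a b X \<gamma> (Matrix.vec k f) v g
    = kernel_weight (scale_at g) g v * exp (- prec g v * gform X (\<lambda>j. f j - post_mean \<gamma> bh g j))"
proof -
  let ?f = "Matrix.vec k f" and ?d = "Determinant.det (minv (gram X))"
  let ?q1 = "gform X (\<lambda>j. vec_index bh j - f j)" and ?q2 = "gform X (\<lambda>j. f j - vec_index \<gamma> j)"
  let ?q = "gform X (\<lambda>j. f j - post_mean \<gamma> bh g j)" and ?T = "discrepancy X \<gamma> bh"
  have fc: "?f \<in> carrier_vec k" by simp
  have gcong: "gform X u = gform X w" if "\<And>j. j < k \<Longrightarrow> u j = w j" for u w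
    unfolding gform_def fitted_def using that X by simp
  have dk: "dim_col (minv (gram X)) = k" using inv_gram(1)[OF X rank] by simp
  have l: "mvn_density ?f (v \<cdot>\<^sub>m minv (gram X)) bh
      = exp (- (?q1 / v) / 2) / sqrt ((2 * pi) ^ k * (v ^ k * ?d))"
  proof -
    have "scalar_prod (bh - ?f) (minv (v \<cdot>\<^sub>m minv (gram X)) *\<^sub>v (bh - ?f)) = ?q1 / v"
      using mvn_exponent[OF X rank _ bh fc, of v] v gcong[of "\<lambda>j. vec_index bh j - vec_index ?f j"] by simp
    then show ?thesis unfolding mvn_density_def using bh dk by simp
  qed
  have p: "mvn_density \<gamma> ((g * v) \<cdot>\<^sub>m minv (gram X)) ?f
      = exp (- (?q2 / (g * v)) / 2) / sqrt ((2 * pi) ^ k * ((g * v) ^ k * ?d))"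
  proof -
    have "scalar_prod (?f - \<gamma>) (minv ((g * v) \<cdot>\<^sub>m minv (gram X)) *\<^sub>v (?f - \<gamma>)) = ?q2 / (g * v)"
      using mvn_exponent[OF X rank _ fc \<gamma>, of "g * v"] v g gcong[of "\<lambda>j. vec_index ?f j - vec_index \<gamma> j"]
      by simp
    then show ?thesis unfolding mvn_density_def using dk by simp
  qed
  have sq: "sqrt ((2 * pi) ^ k * (v ^ k * ?d)) * sqrt ((2 * pi) ^ k * ((g * v) ^ k * ?d))
      = (2 * pi) ^ k * \<bar>?d\<bar> * (v powr real k * g powr (real k / 2))"
  proof -
    have "(2 * pi) ^ k * (v ^ k * ?d) * ((2 * pi) ^ k * ((g * v) ^ k * ?d))
        = ((2 * pi) ^ k * v ^ k * ?d)\<^sup>2 * g ^ k"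
      by (simp add: power2_eq_square power_mult_distrib mult_ac)
    moreover have "sqrt (g ^ k) = g powr (real k / 2)"
      using g by (simp add: powr_half_sqrt[symmetric] powr_realpow[symmetric] powr_powr)
    moreover have "v ^ k = v powr real k" using v by (simp add: powr_realpow)
    ultimately show ?thesis
      unfolding real_sqrt_mult[symmetric] using v by (simp add: real_sqrt_mult abs_mult mult_ac)
  qed
  have ex: "exp (- (?q1 / v) / 2) * exp (- (?q2 / (g * v)) / 2)
      = exp (- ((1 + 1 / g) / (2 * v)) * ?q) * exp (- (?T / (1 + g)) / (2 * v))"
  proof -
    have "- (?q1 / v) / 2 + - (?q2 / (g * v)) / 2 = - ((?q1 + ?q2 / g) / (2 * v))"
      using g v by (simp add: field_simps)
    also have "\<dots> = - ((1 + 1 / g) / (2 * v)) * ?q + - (?T / (1 + g)) / (2 * v)"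
    proof -
      have "- ((e * q + u) / (2 * v)) = - (e / (2 * v)) * q + - u / (2 * v)" for e q u :: real
        using v by (simp add: field_simps)
      then show ?thesis unfolding complete_square[OF g] .
    qed
    finally show ?thesis by (simp only: exp_add[symmetric])
  qed
  have ex2: "exp (- (?T / (1 + g)) / (2 * v)) * exp (- s / (2 * v)) * exp (- (b / 2) / v)
      = exp (- (s + b + ?T / (1 + g)) / (2 * v))"
    using v by (simp add: exp_add[symmetric] add_divide_distrib diff_divide_distrib)
  let ?nu = "real (n - k) / 2"
  have nu: "real (n - k) = real n - real k" using kn by simp
  \<comment> \<open>Likelihood and prior contribute \<open>k / 2\<close> each, the chi-squared
    density \<open>(n - k) / 2\<close>, the prior on the variance \<open>a / 2 + 1\<close>.\<close>
  have pw: "v powr (- (real n + real k + a) / 2 - 1) = v powr (- real k) * v powr (- ?nu) * v powr (- (a / 2) - 1)"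
    unfolding powr_add[symmetric] nu by (rule arg_cong[where f="(powr) v"]) (simp add: field_simps)
  have chi: "scaled_chisq_density (n - k) v s
      = s powr (?nu - 1) * exp (- s / (2 * v)) / (2 powr ?nu * Gamma ?nu) * v powr (- ?nu)"
    unfolding scaled_chisq_density_def using s v by (simp add: powr_mult powr_minus_divide)
  have "likelihood X ?f v bh s * zs_prior a b X \<gamma> ?f v g
    = exp (- (?q1 / v) / 2) * exp (- (?q2 / (g * v)) / 2)
       / (sqrt ((2 * pi) ^ k * (v ^ k * ?d)) * sqrt ((2 * pi) ^ k * ((g * v) ^ k * ?d)))
       * (s powr (?nu - 1) * exp (- s / (2 * v)) / (2 powr ?nu * Gamma ?nu) * v powr (- ?nu))
       * (v powr (- (a / 2) - 1) * exp (- (b / 2) / v))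
       * (g powr (- 3 / 2) * exp (- real n / (2 * g)))"
    unfolding likelihood_def zs_prior_def l p using X g v chi
    by (simp add: inv_gamma_kernel_def mult_ac)
  also have "\<dots> = (s powr (?nu - 1) / (2 powr ?nu * Gamma ?nu) / ((2 * pi) ^ k * \<bar>?d\<bar>))
      * (g powr (- real k / 2) * (v powr (- real k) * v powr (- ?nu) * v powr (- (a / 2) - 1))
        * (exp (- (?T / (1 + g)) / (2 * v)) * exp (- s / (2 * v)) * exp (- (b / 2) / v))
        * (g powr (- 3 / 2) * exp (- real n / (2 * g))))
      * exp (- ((1 + 1 / g) / (2 * v)) * ?q)"
    unfolding ex sq by (simp add: powr_minus_divide mult_ac)
  finally show ?thesis
    unfolding ex2 pw[symmetric] kernel_weight_def mass_const_def Let_def data_scale_def using X by simp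
qed

section \<open>Integration over the coefficients\<close>

abbreviation "inner_mass B g v \<equiv>
  (\<integral>\<^sup>+f. ennreal (likelihood X (Matrix.vec (dim_col X) f) v bh s
                  * zs_prior a b X \<gamma> (Matrix.vec (dim_col X) f) v g)
         * indicator B (Matrix.vec (dim_col X) f) \<partial>(\<Pi>\<^sub>M i\<in>{..<dim_col X}. lborel))"

lemma kernel_weight_nonneg: "kernel_weight S g v \<ge> 0"
  unfolding kernel_weight_def using mass_const_pos by (intro mult_nonneg_nonneg) auto

lemma inner_mass_zero:
  assumes "\<not> (g > 0 \<and> v > 0)"
  shows "inner_mass B g v = 0"
  using assms by (auto simp: zs_prior_def inv_gamma_kernel_def)

lemma inner_mass_UNIV:
  assumes g: "g > 0" and v: "v > 0"
  shows "inner_mass UNIV g v = ennreal (kernel_weight (scale_at g) g v) * gauss_mass X (prec g v)"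
proof -
  have kc: "dim_col X = k" using X by simp
  have "inner_mass UNIV g v
    = (\<integral>\<^sup>+f. ennreal (kernel_weight (scale_at g) g v)
         * ennreal (exp (- prec g v * gform X (\<lambda>j. f j - post_mean \<gamma> bh g j))) \<partial>(\<Pi>\<^sub>M i\<in>{..<dim_col X}. lborel))"
    unfolding kc density_product[OF g v]
    by (intro nn_integral_cong)
      (simp only: ennreal_mult'[OF kernel_weight_nonneg] indicator_UNIV mult_1_right ennreal_1)
  also have "\<dots> = ennreal (kernel_weight (scale_at g) g v) * gauss_mass X (prec g v)"
    unfolding gauss_mass_shift[where m="post_mean \<gamma> bh g", symmetric]
    by (intro nn_integral_cmult) measurable
  finally show ?thesis .
qed

text \<open>Since \<open>prec g v\<close> is at least \<open>1 / (2 * v)\<close>, the Chernoff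
  factor is at most \<open>exp (- (r\<^sup>2 / K) / (2 * v))\<close>. This has the shape of the
  exponential in \<open>kernel_weight\<close>, so it amounts to adding \<open>r\<^sup>2 / K\<close>
  to the scale.\<close>

lemma inner_mass_tail:
  assumes g: "g > 0" and v: "v > 0" and r: "r > 0" and K: "K > 0"
    and diag: "\<And>j. j < k \<Longrightarrow> dual X j j \<le> K"
    and B: "\<And>f. Matrix.vec k f \<in> B \<Longrightarrow> \<exists>j<k. \<bar>f j - post_mean \<gamma> bh g j\<bar> > r"
  shows "inner_mass B g v
    \<le> ennreal (2 * real k) * (ennreal (kernel_weight (scale_at g + r\<^sup>2 / K) g v) * gauss_mass X (prec g v))"
proof -
  have kc: "dim_col X = k" using X by simp
  let ?m = "post_mean \<gamma> bh g" and ?P = "\<Pi>\<^sub>M i\<in>{..<dim_col X}. (lborel :: real measure)"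
  \<comment> \<open>\<open>B\<close> is an arbitrary set of vectors; \<open>E\<close> is a
    measurable event that contains the relevant part of it.\<close>
  define E where "E = {f \<in> space ?P. \<exists>j<k. \<bar>f j - ?m j\<bar> > r}"
  have [measurable]: "E \<in> sets ?P"
  proof -
    have "{f \<in> space ?P. \<bar>f j - ?m j\<bar> > r} \<in> sets ?P" if "j < k" for j
    proof -
      have [measurable]: "(\<lambda>f. f j) \<in> borel_measurable ?P"
        using measurable_component_singleton[of j "{..<dim_col X}" "\<lambda>_. lborel :: real measure"] that kc
        by simp
      show ?thesis by measurable
    qed
    moreover have "E = (\<Union>j<k. {f \<in> space ?P. \<bar>f j - ?m j\<bar> > r})" unfolding E_def by auto
    ultimately show ?thesis by auto
  qed
  have c: "prec g v > 0" using g v by (intro divide_pos_pos add_pos_pos) auto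
  have "inner_mass B g v
    \<le> (\<integral>\<^sup>+f. ennreal (kernel_weight (scale_at g) g v)
         * (ennreal (exp (- prec g v * gform X (\<lambda>j. f j - ?m j))) * indicator E f) \<partial>?P)"
  proof (rule nn_integral_mono)
    fix f assume f: "f \<in> space ?P"
    have "indicator B (Matrix.vec k f) \<le> (indicator E f :: ennreal)"
      using B[of f] f unfolding E_def by (auto simp: indicator_def)
    then have "ennreal (kernel_weight (scale_at g) g v)
         * (ennreal (exp (- prec g v * gform X (\<lambda>j. f j - ?m j))) * indicator B (Matrix.vec k f))
       \<le> ennreal (kernel_weight (scale_at g) g v)
         * (ennreal (exp (- prec g v * gform X (\<lambda>j. f j - ?m j))) * indicator E f)"
      by (intro mult_left_mono) auto
    then show "ennreal (likelihood X (Matrix.vec (dim_col X) f) v bh s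
                  * zs_prior a b X \<gamma> (Matrix.vec (dim_col X) f) v g) * indicator B (Matrix.vec (dim_col X) f)
       \<le> ennreal (kernel_weight (scale_at g) g v)
         * (ennreal (exp (- prec g v * gform X (\<lambda>j. f j - ?m j))) * indicator E f)"
      unfolding kc density_product[OF g v]
      by (simp only: ennreal_mult'[OF kernel_weight_nonneg] mult.assoc)
  qed
  also have "\<dots> = ennreal (kernel_weight (scale_at g) g v)
     * (\<integral>\<^sup>+f. ennreal (exp (- prec g v * gform X (\<lambda>j. f j - ?m j))) * indicator E f \<partial>?P)"
    by (intro nn_integral_cmult) measurable
  also have "\<dots> \<le> ennreal (kernel_weight (scale_at g) g v)
     * (ennreal (2 * real k * exp (- prec g v * r\<^sup>2 / K)) * gauss_mass X (prec g v))"
    by (intro mult_left_mono gauss_tail[OF X rank c r K diag]) (auto simp: E_def)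
  also have "\<dots> = ennreal (kernel_weight (scale_at g) g v * (2 * real k * exp (- prec g v * r\<^sup>2 / K))) * gauss_mass X (prec g v)"
    by (simp only: ennreal_mult'[OF kernel_weight_nonneg] mult.assoc)
  also have "\<dots> \<le> ennreal (2 * real k * kernel_weight (scale_at g + r\<^sup>2 / K) g v) * gauss_mass X (prec g v)"
  proof (intro mult_right_mono ennreal_leI)
    have "1 / (2 * v) \<le> prec g v" using g v by (intro divide_right_mono) auto
    then have "1 / (2 * v) * (r\<^sup>2 / K) \<le> prec g v * (r\<^sup>2 / K)" using K by (intro mult_right_mono) auto
    then have "exp (- prec g v * r\<^sup>2 / K) \<le> exp (- (r\<^sup>2 / K) / (2 * v))" by (simp add: mult_ac)
    then have "kernel_weight (scale_at g) g v * (2 * real k * exp (- prec g v * r\<^sup>2 / K))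
      \<le> kernel_weight (scale_at g) g v * (2 * real k * exp (- (r\<^sup>2 / K) / (2 * v)))"
      by (intro mult_left_mono kernel_weight_nonneg) auto
    also have "\<dots> = 2 * real k * kernel_weight (scale_at g + r\<^sup>2 / K) g v"
    proof -
      have "exp (- (scale_at g + r\<^sup>2 / K) / (2 * v)) = exp (- scale_at g / (2 * v)) * exp (- (r\<^sup>2 / K) / (2 * v))"
        by (simp add: exp_add[symmetric] diff_divide_distrib)
      then show ?thesis unfolding kernel_weight_def by (simp only: mult_ac)
    qed
    finally show "kernel_weight (scale_at g) g v * (2 * real k * exp (- prec g v * r\<^sup>2 / K))
      \<le> 2 * real k * kernel_weight (scale_at g + r\<^sup>2 / K) g v" .
  qed simp
  also have "\<dots> = ennreal (2 * real k) * (ennreal (kernel_weight (scale_at g + r\<^sup>2 / K) g v) * gauss_mass X (prec g v))"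
    by (simp add: ennreal_mult' mult.assoc)
  finally show ?thesis .
qed

section \<open>Integration over the variance\<close>

definition inv_gamma_mass :: "real \<Rightarrow> ennreal" where
  "inv_gamma_mass N = (\<integral>\<^sup>+v\<in>{0<..}. ennreal (v powr (- N - 1) * exp (- 1 / (2 * v))) \<partial>lborel)"

definition total_const :: ennreal where
  "total_const = ennreal (mass_const X s * 2 powr (real k / 2)) * gauss_mass X 1 * inv_gamma_mass ((real n + a) / 2)"

lemma gauss_mass_prec:
  assumes g: "g > 0" and v: "v > 0"
  shows "gauss_mass X (prec g v) = ennreal (prec g v powr (- real k / 2)) * gauss_mass X 1"
proof -
  have "prec g v > 0" using g v by (intro divide_pos_pos add_pos_pos) auto
  then show ?thesis using gauss_mass_scale[of "prec g v" X] X by simp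
qed

text \<open>The power \<open>g powr (- real k / 2)\<close> of the prior cancels against the one
  produced by the Gaussian integral, which leaves \<open>(1 + g) powr (- real k / 2)\<close>;
  likewise \<open>k\<close> drops out of the exponent of \<open>v\<close>, and an inverse Gamma
  integral with shape \<open>(real n + a) / 2\<close> remains.\<close>

lemma integrate_variance:
  assumes N: "real n + a > 0" and S: "S > 0" and g: "g > 0"
  shows "(\<integral>\<^sup>+v\<in>{0<..}. ennreal (kernel_weight S g v) * gauss_mass X (prec g v) \<partial>lborel)
    = total_const * ennreal (marg S g)"
proof -
  let ?N = "(real n + a) / 2"
  define A where "A = mass_const X s * 2 powr (real k / 2) * ((1 + g) powr (- real k / 2) * (g powr (- 3 / 2) * exp (- real n / (2 * g))))"
  have A: "A \<ge> 0" unfolding A_def using mass_const_pos by (intro mult_nonneg_nonneg) auto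
  have pt: "ennreal (kernel_weight S g v) * gauss_mass X (prec g v)
     = ennreal A * gauss_mass X 1 * ennreal (v powr (- ?N - 1) * exp (- S / (2 * v)))" if v: "v > 0" for v
  proof -
    have "prec g v = (1 + g) / (2 * (g * v))" using g v by (simp add: field_simps)
    then have p1: "prec g v powr (- real k / 2) = (1 + g) powr (- real k / 2) * (2 powr (real k / 2) * (g powr (real k / 2) * v powr (real k / 2)))"
      using g v by (simp add: powr_divide powr_mult powr_minus_divide field_simps)
    have p2: "v powr (- (real n + real k + a) / 2 - 1) * v powr (real k / 2) = v powr (- ?N - 1)"
      unfolding powr_add[symmetric] by (rule arg_cong[where f="(powr) v"]) (simp add: field_simps)
    have p3: "g powr (- real k / 2) * g powr (real k / 2) = 1"
      using g by (simp add: powr_add[symmetric])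
    have perm: "C * (gm * vm * E * G) * (w * (t * (gk * vk))) = C * t * (w * G) * (vm * vk * E) * (gm * gk)"
      for C gm vm E G w t gk vk :: real by (simp only: mult_ac)
    have kw: "kernel_weight S g v * prec g v powr (- real k / 2)
      = A * (v powr (- ?N - 1) * exp (- S / (2 * v)))"
      by (simp only: kernel_weight_def p1 perm p2 p3 A_def mult_1_right)
    have "ennreal (kernel_weight S g v) * gauss_mass X (prec g v)
      = ennreal (kernel_weight S g v * prec g v powr (- real k / 2)) * gauss_mass X 1"
      unfolding gauss_mass_prec[OF g v] by (simp only: ennreal_mult'[OF kernel_weight_nonneg] mult.assoc)
    also have "\<dots> = ennreal A * gauss_mass X 1 * ennreal (v powr (- ?N - 1) * exp (- S / (2 * v)))"
      unfolding kw by (simp only: ennreal_mult'[OF A] mult_ac)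
    finally show ?thesis .
  qed
  have "(\<integral>\<^sup>+v\<in>{0<..}. ennreal (kernel_weight S g v) * gauss_mass X (prec g v) \<partial>lborel)
    = (\<integral>\<^sup>+v. ennreal A * gauss_mass X 1 * (ennreal (v powr (- ?N - 1) * exp (- S / (2 * v))) * indicator {0<..} v) \<partial>lborel)"
    using pt by (intro nn_integral_cong) (simp add: indicator_def)
  also have "\<dots> = ennreal A * gauss_mass X 1 * (\<integral>\<^sup>+v\<in>{0<..}. ennreal (v powr (- ?N - 1) * exp (- S / (2 * v))) \<partial>lborel)"
    by (intro nn_integral_cmult) measurable
  also have "(\<integral>\<^sup>+v\<in>{0<..}. ennreal (v powr (- ?N - 1) * exp (- S / (2 * v))) \<partial>lborel) = ennreal (S powr (- ?N)) * inv_gamma_mass ?N"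
    unfolding inv_gamma_mass_def using N S by (intro nn_integral_inv_gamma_scale) auto
  also have "ennreal A * gauss_mass X 1 * (ennreal (S powr (- ?N)) * inv_gamma_mass ?N)
    = total_const * ennreal (marg S g)"
  proof -
    have e: "A = (mass_const X s * 2 powr (real k / 2)) * ((1 + g) powr (- real k / 2) * (g powr (- 3 / 2) * exp (- real n / (2 * g))))"
      unfolding A_def by simp
    have N: "- ?N = - (real n + a) / 2" by linarith
    have perm: "ennreal (c * w) * x * (ennreal q * y) = ennreal c * x * y * ennreal (w * q)"
      if "c \<ge> 0" "w \<ge> 0" "q \<ge> 0" for c w q :: real and x y :: ennreal
      using that by (simp add: ennreal_mult mult_ac)
    show ?thesis unfolding total_const_def g_density_def e N
      by (rule perm) (use mass_const_pos in auto)
  qed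
  finally show ?thesis .
qed

lemma joint_mass_inner:
  "joint_mass a b X \<gamma> bh s B = (\<integral>\<^sup>+g\<in>{0<..}. (\<integral>\<^sup>+v\<in>{0<..}. inner_mass B g v \<partial>lborel) \<partial>lborel)"
proof -
  have "(\<integral>\<^sup>+v. inner_mass B g v \<partial>lborel) = (\<integral>\<^sup>+v\<in>{0<..}. inner_mass B g v \<partial>lborel) * indicator {0<..} g" for g
  proof (cases "g > 0")
    case True
    then show ?thesis
      using inner_mass_zero[of g _ B] by (simp, intro nn_integral_cong) (simp split: split_indicator)
  next
    case False
    then show ?thesis by (simp add: inner_mass_zero)
  qed
  then show ?thesis unfolding joint_mass_def by simp
qed

context
  assumes N: "real n + a > 0" and b: "b \<ge> 0"
begin

lemma data_scale_pos: "g > 0 \<Longrightarrow> scale_at g > 0"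
  unfolding data_scale_def discrepancy_def using s b gform_nonneg
  by (intro add_pos_nonneg) auto

lemma joint_mass_UNIV:
  "joint_mass a b X \<gamma> bh s UNIV
    = total_const * (\<integral>\<^sup>+g\<in>{0<..}. ennreal (marg (scale_at g) g) \<partial>lborel)"
proof -
  have "joint_mass a b X \<gamma> bh s UNIV
    = (\<integral>\<^sup>+g. total_const * (ennreal (marg (scale_at g) g) * indicator {0<..} g) \<partial>lborel)"
    unfolding joint_mass_inner
  proof (intro nn_integral_cong)
    fix g :: real
    show "(\<integral>\<^sup>+v\<in>{0<..}. inner_mass UNIV g v \<partial>lborel) * indicator {0<..} g
      = total_const * (ennreal (marg (scale_at g) g) * indicator {0<..} g)"
    proof (cases "g > 0")
      case True
      have "(\<integral>\<^sup>+v\<in>{0<..}. inner_mass UNIV g v \<partial>lborel)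
        = (\<integral>\<^sup>+v\<in>{0<..}. ennreal (kernel_weight (scale_at g) g v) * gauss_mass X (prec g v) \<partial>lborel)"
        using inner_mass_UNIV[OF True] by (intro nn_integral_cong) (auto split: split_indicator)
      then show ?thesis using integrate_variance[OF N data_scale_pos[OF True] True] True by simp
    qed simp
  qed
  also have "\<dots> = total_const * (\<integral>\<^sup>+g\<in>{0<..}. ennreal (marg (scale_at g) g) \<partial>lborel)"
    unfolding g_density_def data_scale_def by (intro nn_integral_cmult) measurable
  finally show ?thesis .
qed

text \<open>The weight \<phi> merges two bounds into one integrand: the trivial bound where it is at
  least 1, the tail bound elsewhere. Measurability is then required of \<phi> alone, not of
  \<open>B\<close> or of the inner integrals as functions of \<open>g\<close>.\<close>

lemma joint_mass_le:
  assumes r: "r > 0" and K: "K > 0" and diag: "\<And>j. j < k \<Longrightarrow> dual X j j \<le> K"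
    and \<phi>m: "\<phi> \<in> borel_measurable borel"
    and \<phi>: "\<And>g. g > 0 \<Longrightarrow> \<phi> g \<ge> 1 \<or>
       (\<forall>f. Matrix.vec k f \<in> B \<longrightarrow> (\<exists>j<k. \<bar>f j - post_mean \<gamma> bh g j\<bar> > r)) \<and>
       2 * real k * marg (scale_at g + r\<^sup>2 / K) g \<le> \<phi> g * marg (scale_at g) g"
  shows "joint_mass a b X \<gamma> bh s B
    \<le> total_const * (\<integral>\<^sup>+g\<in>{0<..}. ennreal (\<phi> g * marg (scale_at g) g) \<partial>lborel)"
proof -
  note \<phi>m[measurable]
  have "joint_mass a b X \<gamma> bh s B
    \<le> (\<integral>\<^sup>+g. total_const * (ennreal (\<phi> g * marg (scale_at g) g) * indicator {0<..} g) \<partial>lborel)"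
    unfolding joint_mass_inner
  proof (intro nn_integral_mono)
    fix g :: real
    show "(\<integral>\<^sup>+v\<in>{0<..}. inner_mass B g v \<partial>lborel) * indicator {0<..} g
      \<le> total_const * (ennreal (\<phi> g * marg (scale_at g) g) * indicator {0<..} g)"
    proof (cases "g > 0")
      case True
      have "(\<integral>\<^sup>+v\<in>{0<..}. inner_mass B g v \<partial>lborel) \<le> total_const * ennreal (\<phi> g * marg (scale_at g) g)"
      proof (cases "\<phi> g \<ge> 1")
        case 1: True
        have "inner_mass B g v \<le> ennreal (kernel_weight (scale_at g) g v) * gauss_mass X (prec g v)"
          if v: "v > 0" for v
        proof -
          have "inner_mass B g v \<le> inner_mass UNIV g v"
            by (intro nn_integral_mono mult_left_mono) (auto split: split_indicator)
          also note inner_mass_UNIV[OF True v]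
          finally show ?thesis .
        qed
        then have "(\<integral>\<^sup>+v\<in>{0<..}. inner_mass B g v \<partial>lborel)
          \<le> (\<integral>\<^sup>+v\<in>{0<..}. ennreal (kernel_weight (scale_at g) g v) * gauss_mass X (prec g v) \<partial>lborel)"
          by (intro nn_integral_mono) (simp split: split_indicator)
        also have "\<dots> = total_const * ennreal (marg (scale_at g) g)"
          by (rule integrate_variance[OF N data_scale_pos[OF True] True])
        also have "\<dots> \<le> total_const * ennreal (\<phi> g * marg (scale_at g) g)"
          using mult_right_mono[OF 1 g_density_nonneg[of n k a "scale_at g" g]]
          by (intro mult_left_mono ennreal_leI) auto
        finally show ?thesis .
      next
        case False
        with \<phi>[OF True] have B: "\<And>f. Matrix.vec k f \<in> B \<Longrightarrow> \<exists>j<k. \<bar>f j - post_mean \<gamma> bh g j\<bar> > r"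
          and le: "2 * real k * marg (scale_at g + r\<^sup>2 / K) g \<le> \<phi> g * marg (scale_at g) g"
          by auto
        have S: "scale_at g + r\<^sup>2 / K > 0" using data_scale_pos[OF True] K by (simp add: add_pos_nonneg)
        have "(\<integral>\<^sup>+v\<in>{0<..}. inner_mass B g v \<partial>lborel)
          \<le> (\<integral>\<^sup>+v. ennreal (2 * real k) * (ennreal (kernel_weight (scale_at g + r\<^sup>2 / K) g v) * gauss_mass X (prec g v) * indicator {0<..} v) \<partial>lborel)"
          using inner_mass_tail[OF True _ r K diag B]
          by (intro nn_integral_mono) (auto split: split_indicator)
        \<comment> \<open>The explicit power of \<open>prec g v\<close> makes measurability in
          \<open>v\<close> evident, so that the constant can be pulled out; the rewriting is undone
          right after.\<close>
        also have "\<dots> = (\<integral>\<^sup>+v. ennreal (2 * real k) * (ennreal (kernel_weight (scale_at g + r\<^sup>2 / K) g v) * (ennreal (prec g v powr (- real k / 2)) * gauss_mass X 1) * indicator {0<..} v) \<partial>lborel)"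
          by (intro nn_integral_cong) (simp split: split_indicator add: gauss_mass_prec[OF True])
        also have "\<dots> = ennreal (2 * real k) * (\<integral>\<^sup>+v. (ennreal (kernel_weight (scale_at g + r\<^sup>2 / K) g v) * (ennreal (prec g v powr (- real k / 2)) * gauss_mass X 1) * indicator {0<..} v) \<partial>lborel)"
          unfolding kernel_weight_def by (intro nn_integral_cmult) measurable
        also have "(\<integral>\<^sup>+v. (ennreal (kernel_weight (scale_at g + r\<^sup>2 / K) g v) * (ennreal (prec g v powr (- real k / 2)) * gauss_mass X 1) * indicator {0<..} v) \<partial>lborel)
          = (\<integral>\<^sup>+v\<in>{0<..}. ennreal (kernel_weight (scale_at g + r\<^sup>2 / K) g v) * gauss_mass X (prec g v) \<partial>lborel)"
          by (intro nn_integral_cong) (simp split: split_indicator add: gauss_mass_prec[OF True])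
        also have "\<dots> = total_const * ennreal (marg (scale_at g + r\<^sup>2 / K) g)"
          by (rule integrate_variance[OF N S True])
        also have "ennreal (2 * real k) * (total_const * ennreal (marg (scale_at g + r\<^sup>2 / K) g))
          = total_const * ennreal (2 * real k * marg (scale_at g + r\<^sup>2 / K) g)"
          using g_density_nonneg by (subst ennreal_mult) (auto simp: mult_ac)
        also have "\<dots> \<le> total_const * ennreal (\<phi> g * marg (scale_at g) g)"
          by (intro mult_left_mono ennreal_leI le) auto
        finally show ?thesis .
      qed
      then show ?thesis using True by simp
    qed simp
  qed
  also have "\<dots> = total_const * (\<integral>\<^sup>+g\<in>{0<..}. ennreal (\<phi> g * marg (scale_at g) g) \<partial>lborel)"
    unfolding g_density_def data_scale_def by (intro nn_integral_cmult) measurable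
  finally show ?thesis .
qed

section \<open>Normalisation and Bayes' formula\<close>

lemma marginal_pos: "(\<integral>\<^sup>+g\<in>{0<..}. ennreal (marg (scale_at g) g) \<partial>lborel) \<noteq> 0"
proof
  assume "(\<integral>\<^sup>+g\<in>{0<..}. ennreal (marg (scale_at g) g) \<partial>lborel) = 0"
  moreover have "(\<lambda>g. ennreal (marg (scale_at g) g) * indicator {0<..} g) \<in> borel_measurable lborel"
    unfolding g_density_def data_scale_def by measurable
  ultimately have "AE g in lborel. ennreal (marg (scale_at g) g) * indicator {0<..} g = 0"
    by (subst (asm) nn_integral_0_iff_AE) auto
  then have "AE g in lborel. g \<notin> {0<..(1::real)}"
  proof eventually_elim
    case (elim g)
    show ?case
    proof
      assume g: "g \<in> {0<..1}"
      then have "marg (scale_at g) g > 0"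
        unfolding g_density_def using data_scale_pos[of g] by (intro mult_pos_pos) auto
      with elim g show False by simp
    qed
  qed
  then have "{0<..(1::real)} \<in> null_sets lborel"
    by (subst AE_iff_null_sets) auto
  then show False by (simp add: null_sets_def)
qed

text \<open>The factors besides the prior of \<open>g\<close> are bounded in \<open>g\<close>, and
  that prior is proper.\<close>

lemma marginal_finite: "(\<integral>\<^sup>+g\<in>{0<..}. ennreal (marg (scale_at g) g) \<partial>lborel) < \<infinity>"
proof -
  let ?c = "(s + b) powr (- (real n + a) / 2)"
  have "(\<integral>\<^sup>+g\<in>{0<..}. ennreal (marg (scale_at g) g) \<partial>lborel)
    \<le> (\<integral>\<^sup>+g. ennreal ?c * (ennreal (g powr (- (1/2) - 1) * exp (- real n / (2 * g))) * indicator {0<..} g) \<partial>lborel)"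
  proof (rule nn_integral_mono)
    fix g :: real
    show "ennreal (marg (scale_at g) g) * indicator {0<..} g
      \<le> ennreal ?c * (ennreal (g powr (- (1/2) - 1) * exp (- real n / (2 * g))) * indicator {0<..} g)"
    proof (cases "g > 0")
      case True
      have 1: "(1 + g) powr (- real k / 2) \<le> 1"
        using True powr_mono[of "- real k / 2" 0 "1 + g"] by simp
      have 2: "scale_at g powr (- (real n + a) / 2) \<le> ?c"
        using True s b N gform_nonneg[of X]
        by (intro powr_mono2') (auto simp: data_scale_def discrepancy_def)
      have "marg (scale_at g) g \<le> 1 * (g powr (- 3 / 2) * exp (- real n / (2 * g))) * ?c"
        unfolding g_density_def by (intro mult_mono 1 2) auto
      then have "ennreal (marg (scale_at g) g) \<le> ennreal (?c * (g powr (- (1/2) - 1) * exp (- real n / (2 * g))))"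
        by (intro ennreal_leI) (simp add: mult_ac)
      then show ?thesis using True by (simp add: ennreal_mult')
    qed simp
  qed
  also have "\<dots> = ennreal ?c * (\<integral>\<^sup>+g\<in>{0<..}. ennreal (g powr (- (1/2) - 1) * exp (- real n / (2 * g))) \<partial>lborel)"
    by (intro nn_integral_cmult) measurable
  also have "\<dots> < \<infinity>"
    using nn_integral_inv_gamma_scale[of "1/2" "real n"] nn_integral_inv_gamma_finite[of "1/2"] kn
    by (auto simp: ennreal_mult_less_top)
  finally show ?thesis .
qed

text \<open>On \<open>bad\<close> the density is at most \<open>1 / G\<close> times the density
  transported by doubling, and the transported density has the same integral as the original one;
  this gives the term \<open>1 / G\<close>. Off \<open>bad\<close> the tail event has conditional
  probability at most \<kappa>, after the variance has been integrated out.\<close>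

lemma posterior_prob_le:
  assumes L: "L > 0" and le: "\<And>f. (\<Sum>j<k. (f j)\<^sup>2) \<le> L * gform X f"
    and r: "r > 0" and diag: "\<And>j. j < k \<Longrightarrow> dual X j j \<le> L"
    and bad[measurable]: "bad \<in> sets borel" and G: "G > 0" and \<kappa>: "\<kappa> \<ge> 0"
    and bad_le: "\<And>g. g > 0 \<Longrightarrow> g \<in> bad \<Longrightarrow>
       G * marg (scale_at g) g \<le> 2 * marg (scale_at (2 * g)) (2 * g)"
    and good: "\<And>g f. g > 0 \<Longrightarrow> g \<notin> bad \<Longrightarrow> Matrix.vec k f \<in> B \<Longrightarrow> \<exists>j<k. \<bar>f j - post_mean \<gamma> bh g j\<bar> > r"
    and good_le: "\<And>g. g > 0 \<Longrightarrow> g \<notin> bad \<Longrightarrow>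
       2 * real k * marg (scale_at g + r\<^sup>2 / L) g \<le> \<kappa> * marg (scale_at g) g"
  shows "0 \<le> posterior_prob a b X \<gamma> bh s B" "posterior_prob a b X \<gamma> bh s B \<le> 1 / G + \<kappa>"
proof -
  let ?I = "\<integral>\<^sup>+g\<in>{0<..}. ennreal (marg (scale_at g) g) \<partial>lborel"
  define \<phi> where "\<phi> = (\<lambda>g::real. indicator bad g + \<kappa> :: real)"
  have [measurable]: "(\<lambda>g. marg (scale_at g) g) \<in> borel_measurable borel"
    unfolding g_density_def data_scale_def by measurable
  have tc: "total_const \<noteq> 0" "total_const \<noteq> \<infinity>"
  proof -
    have "gauss_mass X 1 < \<infinity>" by (rule gauss_mass_finite[OF L]) (use le X in auto)
    moreover have "inv_gamma_mass ((real n + a) / 2) < \<infinity>" "inv_gamma_mass ((real n + a) / 2) > 0"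
      unfolding inv_gamma_mass_def using N
      by (intro nn_integral_inv_gamma_finite nn_integral_inv_gamma_pos; simp)+
    ultimately show "total_const \<noteq> 0" "total_const \<noteq> \<infinity>"
      unfolding total_const_def using gauss_mass_pos[of X 1] mass_const_pos
      by (auto simp: ennreal_mult_eq_top_iff)
  qed
  have "joint_mass a b X \<gamma> bh s B
    \<le> total_const * (\<integral>\<^sup>+g\<in>{0<..}. ennreal (\<phi> g * marg (scale_at g) g) \<partial>lborel)"
  proof (rule joint_mass_le[OF r L diag])
    show "\<phi> \<in> borel_measurable borel" unfolding \<phi>_def by measurable
    fix g :: real assume g: "g > 0"
    show "\<phi> g \<ge> 1 \<or>
       (\<forall>f. Matrix.vec k f \<in> B \<longrightarrow> (\<exists>j<k. \<bar>f j - post_mean \<gamma> bh g j\<bar> > r)) \<and>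
       2 * real k * marg (scale_at g + r\<^sup>2 / L) g \<le> \<phi> g * marg (scale_at g) g"
      unfolding \<phi>_def using good[OF g] good_le[OF g] \<kappa> by (cases "g \<in> bad") auto
  qed
  moreover have "(\<integral>\<^sup>+g\<in>{0<..}. ennreal (\<phi> g * marg (scale_at g) g) \<partial>lborel) \<le> ennreal (1 / G + \<kappa>) * ?I"
  proof -
    have "(\<integral>\<^sup>+g\<in>{0<..}. ennreal (\<phi> g * marg (scale_at g) g) \<partial>lborel)
      \<le> (\<integral>\<^sup>+g. ennreal (1 / G) * (ennreal (2 * marg (scale_at (2 * g)) (2 * g)) * indicator {0<..} g)
           + ennreal \<kappa> * (ennreal (marg (scale_at g) g) * indicator {0<..} g) \<partial>lborel)"
    proof (rule nn_integral_mono)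
      fix g :: real
      show "ennreal (\<phi> g * marg (scale_at g) g) * indicator {0<..} g
        \<le> ennreal (1 / G) * (ennreal (2 * marg (scale_at (2 * g)) (2 * g)) * indicator {0<..} g)
           + ennreal \<kappa> * (ennreal (marg (scale_at g) g) * indicator {0<..} g)"
      proof (cases "g > 0")
        case True
        have "\<phi> g * marg (scale_at g) g
          \<le> 1 / G * (2 * marg (scale_at (2 * g)) (2 * g)) + \<kappa> * marg (scale_at g) g"
        proof (cases "g \<in> bad")
          case b: True
          then show ?thesis using bad_le[OF True b] G unfolding \<phi>_def by (simp add: field_simps)
        next
          case False
          then show ?thesis unfolding \<phi>_def using G g_density_nonneg by simp
        qed
        then have "ennreal (\<phi> g * marg (scale_at g) g)
          \<le> ennreal (1 / G * (2 * marg (scale_at (2 * g)) (2 * g)) + \<kappa> * marg (scale_at g) g)"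
          by (rule ennreal_leI)
        also have "\<dots> = ennreal (1 / G) * ennreal (2 * marg (scale_at (2 * g)) (2 * g))
           + ennreal \<kappa> * ennreal (marg (scale_at g) g)"
        proof -
          have "ennreal (x * y + z * w) = ennreal x * ennreal y + ennreal z * ennreal w"
            if "x \<ge> 0" "y \<ge> 0" "z \<ge> 0" "w \<ge> 0" for x y z w
            using that by (simp add: ennreal_mult)
          then show ?thesis by this (use G \<kappa> g_density_nonneg in auto)
        qed
        finally show ?thesis using True by simp
      qed simp
    qed
    also have "\<dots> = ennreal (1 / G) * (\<integral>\<^sup>+g\<in>{0<..}. ennreal (2 * marg (scale_at (2 * g)) (2 * g)) \<partial>lborel)
         + ennreal \<kappa> * ?I"
    proof -
      have [measurable]: "(\<lambda>g. marg (scale_at (2 * g)) (2 * g)) \<in> borel_measurable borel"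
        unfolding g_density_def data_scale_def by measurable
      show ?thesis by (subst nn_integral_add) (auto simp: nn_integral_cmult)
    qed
    also have "(\<integral>\<^sup>+g\<in>{0<..}. ennreal (2 * marg (scale_at (2 * g)) (2 * g)) \<partial>lborel) = ?I"
    proof -
      have [measurable]: "(\<lambda>g. marg (scale_at (2 * g)) (2 * g)) \<in> borel_measurable borel"
        unfolding g_density_def data_scale_def by measurable
      have "?I = ennreal 2 * (\<integral>\<^sup>+g. ennreal (marg (scale_at (0 + 2 * g)) (0 + 2 * g)) * indicator {0<..} (0 + 2 * g) \<partial>lborel)"
        by (subst nn_integral_real_affine[of _ 2 0]) auto
      also have "\<dots> = (\<integral>\<^sup>+g. ennreal 2 * (ennreal (marg (scale_at (2 * g)) (2 * g)) * indicator {0<..} g) \<partial>lborel)"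
        by (subst nn_integral_cmult) (auto simp: indicator_def)
      also have "\<dots> = (\<integral>\<^sup>+g\<in>{0<..}. ennreal (2 * marg (scale_at (2 * g)) (2 * g)) \<partial>lborel)"
        by (intro nn_integral_cong) (simp add: ennreal_mult' mult.assoc)
      finally show ?thesis by simp
    qed
    also have "ennreal (1 / G) * ?I + ennreal \<kappa> * ?I = ennreal (1 / G + \<kappa>) * ?I"
      using G \<kappa> by (simp add: distrib_right)
    finally show ?thesis .
  qed
  ultimately have "joint_mass a b X \<gamma> bh s B \<le> total_const * (ennreal (1 / G + \<kappa>) * ?I)"
    using order_trans[OF _ mult_left_mono[of _ _ total_const]] by simp
  then have le: "joint_mass a b X \<gamma> bh s B \<le> ennreal (1 / G + \<kappa>) * joint_mass a b X \<gamma> bh s UNIV"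
    unfolding joint_mass_UNIV by (simp only: mult.left_commute)
  \<comment> \<open>This excludes the branch in which \<open>posterior_prob\<close> is
    unspecified.\<close>
  have J: "joint_mass a b X \<gamma> bh s UNIV \<noteq> 0" "joint_mass a b X \<gamma> bh s UNIV \<noteq> \<infinity>"
    unfolding joint_mass_UNIV using tc marginal_pos marginal_finite
    by (auto simp: ennreal_mult_eq_top_iff)
  have "joint_mass a b X \<gamma> bh s B / joint_mass a b X \<gamma> bh s UNIV
    \<le> ennreal (1 / G + \<kappa>) * joint_mass a b X \<gamma> bh s UNIV / joint_mass a b X \<gamma> bh s UNIV"
    by (rule divide_right_mono_ennreal[OF le])
  also have "\<dots> = ennreal (1 / G + \<kappa>)" using J by (simp add: ennreal_mult_divide_eq)
  finally have "enn2real (joint_mass a b X \<gamma> bh s B / joint_mass a b X \<gamma> bh s UNIV) \<le> 1 / G + \<kappa>"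
    using G \<kappa> by (intro enn2real_leI) auto
  then show "posterior_prob a b X \<gamma> bh s B \<le> 1 / G + \<kappa>"
    unfolding posterior_prob_def using J by auto
  show "0 \<le> posterior_prob a b X \<gamma> bh s B"
    unfolding posterior_prob_def using J by auto
qed

end

end

section \<open>Doubling the scale parameter\<close>

text \<open>The 2 on the left is the Jacobian of the doubling; together with
  \<open>2 powr (- 3 / 2)\<close> from the prior it leaves \<open>2 powr (- 1 / 2)\<close>. The
  other factors compare shrinkage, prior exponential and scale.\<close>

lemma g_density_double:
  assumes g: "g > 0" and U: "U > 0" "U' > 0"
  shows "2 * g_density n k a U' (2 * g)
    = 2 powr (- 1 / 2) * ((1 + 2 * g) / (1 + g)) powr (- real k / 2) * exp (real n / (4 * g))
        * (U / U') powr ((real n + a) / 2) * g_density n k a U g"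
proof -
  have 1: "((1 + 2 * g) / (1 + g)) powr (- real k / 2) * (1 + g) powr (- real k / 2) = (1 + 2 * g) powr (- real k / 2)"
    using g by (simp add: powr_mult[symmetric])
  have 2: "exp (real n / (4 * g)) * exp (- real n / (2 * g)) = exp (- real n / (2 * (2 * g)))"
    using g by (simp add: exp_add[symmetric] field_simps)
  have 3: "(U / U') powr ((real n + a) / 2) * U powr (- (real n + a) / 2) = U' powr (- (real n + a) / 2)"
  proof -
    have e: "- (real n + a) / 2 = - ((real n + a) / 2)" by linarith
    have "(U / U') powr M * U powr - M = U' powr - M" for M
      using U by (simp add: powr_divide powr_minus_divide)
    then show ?thesis unfolding e .
  qed
  have 4: "2 * (2 * g) powr (- 3 / 2) = 2 powr (- 1 / 2) * g powr (- 3 / 2)"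
  proof -
    have "(2::real) powr (1 + (- 3 / 2)) = 2 powr 1 * 2 powr (- 3 / 2)" by (rule powr_add)
    then show ?thesis using g by (simp add: powr_mult)
  qed
  have "2 powr (- 1 / 2) * x * e * u * (y * (w * d) * z) = (x * y) * (2 powr (- 1 / 2) * w * (e * d)) * (u * z)"
    for x e u y w d z :: real by (simp only: mult_ac)
  then show ?thesis
    unfolding g_density_def by (simp only: 1 2 3 4[symmetric])
qed

text \<open>With \<rho> the quotient of \<open>1 + 2 * g\<close> and \<open>1 + g\<close>, doubling
  divides the dominant part of the scale by \<rho>. The gain is nearly \<rho> to the power
  \<open>(n + a) / 2\<close>, the loss is \<rho> to the power \<open>k / 2\<close>, so an exponent
  of at least \<open>\<theta> * n / 2\<close> survives.\<close>

lemma gain_large_discrepancy: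
  fixes a :: real
  assumes g: "g > 0" and S: "S > 0" and T: "T \<ge> 0" and Q: "Q > 0" and big: "Q * S \<le> T / (1 + g)"
    and \<theta>: "\<theta> \<ge> 0" "\<theta> * real n \<le> real n + a - real k" and a: "\<bar>a\<bar> \<le> real n"
    and c: "c > 0" "c \<le> \<theta> / 2 * ln (3 / 2)" "c \<le> 1 / 4" "Q * c \<ge> 4"
  shows "2 powr (- 1 / 2) * exp (c / 2 * real n) * g_density n k a (S + T / (1 + g)) g
    \<le> 2 * g_density n k a (S + T / (1 + 2 * g)) (2 * g)"
proof -
  define \<rho> where "\<rho> = (1 + 2 * g) / (1 + g)"
  define t where "t = T / (1 + g)"
  define N where "N = (real n + a) / 2"
  have \<rho>: "1 \<le> \<rho>" "\<rho> \<le> 2" unfolding \<rho>_def using g by (auto simp: field_simps)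
  have t: "Q * S \<le> t" "t > 0" using big S Q unfolding t_def by (auto intro: less_le_trans[OF mult_pos_pos])
  have N: "N \<ge> 0" unfolding N_def using a by (simp add: abs_le_iff)
  have U: "S + t > 0" using S t by simp
  have t2: "T / (1 + 2 * g) = t / \<rho>" unfolding t_def \<rho>_def using g by simp
  have U': "S + t / \<rho> > 0" using S t \<rho> by (simp add: add_pos_nonneg)
  have ratio: "\<rho> / (1 + 2 / Q) \<le> (S + t) / (S + t / \<rho>)"
  proof -
    have "\<rho> * (S + t / \<rho>) = \<rho> * S + t" using \<rho> by (simp add: field_simps)
    also have "\<dots> \<le> 2 * S + t" using \<rho> S by (simp add: mult_right_mono)
    also have "\<dots> \<le> (S + t) * (1 + 2 / Q)"
    proof -
      have "2 / Q * t \<ge> 2 * S" using t Q by (simp add: field_simps)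
      moreover have "2 / Q * S \<ge> 0" using Q S by simp
      moreover have "(S + t) * (1 + q) = S + t + q * S + q * t" for q by (simp add: algebra_simps)
      ultimately show ?thesis using S by simp
    qed
    finally show ?thesis using U' Q by (simp add: divide_le_eq le_divide_eq add_pos_pos mult.commute)
  qed
  have "exp (c / 2 * real n) \<le> \<rho> powr (- real k / 2) * exp (real n / (4 * g)) * ((S + t) / (S + t / \<rho>)) powr N"
  proof -
    \<comment> \<open>\<open>S\<close> itself does not shrink, so the scale drops by \<rho> only up
      to the factor \<open>1 + 2 / Q\<close>. The condition \<open>Q * c \<ge> 4\<close> limits this
      defect to half of the rate \<open>c\<close>.\<close>
    have lnQ: "ln (1 + 2 / Q) * N \<le> c / 2 * real n"
    proof -
      have "ln (1 + 2 / Q) \<le> 2 / Q" using Q by (intro ln_add_one_self_le_self) simp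
      then have "ln (1 + 2 / Q) * N \<le> 2 / Q * real n"
        using N Q a unfolding N_def by (intro mult_mono) auto
      also have "2 / Q \<le> c / 2" using Q c by (simp add: field_simps)
      finally show ?thesis by (simp add: mult_right_mono)
    qed
    \<comment> \<open>For \<open>g \<ge> 1\<close> the quotient \<rho> is at least 3/2 and the power
      of \<rho> suffices. For small \<open>g\<close> it may be close to 1, but then
      \<open>exp (real n / (4 * g))\<close> is at least \<open>exp (real n / 4)\<close>.\<close>
    have cn: "c * real n \<le> ln \<rho> * (N - real k / 2) + real n / (4 * g)"
    proof (cases "g \<ge> 1")
      case True
      have "3 / 2 \<le> \<rho>" unfolding \<rho>_def using True by (simp add: field_simps)
      then have "ln (3 / 2) \<le> ln \<rho>" by simp
      moreover have "\<theta> / 2 * real n \<le> N - real k / 2" unfolding N_def using \<theta> by (simp add: field_simps)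
      ultimately have "ln (3 / 2) * (\<theta> / 2 * real n) \<le> ln \<rho> * (N - real k / 2)"
        using \<theta> \<rho> by (intro mult_mono) auto
      moreover have "c * real n \<le> \<theta> / 2 * ln (3 / 2) * real n" using c by (intro mult_right_mono) auto
      moreover have "\<theta> / 2 * ln (3 / 2) * real n = ln (3 / 2) * (\<theta> / 2 * real n)" by (simp only: mult_ac)
      ultimately have "c * real n \<le> ln \<rho> * (N - real k / 2)" by linarith
      moreover have "real n / (4 * g) \<ge> 0" using g by simp
      ultimately show ?thesis by linarith
    next
      case False
      have "c * real n \<le> 1 / 4 * real n" using c by (intro mult_right_mono) auto
      also have "1 / 4 * real n = real n / 4" by simp
      also have "\<dots> \<le> real n / (4 * g)" using False g by (intro divide_left_mono) auto
      finally have "c * real n \<le> real n / (4 * g)" .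
      moreover have "N - real k / 2 \<ge> 0" unfolding N_def
        using order_trans[OF _ \<theta>(2), of 0] \<theta>(1) by simp
      then have "ln \<rho> * (N - real k / 2) \<ge> 0" using \<rho> by (intro mult_nonneg_nonneg) auto
      ultimately show ?thesis by linarith
    qed
    have "exp (c / 2 * real n) \<le> exp (- real k / 2 * ln \<rho> + real n / (4 * g) + N * (ln \<rho> - ln (1 + 2 / Q)))"
      using lnQ cn by (simp add: algebra_simps)
    also have "\<dots> = \<rho> powr (- real k / 2) * exp (real n / (4 * g)) * (\<rho> / (1 + 2 / Q)) powr N"
    proof -
      have q: "1 + 2 / Q > 0" using Q by (simp add: add_pos_pos)
      have "\<rho> powr (- real k / 2) = exp (- real k / 2 * ln \<rho>)" using \<rho> by (simp add: powr_def)
      moreover have "(\<rho> / (1 + 2 / Q)) powr N = exp (N * (ln \<rho> - ln (1 + 2 / Q)))"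
        using \<rho> q by (simp add: powr_def ln_div)
      ultimately show ?thesis by (simp only: exp_add)
    qed
    also have "\<dots> \<le> \<rho> powr (- real k / 2) * exp (real n / (4 * g)) * ((S + t) / (S + t / \<rho>)) powr N"
      using ratio N \<rho> Q by (intro mult_left_mono powr_mono2) (auto intro!: divide_nonneg_nonneg add_nonneg_nonneg)
    finally show ?thesis .
  qed
  then have "2 powr (- 1 / 2) * exp (c / 2 * real n) * g_density n k a (S + t) g
    \<le> 2 powr (- 1 / 2) * (\<rho> powr (- real k / 2) * exp (real n / (4 * g)) * ((S + t) / (S + t / \<rho>)) powr N) * g_density n k a (S + t) g"
    by (intro mult_right_mono mult_left_mono) (auto simp: g_density_def)
  also have "\<dots> = 2 * g_density n k a (S + t / \<rho>) (2 * g)"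
    unfolding g_density_double[OF g U U'] \<rho>_def[symmetric] N_def[symmetric] by (simp only: mult.assoc)
  finally show ?thesis unfolding t_def[symmetric] t2 .
qed

text \<open>The scale cannot grow under doubling, so the only loss is \<rho> to the power
  \<open>- k / 2\<close>, with \<rho> at most 2. The exponential of the prior, at least
  \<open>exp (real n / (4 * w))\<close>, has to pay for it.\<close>

lemma gain_small_g:
  fixes a :: real
  assumes g: "g > 0" and S: "S > 0" and T: "T \<ge> 0" and w: "g \<le> w"
    and N: "real n + a \<ge> 0" and k: "real k * ln 2 / 2 + c * real n \<le> real n / (4 * w)"
  shows "2 powr (- 1 / 2) * exp (c * real n) * g_density n k a (S + T / (1 + g)) g
    \<le> 2 * g_density n k a (S + T / (1 + 2 * g)) (2 * g)"
proof -
  define \<rho> where "\<rho> = (1 + 2 * g) / (1 + g)"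
  define U where "U = S + T / (1 + g)"
  define U' where "U' = S + T / (1 + 2 * g)"
  have \<rho>: "1 \<le> \<rho>" "\<rho> \<le> 2" unfolding \<rho>_def using g by (auto simp: field_simps)
  have U: "U > 0" "U' > 0" unfolding U_def U'_def using S T g by (auto intro!: add_pos_nonneg divide_nonneg_nonneg)
  have "U' \<le> U" unfolding U_def U'_def using T g by (intro add_left_mono divide_left_mono) auto
  then have "U / U' \<ge> 1" using U by simp
  then have u: "(U / U') powr ((real n + a) / 2) \<ge> 1" using N by (intro ge_one_powr_ge_zero) auto
  have "exp (c * real n) \<le> exp (- real k / 2 * ln \<rho> + real n / (4 * g))"
  proof -
    have "real k / 2 * ln \<rho> \<le> real k / 2 * ln 2" using \<rho> by (intro mult_left_mono) auto
    moreover have "real n / (4 * w) \<le> real n / (4 * g)" using g w by (intro divide_left_mono) auto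
    ultimately show ?thesis using k by simp
  qed
  also have "\<dots> = \<rho> powr (- real k / 2) * exp (real n / (4 * g)) * 1"
    using \<rho> by (simp add: powr_def exp_add[symmetric])
  also have "\<dots> \<le> \<rho> powr (- real k / 2) * exp (real n / (4 * g)) * (U / U') powr ((real n + a) / 2)"
    using u by (intro mult_left_mono) auto
  finally have "2 powr (- 1 / 2) * exp (c * real n) * g_density n k a U g
    \<le> 2 powr (- 1 / 2) * (\<rho> powr (- real k / 2) * exp (real n / (4 * g)) * (U / U') powr ((real n + a) / 2)) * g_density n k a U g"
    by (intro mult_right_mono mult_left_mono) (auto simp: g_density_def)
  also have "\<dots> = 2 * g_density n k a U' (2 * g)"
    unfolding g_density_double[OF g U] \<rho>_def[symmetric] by (simp only: mult.assoc)
  finally show ?thesis unfolding U_def U'_def .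
qed

text \<open>An increment proportional to the scale multiplies it by at least
  \<open>1 + \<eta>\<close>, and the exponent of the scale grows linearly in
  \<open>n\<close>.\<close>

lemma g_density_shift:
  assumes U: "U > 0" and D: "\<eta> * U \<le> D" and \<eta>: "\<eta> > 0" and N: "real n + a \<ge> 0"
  shows "g_density n k a (U + D) g \<le> (1 + \<eta>) powr (- (real n + a) / 2) * g_density n k a U g"
proof -
  have "(U + D) powr (- (real n + a) / 2) \<le> ((1 + \<eta>) * U) powr (- (real n + a) / 2)"
    using U \<eta> N D by (intro powr_mono2') (auto simp: algebra_simps add_pos_pos)
  also have "\<dots> = (1 + \<eta>) powr (- (real n + a) / 2) * U powr (- (real n + a) / 2)"
    using U \<eta> by (simp add: powr_mult)
  finally have "(1 + g) powr (- real k / 2) * (g powr (- 3 / 2) * exp (- real n / (2 * g))) * (U + D) powr (- (real n + a) / 2)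
    \<le> (1 + g) powr (- real k / 2) * (g powr (- 3 / 2) * exp (- real n / (2 * g)))
      * ((1 + \<eta>) powr (- (real n + a) / 2) * U powr (- (real n + a) / 2))"
    by (intro mult_left_mono) auto
  then show ?thesis unfolding g_density_def by (simp only: mult_ac)
qed

text \<open>Bolzano-Weierstrass turns the hypothesis on subsequences into a dichotomy for all large \<open>n\<close>.\<close>

lemma no_intermediate_subsequence:
  fixes d D :: "nat \<Rightarrow> real"
  assumes no: "\<not> (\<exists>(k :: nat \<Rightarrow> nat) A. strict_mono k \<and> (\<forall>n. 1 \<le> k n) \<and> 0 < A
               \<and> (\<lambda>n. (D (k n))\<^sup>2) \<longlonglongrightarrow> A \<and> \<not> (\<lambda>n. d (k n)) \<longlonglongrightarrow> 0)"
    and d: "\<And>n. 1 \<le> n \<Longrightarrow> d n \<le> D n" and \<eta>: "\<eta> > 0"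
  shows "eventually (\<lambda>n. d n < \<eta> \<or> D n > C) sequentially"
proof (rule ccontr)
  assume "\<not> ?thesis"
  then have "\<exists>\<^sub>F n in sequentially. \<not> (d n < \<eta> \<or> D n > C)" by (simp add: frequently_def)
  then have fr: "infinite {n. \<not> (d n < \<eta> \<or> D n > C)}"
    by (simp add: frequently_cofinite flip: cofinite_eq_sequentially)
  \<comment> \<open>Index 0 is removed because the excluded subsequences take values from 1
    on.\<close>
  have "infinite ({n. \<not> (d n < \<eta> \<or> D n > C)} - {0})"
    using fr by simp
  from infinite_enumerate[OF this] obtain k0 :: "nat \<Rightarrow> nat"
    where k0: "strict_mono k0" "\<And>n. k0 n \<in> {n. \<not> (d n < \<eta> \<or> D n > C)} - {0}" by blast
  have k0': "1 \<le> k0 n" "\<eta> \<le> d (k0 n)" "D (k0 n) \<le> C" for n using k0(2)[of n] by auto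
  \<comment> \<open>The lower bound passes to the limit and makes its square a legitimate positive
    \<open>A\<close>.\<close>
  have D: "\<eta> \<le> D (k0 n)" for n using d[OF k0'(1)] k0'(2)[of n] by (meson order_trans)
  have "bounded (range (\<lambda>n. D (k0 n)))"
    using D k0'(3) by (intro bounded_subset[OF bounded_closed_interval[of \<eta> C]]) auto
  from bounded_imp_convergent_subsequence[OF this]
  obtain l r where r: "strict_mono r" "((\<lambda>n. D (k0 n)) \<circ> r) \<longlonglongrightarrow> l" by blast
  have lim: "(\<lambda>n. D (k0 (r n))) \<longlonglongrightarrow> l" using r(2) by (simp add: o_def)
  have l: "l \<ge> \<eta>" by (rule LIMSEQ_le_const[OF lim]) (use D in auto)
  have lim2: "(\<lambda>n. (D (k0 (r n)))\<^sup>2) \<longlonglongrightarrow> l\<^sup>2" by (intro tendsto_intros lim)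
  have "\<not> (\<lambda>n. d (k0 (r n))) \<longlonglongrightarrow> 0"
  proof
    assume "(\<lambda>n. d (k0 (r n))) \<longlonglongrightarrow> 0"
    then have "\<eta> \<le> 0" by (rule LIMSEQ_le_const) (use k0'(2) in auto)
    with \<eta> show False by simp
  qed
  moreover have "strict_mono (\<lambda>n. k0 (r n))"
    using strict_mono_o[OF k0(1) r(1)] by (simp add: o_def)
  ultimately have "\<exists>(k :: nat \<Rightarrow> nat) A. strict_mono k \<and> (\<forall>n. 1 \<le> k n) \<and> 0 < A
       \<and> (\<lambda>n. (D (k n))\<^sup>2) \<longlonglongrightarrow> A \<and> \<not> (\<lambda>n. d (k n)) \<longlonglongrightarrow> 0"
    using k0'(1) lim2 l \<eta> by (intro exI[of _ "\<lambda>n. k0 (r n)"] exI[of _ "l\<^sup>2"]) auto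
  with no show False by blast
qed

section \<open>Least squares\<close>

lemma abs_le_linfnorm: "j < dim_vec x \<Longrightarrow> \<bar>vec_index x j\<bar> \<le> linfnorm x"
  unfolding linfnorm_def by (intro Max_ge) auto

lemma linfnorm_greaterE:
  assumes "linfnorm x > r" "r \<ge> 0"
  obtains j where "j < dim_vec x" "\<bar>vec_index x j\<bar> > r"
proof -
  have "linfnorm x \<in> insert 0 ((\<lambda>i. \<bar>vec_index x i\<bar>) ` {..<dim_vec x})"
    unfolding linfnorm_def by (intro Max_in) auto
  with assms that show ?thesis by auto
qed

lemma l2norm_squared: "(l2norm x)\<^sup>2 = (\<Sum>i<dim_vec x. (vec_index x i)\<^sup>2)"
  unfolding l2norm_def by (simp add: sum_nonneg)

lemma l2norm_nonneg: "l2norm x \<ge> 0"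
  unfolding l2norm_def by (simp add: sum_nonneg)

lemma linfnorm_le_l2norm: "linfnorm x \<le> l2norm x"
proof -
  have "\<bar>vec_index x i\<bar> \<le> l2norm x" if "i < dim_vec x" for i
  proof -
    have "(vec_index x i)\<^sup>2 \<le> (\<Sum>i<dim_vec x. (vec_index x i)\<^sup>2)"
      using that by (intro member_le_sum) auto
    then show ?thesis unfolding l2norm_def by (intro real_le_rsqrt) simp
  qed
  then show ?thesis unfolding linfnorm_def using l2norm_nonneg by (subst Max_le_iff) auto
qed

lemma rss_nonneg: "rss X z \<ge> 0"
  unfolding rss_def by simp

lemma gform_parallelogram_le:
  "gform X (\<lambda>j. f j + h j) \<le> 2 * gform X f + 2 * gform X h"
proof -
  have "fitted X (\<lambda>j. f j + h j) i = fitted X f i + fitted X h i" for i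
    using fitted_linear[of X f 1 h i] by simp
  moreover have "(x + y)\<^sup>2 \<le> 2 * x\<^sup>2 + 2 * y\<^sup>2" for x y :: real
    using sum_squares_bound[of x y] by (simp add: power2_sum)
  ultimately show ?thesis
    unfolding gform_def sum_distrib_left sum.distrib[symmetric] by (intro sum_mono) simp
qed

context
  fixes X :: "real Matrix.mat" and n k :: nat
  assumes X: "X \<in> carrier_mat n k" and rank: "vec_space.rank n X = k"
begin

lemma ls_estimator_shift:
  assumes \<beta>: "\<beta> \<in> carrier_vec k" and z: "z \<in> carrier_vec n"
  shows "ls_estimator X (X *\<^sub>v \<beta> + z) = \<beta> + ls_estimator X z"
proof -
  have c: "X *\<^sub>v \<beta> \<in> carrier_vec n" "transpose_mat X *\<^sub>v z \<in> carrier_vec k"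
    "transpose_mat X \<in> carrier_mat k n" "gram X *\<^sub>v \<beta> \<in> carrier_vec k"
    using X \<beta> z gram_carrier[OF X] by auto
  have "transpose_mat X *\<^sub>v (X *\<^sub>v \<beta> + z) = gram X *\<^sub>v \<beta> + transpose_mat X *\<^sub>v z"
    using mult_add_distrib_mat_vec[OF c(3) c(1) z] assoc_mult_mat_vec[OF c(3) X \<beta>]
    by (simp add: gram_def)
  then have "ls_estimator X (X *\<^sub>v \<beta> + z) = minv (gram X) *\<^sub>v (gram X *\<^sub>v \<beta>) + ls_estimator X z"
    unfolding ls_estimator_def
    using mult_add_distrib_mat_vec[OF inv_gram(1)[OF X rank] c(4) c(2)] by simp
  then show ?thesis using gram_inv_apply(2)[OF X rank \<beta>] by simp
qed

lemma rss_shift: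
  assumes \<beta>: "\<beta> \<in> carrier_vec k" and z: "z \<in> carrier_vec n"
  shows "rss X (X *\<^sub>v \<beta> + z) = rss X z"
proof -
  have ls: "ls_estimator X z \<in> carrier_vec k" by (rule ls_estimator_carrier[OF X rank])
  have "X *\<^sub>v \<beta> + z - X *\<^sub>v (\<beta> + ls_estimator X z) = z - X *\<^sub>v ls_estimator X z"
    unfolding mult_add_distrib_mat_vec[OF X \<beta> ls]
    using X \<beta> z ls by (intro eq_vecI) (auto simp del: index_mult_mat_vec)
  then show ?thesis unfolding rss_def ls_estimator_shift[OF \<beta> z] by simp
qed

text \<open>Through this identity a single bound for the squared norm of the noise controls both the
  residual sum of squares and the Gram form of the estimation error.\<close>

lemma rss_pythagoras:
  assumes z: "z \<in> carrier_vec n"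
  shows "rss X z + gform X (vec_index (ls_estimator X z)) = (\<Sum>i<n. (vec_index z i)\<^sup>2)"
proof -
  define w where "w = ls_estimator X z"
  have w: "w \<in> carrier_vec k" unfolding w_def by (rule ls_estimator_carrier[OF X rank])
  have Xw: "X *\<^sub>v w \<in> carrier_vec n" using X w by auto
  have c: "transpose_mat X *\<^sub>v z \<in> carrier_vec k" using X z by auto
  have "scalar_prod (X *\<^sub>v w) (X *\<^sub>v w) = scalar_prod w (gram X *\<^sub>v w)"
    by (rule gram_form[OF X w w, symmetric])
  also have "gram X *\<^sub>v w = transpose_mat X *\<^sub>v z"
    unfolding w_def ls_estimator_def by (rule gram_inv_apply(1)[OF X rank c])
  also have "scalar_prod w (transpose_mat X *\<^sub>v z) = scalar_prod (X *\<^sub>v w) z"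
    using transpose_vec_mult_scalar[OF X w z] comm_scalar_prod[OF w c] comm_scalar_prod[OF Xw z] by simp
  finally have orth: "scalar_prod (X *\<^sub>v w) (X *\<^sub>v w) = scalar_prod (X *\<^sub>v w) z" .
  have "rss X z = scalar_prod (z - X *\<^sub>v w) (z - X *\<^sub>v w)"
    unfolding rss_def w_def[symmetric] l2norm_squared
    by (simp add: scalar_prod_def power2_eq_square atLeast0LessThan)
  also have "\<dots> = scalar_prod z z - scalar_prod (X *\<^sub>v w) z"
    using z Xw orth comm_scalar_prod[OF Xw z]
    by (simp add: minus_scalar_prod_distrib[of _ n] scalar_prod_minus_distrib[of _ n])
  finally have r: "rss X z = scalar_prod z z - scalar_prod (X *\<^sub>v w) (X *\<^sub>v w)" using orth by simp
  have wv: "Matrix.vec k (vec_index w) = w" using w by auto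
  have "gform X (vec_index w) = scalar_prod (X *\<^sub>v w) (X *\<^sub>v w)"
    unfolding gform_scalar_prod using X wv by simp
  moreover have "scalar_prod z z = (\<Sum>i<n. (vec_index z i)\<^sup>2)"
    using z by (simp add: scalar_prod_def power2_eq_square atLeast0LessThan)
  ultimately show ?thesis using r unfolding w_def by simp
qed

text \<open>A vector orthogonal to the column space is obtained from the square matrix that pads
  the transpose of \<open>X\<close> with zero rows.\<close>

lemma left_kernel_nontrivial:
  assumes kn: "k < n"
  obtains u where "u \<in> carrier_vec n" "u \<noteq> 0\<^sub>v n" "transpose_mat X *\<^sub>v u = 0\<^sub>v k"
proof -
  define A where "A = Matrix.mat n n (\<lambda>(i, j). if i < k then X $$ (j, i) else 0)"
  have A: "A \<in> carrier_mat n n" unfolding A_def by simp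
  \<comment> \<open>Row \<open>k\<close> of \<open>A\<close> is a padding row since
    \<open>k < n\<close>; it witnesses singularity.\<close>
  have tA: "transpose_mat A *\<^sub>v unit_vec n k = 0\<^sub>v n"
    unfolding A_def using kn by (intro eq_vecI) auto
  have tc: "transpose_mat A \<in> carrier_mat n n" using A by simp
  have "unit_vec n k \<noteq> (0\<^sub>v n :: real Matrix.vec)"
  proof
    assume "unit_vec n k = (0\<^sub>v n :: real Matrix.vec)"
    then have "vec_index (unit_vec n k :: real Matrix.vec) k = vec_index (0\<^sub>v n) k" by simp
    then show False using kn by simp
  qed
  then have "Determinant.det (transpose_mat A) = 0"
    using tA by (intro iffD2[OF det_0_iff_vec_prod_zero[OF tc]] exI[of _ "unit_vec n k"]) auto
  then have "Determinant.det A = 0" using det_transpose[OF A] by simp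
  then obtain u where u: "u \<in> carrier_vec n" "u \<noteq> 0\<^sub>v n" "A *\<^sub>v u = 0\<^sub>v n"
    using det_0_iff_vec_prod_zero[OF A] by auto
  have "transpose_mat X *\<^sub>v u = 0\<^sub>v k"
  proof (rule eq_vecI)
    fix i assume "i < dim_vec (0\<^sub>v k :: real Matrix.vec)"
    then have i: "i < k" by simp
    have "vec_index (transpose_mat X *\<^sub>v u) i = (\<Sum>j<n. X $$ (j, i) * vec_index u j)"
      using i X u(1) by (simp add: scalar_prod_def atLeast0LessThan)
    also have "\<dots> = vec_index (A *\<^sub>v u) i"
      using i kn u(1) unfolding A_def by (simp add: scalar_prod_def atLeast0LessThan)
    also have "\<dots> = 0" using u(3) i kn by simp
    finally show "vec_index (transpose_mat X *\<^sub>v u) i = vec_index (0\<^sub>v k) i" using i by simp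
  qed (use X in simp)
  with u that show ?thesis by blast
qed

text \<open>A vanishing residual puts \<open>z\<close> into the column space, hence into the
  hyperplane orthogonal to \<open>u\<close>. Gaussian noise avoids a hyperplane almost surely, which
  gives \<open>S > 0\<close> without its chi-squared law.\<close>

lemma rss_zero_orthogonal:
  assumes z: "z \<in> carrier_vec n" and u: "u \<in> carrier_vec n" "transpose_mat X *\<^sub>v u = 0\<^sub>v k"
    and r: "rss X z = 0"
  shows "(\<Sum>i<n. vec_index u i * vec_index z i) = 0"
proof -
  define w where "w = ls_estimator X z"
  have w: "w \<in> carrier_vec k" unfolding w_def by (rule ls_estimator_carrier[OF X rank])
  have Xw: "X *\<^sub>v w \<in> carrier_vec n" using X w by auto
  have d: "z - X *\<^sub>v w \<in> carrier_vec n" using z Xw by simp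
  have "scalar_prod (z - X *\<^sub>v w) (z - X *\<^sub>v w) = 0"
    using r unfolding rss_def w_def[symmetric] l2norm_squared
    by (simp add: scalar_prod_def power2_eq_square atLeast0LessThan)
  then have 0: "z - X *\<^sub>v w = 0\<^sub>v n" by (rule scalar_prod_self_eq_0[OF d])
  have "scalar_prod u z - scalar_prod u (X *\<^sub>v w) = scalar_prod u (z - X *\<^sub>v w)"
    using u(1) z Xw by (simp add: scalar_prod_minus_distrib[of _ n])
  also have "\<dots> = 0" unfolding 0 using u(1) by simp
  also have "scalar_prod u (X *\<^sub>v w) = scalar_prod (transpose_mat X *\<^sub>v u) w"
    using transpose_vec_mult_scalar[OF X w u(1)] comm_scalar_prod[OF Xw u(1)]
      comm_scalar_prod[OF w, of "transpose_mat X *\<^sub>v u"] X u by simp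
  also have "\<dots> = 0" unfolding u(2) using w by simp
  finally show ?thesis using z u(1) by (simp add: scalar_prod_def atLeast0LessThan)
qed

end

section \<open>Tail bounds for Gaussian noise\<close>

lemma normal_density_tilt:
  assumes "\<sigma> > 0"
  shows "exp (t * x) * normal_density 0 \<sigma> x = exp (t\<^sup>2 * \<sigma>\<^sup>2 / 2) * normal_density (t * \<sigma>\<^sup>2) \<sigma> x"
proof -
  have "t * x + - (x - 0)\<^sup>2 / (2 * \<sigma>\<^sup>2) = t\<^sup>2 * \<sigma>\<^sup>2 / 2 + - (x - t * \<sigma>\<^sup>2)\<^sup>2 / (2 * \<sigma>\<^sup>2)"
    using assms by (simp add: field_simps power2_eq_square)
  then have "exp (t * x) * exp (- (x - 0)\<^sup>2 / (2 * \<sigma>\<^sup>2)) = exp (t\<^sup>2 * \<sigma>\<^sup>2 / 2) * exp (- (x - t * \<sigma>\<^sup>2)\<^sup>2 / (2 * \<sigma>\<^sup>2))"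
    by (simp only: exp_add[symmetric])
  then show ?thesis unfolding normal_density_def by (simp add: mult.left_commute)
qed

lemma nn_integral_normal_density:
  "\<sigma> > 0 \<Longrightarrow> (\<integral>\<^sup>+x. ennreal (normal_density \<mu> \<sigma> x) \<partial>lborel) = 1"
  by (subst nn_integral_eq_integral) auto

lemma normal_mgf:
  assumes "\<sigma> > 0"
  shows "(\<integral>\<^sup>+x. ennreal (normal_density 0 \<sigma> x) * ennreal (exp (t * x)) \<partial>lborel) = ennreal (exp (t\<^sup>2 * \<sigma>\<^sup>2 / 2))"
proof -
  have "(\<integral>\<^sup>+x. ennreal (normal_density 0 \<sigma> x) * ennreal (exp (t * x)) \<partial>lborel)
    = (\<integral>\<^sup>+x. ennreal (exp (t\<^sup>2 * \<sigma>\<^sup>2 / 2)) * ennreal (normal_density (t * \<sigma>\<^sup>2) \<sigma> x) \<partial>lborel)"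
    using normal_density_tilt[OF assms, of t]
    by (intro nn_integral_cong) (simp add: ennreal_mult'[symmetric] mult.commute)
  also have "\<dots> = ennreal (exp (t\<^sup>2 * \<sigma>\<^sup>2 / 2))"
    by (subst nn_integral_cmult) (auto simp: nn_integral_normal_density[OF assms])
  finally show ?thesis .
qed

text \<open>The rate \<open>1 / (4 * \<sigma>\<^sup>2)\<close> is half the critical one: the tilted
  density is \<open>sqrt 2\<close> times the normal density with doubled variance.\<close>

lemma normal_square_mgf:
  assumes "\<sigma> > 0"
  shows "(\<integral>\<^sup>+x. ennreal (normal_density 0 \<sigma> x) * ennreal (exp (x\<^sup>2 / (4 * \<sigma>\<^sup>2))) \<partial>lborel) = ennreal (sqrt 2)"
proof -
  have "normal_density 0 \<sigma> x * exp (x\<^sup>2 / (4 * \<sigma>\<^sup>2)) = sqrt 2 * normal_density 0 (sqrt 2 * \<sigma>) x" for x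
  proof -
    have "- x\<^sup>2 / (2 * \<sigma>\<^sup>2) + x\<^sup>2 / (4 * \<sigma>\<^sup>2) = - x\<^sup>2 / (2 * (sqrt 2 * \<sigma>)\<^sup>2)"
      using assms by (simp add: power_mult_distrib field_simps)
    then have "exp (- x\<^sup>2 / (2 * \<sigma>\<^sup>2)) * exp (x\<^sup>2 / (4 * \<sigma>\<^sup>2)) = exp (- x\<^sup>2 / (2 * (sqrt 2 * \<sigma>)\<^sup>2))"
      by (simp only: exp_add[symmetric])
    moreover have "1 / c * E * F = sqrt 2 * (1 / (sqrt 2 * c) * G)" if "E * F = G" for c E F G :: real
      using that by simp
    moreover have "sqrt (2 * pi * (sqrt 2 * \<sigma>)\<^sup>2) = sqrt 2 * sqrt (2 * pi * \<sigma>\<^sup>2)"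
      by (simp add: real_sqrt_mult[symmetric] power_mult_distrib)
    ultimately show ?thesis unfolding normal_density_def by simp
  qed
  then have "(\<integral>\<^sup>+x. ennreal (normal_density 0 \<sigma> x) * ennreal (exp (x\<^sup>2 / (4 * \<sigma>\<^sup>2))) \<partial>lborel)
    = (\<integral>\<^sup>+x. ennreal (sqrt 2) * ennreal (normal_density 0 (sqrt 2 * \<sigma>) x) \<partial>lborel)"
    by (intro nn_integral_cong) (simp add: ennreal_mult'[symmetric])
  also have "\<dots> = ennreal (sqrt 2)"
    using assms by (subst nn_integral_cmult) (auto simp: nn_integral_normal_density)
  finally show ?thesis .
qed

lemma mvn_density_iid:
  assumes v: "v > 0"
  shows "mvn_density (0\<^sub>v n) (v \<cdot>\<^sub>m 1\<^sub>m n) (Matrix.vec n x) = (\<Prod>i<n. normal_density 0 (sqrt v) (x i))"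
proof -
  let ?x = "Matrix.vec n x"
  have "minv (1\<^sub>m n :: real Matrix.mat) = 1\<^sub>m n" by (rule minv_unique) auto
  then have m: "minv (v \<cdot>\<^sub>m 1\<^sub>m n :: real Matrix.mat) = (1 / v) \<cdot>\<^sub>m 1\<^sub>m n"
    using minv_smult[of "1\<^sub>m n" n v] v by simp
  have z: "?x - 0\<^sub>v n = ?x" by auto
  have "((1 / v) \<cdot>\<^sub>m 1\<^sub>m n) *\<^sub>v ?x = (1 / v) \<cdot>\<^sub>v ?x"
    using smult_mat_mult_vec[of "1\<^sub>m n" n n ?x "1 / v"] by simp
  then have q: "scalar_prod (?x - 0\<^sub>v n) (minv (v \<cdot>\<^sub>m 1\<^sub>m n) *\<^sub>v (?x - 0\<^sub>v n)) = (\<Sum>i<n. (x i)\<^sup>2) / v"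
    unfolding m z by (simp add: scalar_prod_def power2_eq_square atLeast0LessThan sum_divide_distrib)
  have d: "sqrt ((2 * pi) ^ n * (v ^ n)) = (\<Prod>i<n. sqrt (2 * pi * v))"
    by (simp add: real_sqrt_power real_sqrt_mult power_mult_distrib)
  have e: "exp (- ((\<Sum>i<n. (x i)\<^sup>2) / v) / 2) = (\<Prod>i<n. exp (- (x i)\<^sup>2 / (2 * v)))"
    by (simp add: exp_sum[symmetric] sum_negf sum_divide_distrib mult.commute)
  have "mvn_density (0\<^sub>v n) (v \<cdot>\<^sub>m 1\<^sub>m n) ?x
    = (\<Prod>i<n. exp (- (x i)\<^sup>2 / (2 * v))) / (\<Prod>i<n. sqrt (2 * pi * v))"
    unfolding mvn_density_def q e[symmetric] d[symmetric] by simp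
  also have "\<dots> = (\<Prod>i<n. normal_density 0 (sqrt v) (x i))"
    unfolding prod_dividef[symmetric] normal_density_def using v by simp
  finally show ?thesis .
qed

context
  fixes M :: "'w measure" and n :: nat and v :: real and e :: "'w \<Rightarrow> nat \<Rightarrow> real"
  assumes v: "v > 0"
    and noise: "distributed M (\<Pi>\<^sub>M i\<in>{..<n}. lborel) e
            (\<lambda>x. ennreal (mvn_density (0\<^sub>v n) (v \<cdot>\<^sub>m 1\<^sub>m n) (Matrix.vec n x)))"
begin

abbreviation "PN \<equiv> \<Pi>\<^sub>M i\<in>{..<n}. (lborel :: real measure)"

lemma noise_measurable: "e \<in> measurable M PN"
  by (rule distributed_measurable[OF noise])

lemma component_measurable: "i < n \<Longrightarrow> (\<lambda>x. x i) \<in> borel_measurable PN"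
  using measurable_component_singleton[of i "{..<n}" "\<lambda>_. lborel :: real measure"] by simp

lemma noise_component: "i < n \<Longrightarrow> (\<lambda>\<omega>. e \<omega> i) \<in> borel_measurable M"
  using measurable_compose[OF noise_measurable component_measurable] .

lemma noise_nn_integral:
  "g \<in> borel_measurable PN \<Longrightarrow>
    (\<integral>\<^sup>+\<omega>. g (e \<omega>) \<partial>M) = (\<integral>\<^sup>+x. ennreal (\<Prod>i<n. normal_density 0 (sqrt v) (x i)) * g x \<partial>PN)"
  using distributed_nn_integral[OF noise, of g] by (simp add: mvn_density_iid[OF v])

lemma noise_prod:
  assumes g: "\<And>i. g i \<in> borel_measurable borel"
  shows "(\<integral>\<^sup>+\<omega>. (\<Prod>i<n. g i (e \<omega> i)) \<partial>M)
    = (\<Prod>i<n. \<integral>\<^sup>+x. ennreal (normal_density 0 (sqrt v) x) * g i x \<partial>lborel)"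
proof -
  interpret product_sigma_finite "\<lambda>_::nat. lborel :: real measure" ..
  note g[measurable]
  have "(\<lambda>x. \<Prod>i<n. g i (x i)) \<in> borel_measurable PN"
    by (intro borel_measurable_prod_ennreal measurable_compose[OF component_measurable g]) auto
  then have "(\<integral>\<^sup>+\<omega>. (\<Prod>i<n. g i (e \<omega> i)) \<partial>M)
    = (\<integral>\<^sup>+x. ennreal (\<Prod>i<n. normal_density 0 (sqrt v) (x i)) * (\<Prod>i<n. g i (x i)) \<partial>PN)"
    by (rule noise_nn_integral)
  also have "\<dots> = (\<integral>\<^sup>+x. (\<Prod>i<n. ennreal (normal_density 0 (sqrt v) (x i)) * g i (x i)) \<partial>PN)"
    by (intro nn_integral_cong) (simp add: prod.distrib prod_ennreal)
  also have "\<dots> = (\<Prod>i<n. \<integral>\<^sup>+x. ennreal (normal_density 0 (sqrt v) x) * g i x \<partial>lborel)"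
    by (rule product_nn_integral_prod) auto
  finally show ?thesis .
qed

lemma noise_linear_mgf:
  "(\<integral>\<^sup>+\<omega>. ennreal (exp (\<Sum>i<n. u i * e \<omega> i)) \<partial>M) = ennreal (exp (v * (\<Sum>i<n. (u i)\<^sup>2) / 2))"
proof -
  have "(\<integral>\<^sup>+\<omega>. ennreal (exp (\<Sum>i<n. u i * e \<omega> i)) \<partial>M) = (\<integral>\<^sup>+\<omega>. (\<Prod>i<n. ennreal (exp (u i * e \<omega> i))) \<partial>M)"
    by (simp add: exp_sum prod_ennreal)
  also have "\<dots> = (\<Prod>i<n. ennreal (exp ((u i)\<^sup>2 * v / 2)))"
    using v by (subst noise_prod) (auto simp: normal_mgf)
  also have "\<dots> = ennreal (exp (v * (\<Sum>i<n. (u i)\<^sup>2) / 2))"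
    by (simp add: prod_ennreal exp_sum[symmetric] sum_distrib_left sum_divide_distrib mult.commute)
  finally show ?thesis .
qed

lemma noise_linear_tail:
  assumes V: "(\<Sum>i<n. (u i)\<^sup>2) \<le> V" "V > 0" and r: "r > 0"
  shows "emeasure M {\<omega> \<in> space M. \<bar>\<Sum>i<n. u i * e \<omega> i\<bar> \<ge> r} \<le> ennreal (2 * exp (- r\<^sup>2 / (2 * v * V)))"
proof -
  \<comment> \<open>Minimises \<open>- t * r + v * (t\<^sup>2 * V) / 2\<close>.\<close>
  define t where "t = r / (v * V)"
  have t: "t > 0" unfolding t_def using r v V by simp
  have meas: "(\<lambda>\<omega>. \<Sum>i<n. w i * e \<omega> i) \<in> borel_measurable M" for w
    using noise_component by (intro borel_measurable_sum borel_measurable_times) auto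
  have one: "emeasure M {\<omega> \<in> space M. (\<Sum>i<n. w i * e \<omega> i) \<ge> r} \<le> ennreal (exp (- r\<^sup>2 / (2 * v * V)))"
    if w: "(\<Sum>i<n. (w i)\<^sup>2) \<le> V" for w
  proof -
    have "emeasure M {\<omega> \<in> space M. (\<Sum>i<n. w i * e \<omega> i) \<ge> r}
      \<le> ennreal (exp (- t * r)) * (\<integral>\<^sup>+\<omega>\<in>space M. ennreal (exp (t * (\<Sum>i<n. w i * e \<omega> i))) \<partial>M)"
      by (rule Chernoff_ineq_nn_integral_ge[OF t]) (use meas in auto)
    also have "(\<integral>\<^sup>+\<omega>\<in>space M. ennreal (exp (t * (\<Sum>i<n. w i * e \<omega> i))) \<partial>M)
      = (\<integral>\<^sup>+\<omega>. ennreal (exp (\<Sum>i<n. (t * w i) * e \<omega> i)) \<partial>M)"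
      by (intro nn_integral_cong) (simp add: sum_distrib_left mult.assoc)
    also have "\<dots> = ennreal (exp (v * (\<Sum>i<n. (t * w i)\<^sup>2) / 2))" by (rule noise_linear_mgf)
    also have "ennreal (exp (- t * r)) * \<dots> = ennreal (exp (- t * r + v * (\<Sum>i<n. (t * w i)\<^sup>2) / 2))"
      by (simp add: ennreal_mult'[symmetric] exp_add[symmetric])
    also have "\<dots> \<le> ennreal (exp (- r\<^sup>2 / (2 * v * V)))"
    proof (intro ennreal_leI)
      have "(\<Sum>i<n. (t * w i)\<^sup>2) = t\<^sup>2 * (\<Sum>i<n. (w i)\<^sup>2)" by (simp add: power_mult_distrib sum_distrib_left)
      also have "\<dots> \<le> t\<^sup>2 * V" using w by (intro mult_left_mono) auto
      finally have "v * (\<Sum>i<n. (t * w i)\<^sup>2) / 2 \<le> v * (t\<^sup>2 * V) / 2"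
        using v by (intro divide_right_mono mult_left_mono) auto
      also have "v * (t\<^sup>2 * V) / 2 = t * r - r\<^sup>2 / (2 * v * V)"
        unfolding t_def using v V by (simp add: field_simps power2_eq_square)
      finally show "exp (- t * r + v * (\<Sum>i<n. (t * w i)\<^sup>2) / 2) \<le> exp (- r\<^sup>2 / (2 * v * V))"
        unfolding exp_le_cancel_iff minus_divide_left[symmetric] by linarith
    qed
    finally show ?thesis .
  qed
  have "emeasure M {\<omega> \<in> space M. \<bar>\<Sum>i<n. u i * e \<omega> i\<bar> \<ge> r}
    \<le> emeasure M ({\<omega> \<in> space M. (\<Sum>i<n. u i * e \<omega> i) \<ge> r} \<union> {\<omega> \<in> space M. (\<Sum>i<n. (- u i) * e \<omega> i) \<ge> r})"
    using meas[of u] meas[of "\<lambda>i. - u i"] by (intro emeasure_mono) (auto simp: sum_negf abs_le_iff)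
  also have "\<dots> \<le> emeasure M {\<omega> \<in> space M. (\<Sum>i<n. u i * e \<omega> i) \<ge> r} + emeasure M {\<omega> \<in> space M. (\<Sum>i<n. (- u i) * e \<omega> i) \<ge> r}"
    using meas[of u] meas[of "\<lambda>i. - u i"] by (intro emeasure_subadditive) auto
  also have "\<dots> \<le> ennreal (exp (- r\<^sup>2 / (2 * v * V))) + ennreal (exp (- r\<^sup>2 / (2 * v * V)))"
    using V by (intro add_mono one) auto
  also have "\<dots> = ennreal (2 * exp (- r\<^sup>2 / (2 * v * V)))"
    by (simp add: ennreal_plus[symmetric] del: ennreal_plus)
  finally show ?thesis .
qed

text \<open>At the tilt \<open>1 / (4 * v)\<close> the threshold contributes
  \<open>exp (- n)\<close> and each coordinate a factor \<open>sqrt 2\<close>.\<close>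

lemma noise_norm_tail:
  "emeasure M {\<omega> \<in> space M. (\<Sum>i<n. (e \<omega> i)\<^sup>2) \<ge> 4 * v * real n} \<le> ennreal ((sqrt 2 / exp 1) ^ n)"
proof -
  have meas: "(\<lambda>\<omega>. \<Sum>i<n. (e \<omega> i)\<^sup>2) \<in> borel_measurable M"
    using noise_component by (intro borel_measurable_sum borel_measurable_power) auto
  have "emeasure M {\<omega> \<in> space M. (\<Sum>i<n. (e \<omega> i)\<^sup>2) \<ge> 4 * v * real n}
    \<le> ennreal (exp (- (1 / (4 * v)) * (4 * v * real n)))
       * (\<integral>\<^sup>+\<omega>\<in>space M. ennreal (exp (1 / (4 * v) * (\<Sum>i<n. (e \<omega> i)\<^sup>2))) \<partial>M)"
    by (rule Chernoff_ineq_nn_integral_ge) (use v meas in auto)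
  also have "(\<integral>\<^sup>+\<omega>\<in>space M. ennreal (exp (1 / (4 * v) * (\<Sum>i<n. (e \<omega> i)\<^sup>2))) \<partial>M)
    = (\<integral>\<^sup>+\<omega>. (\<Prod>i<n. ennreal (exp ((e \<omega> i)\<^sup>2 / (4 * v)))) \<partial>M)"
    by (intro nn_integral_cong) (simp add: prod_ennreal exp_sum[symmetric] sum_divide_distrib)
  also have "\<dots> = (\<Prod>i<n. ennreal (sqrt 2))"
    using v normal_square_mgf[of "sqrt v"] by (subst noise_prod) auto
  also have "exp (- (1 / (4 * v)) * (4 * v * real n)) = (1 / exp 1) ^ n"
    using v by (simp add: exp_minus power_one_over exp_of_nat_mult[symmetric] inverse_eq_divide)
  also have "ennreal ((1 / exp 1) ^ n) * (\<Prod>i<n. ennreal (sqrt 2)) = ennreal ((sqrt 2 / exp 1) ^ n)"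
    by (simp add: ennreal_power ennreal_mult'[symmetric] power_divide power_one_over)
  finally show ?thesis .
qed

text \<open>By Fubini with coordinate \<open>i0\<close> innermost: for fixed other coordinates the
  hyperplane meets that axis in at most one point.\<close>

lemma noise_hyperplane_null:
  assumes i0: "i0 < n" "u i0 \<noteq> 0"
  shows "AE \<omega> in M. (\<Sum>i<n. u i * e \<omega> i) \<noteq> 0"
proof -
  interpret product_sigma_finite "\<lambda>_::nat. lborel :: real measure" ..
  let ?H = "{x \<in> space PN. (\<Sum>i<n. u i * x i) = 0}"
  have [measurable]: "(\<lambda>x. \<Sum>i<n. u i * x i) \<in> borel_measurable PN"
    using component_measurable by (intro borel_measurable_sum borel_measurable_times) auto
  have H[measurable]: "?H \<in> sets PN" by measurable
  define J where "J = {..<n} - {i0}"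
  have J: "finite J" "i0 \<notin> J" "insert i0 J = {..<n}" unfolding J_def using i0 by auto
  have "emeasure PN ?H = (\<integral>\<^sup>+x. indicator ?H x \<partial>PN)" using H by simp
  also have "\<dots> = (\<integral>\<^sup>+x. (\<integral>\<^sup>+y. indicator ?H (x(i0 := y)) \<partial>lborel) \<partial>PiM J (\<lambda>_. lborel :: real measure))"
    using product_nn_integral_insert[OF J(1,2), of "indicator ?H"] H unfolding J(3) by simp
  also have "\<dots> = (\<integral>\<^sup>+x. 0 \<partial>PiM J (\<lambda>_. lborel :: real measure))"
  proof (intro nn_integral_cong)
    fix x :: "nat \<Rightarrow> real"
    let ?c = "\<Sum>i\<in>J. u i * x i"
    have "(\<integral>\<^sup>+y. indicator ?H (x(i0 := y)) \<partial>lborel) \<le> (\<integral>\<^sup>+y. indicator {- ?c / u i0} y \<partial>lborel)"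
    proof (intro nn_integral_mono)
      fix y :: real
      have "(\<Sum>i<n. u i * (x(i0 := y)) i) = u i0 * y + ?c"
      proof -
        have "(\<Sum>i\<in>J. u i * (x(i0 := y)) i) = ?c" using J by (intro sum.cong) auto
        then show ?thesis unfolding J(3)[symmetric] using J(1,2) by simp
      qed
      then show "indicator ?H (x(i0 := y)) \<le> (indicator {- ?c / u i0} y :: ennreal)"
        using i0 by (auto simp: indicator_def field_simps add_eq_0_iff)
    qed
    also have "\<dots> = 0" by simp
    finally show "(\<integral>\<^sup>+y. indicator ?H (x(i0 := y)) \<partial>lborel) = 0" by simp
  qed
  also have "\<dots> = 0" by simp
  finally have "?H \<in> null_sets PN" using H by auto
  then have "AE x in PN. x \<notin> ?H" by (rule AE_not_in)
  then have "(\<integral>\<^sup>+x\<in>?H. ennreal (mvn_density (0\<^sub>v n) (v \<cdot>\<^sub>m 1\<^sub>m n) (Matrix.vec n x)) \<partial>PN)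
    = (\<integral>\<^sup>+x. 0 \<partial>PN)"
    by (intro nn_integral_cong_AE, eventually_elim) simp
  then have "emeasure M (e -` ?H \<inter> space M) = 0"
    using distributed_emeasure[OF noise H] by simp
  moreover have "e -` ?H \<inter> space M \<in> sets M" by (rule measurable_sets[OF noise_measurable H])
  ultimately have "e -` ?H \<inter> space M \<in> null_sets M" by auto
  then show ?thesis
    by (rule AE_I') (use measurable_space[OF noise_measurable] in auto)
qed

end

section \<open>Posterior consistency\<close>

text \<open>All randomness is confined to four eventual conditions on the data, so the posterior
  analysis can be done along one fixed data sequence.\<close>

lemma posterior_consistency_deterministic:
  fixes p :: "nat \<Rightarrow> nat" and X :: "nat \<Rightarrow> real Matrix.mat" and \<beta>0 \<gamma> bh :: "nat \<Rightarrow> real Matrix.vec"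
    and s :: "nat \<Rightarrow> real" and \<alpha> a b C L \<epsilon> :: real
  assumes p_less: "\<And>n. 1 \<le> n \<Longrightarrow> p n < n"
    and p_ratio: "(\<lambda>n. real (p n) / real n) \<longlonglongrightarrow> \<alpha>" and alpha: "\<alpha> < 1"
    and X: "\<And>n. 1 \<le> n \<Longrightarrow> X n \<in> carrier_mat n (p n)"
    and rank: "\<And>n. 1 \<le> n \<Longrightarrow> vec_space.rank n (X n) = p n"
    and L: "L > 0" and ev: "\<And>n l. 1 \<le> n \<Longrightarrow> eigenvalue (real n \<cdot>\<^sub>m minv (gram (X n))) l \<Longrightarrow> l \<le> L"
    and \<beta>0: "\<And>n. 1 \<le> n \<Longrightarrow> \<beta>0 n \<in> carrier_vec (p n)"
    and \<gamma>: "\<And>n. 1 \<le> n \<Longrightarrow> \<gamma> n \<in> carrier_vec (p n)"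
    and bh: "\<And>n. 1 \<le> n \<Longrightarrow> bh n \<in> carrier_vec (p n)"
    and a: "a \<ge> -2" and b: "b \<ge> 0" and C: "C > 0" and \<epsilon>: "\<epsilon> > 0"
    and s_pos: "\<forall>\<^sub>F n in sequentially. s n > 0"
    and s_le: "\<forall>\<^sub>F n in sequentially. s n \<le> C * real n"
    and q_le: "\<forall>\<^sub>F n in sequentially. gform (X n) (\<lambda>j. vec_index (bh n) j - vec_index (\<beta>0 n) j) \<le> C * real n"
    and bh_close: "\<forall>\<^sub>F n in sequentially. \<forall>j<p n. \<bar>vec_index (bh n) j - vec_index (\<beta>0 n) j\<bar> \<le> \<epsilon> / 4"
    and dichotomy: "\<alpha> = 0 \<or> (\<forall>\<eta>>0. \<forall>D. \<forall>\<^sub>F n in sequentially.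
           linfnorm (\<gamma> n - \<beta>0 n) < \<eta> \<or> l2norm (\<gamma> n - \<beta>0 n) > D)"
  shows "(\<lambda>n. posterior_prob a b (X n) (\<gamma> n) (bh n) (s n) {\<beta>. linfnorm (\<beta> - \<beta>0 n) > \<epsilon>}) \<longlonglongrightarrow> 0"
proof -
  define r where "r = \<epsilon> / 2"
  \<comment> \<open>Half of \<open>1 - \<alpha>\<close>; the other half absorbs the deviation of
    \<open>p n / n\<close> from \<alpha> and the possibly negative \<open>a\<close>.\<close>
  define \<theta> where "\<theta> = (1 - \<alpha>) / 2"
  define c where "c = min (\<theta> / 2 * ln (3 / 2)) (1 / 4)"
  define Q where "Q = 4 / c"
  define s1 where "s1 = C + b"
  \<comment> \<open>The first entry lets a distance of at least \<open>D0\<close> dominate the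
    estimation error in the lower bound for \<open>T\<close>; the second then makes the bias at most
    \<open>\<epsilon> / 4\<close> off the bad set.\<close>
  define D0 where "D0 = max (2 * sqrt (L * C)) (16 * L * Q * s1 / \<epsilon>)"
  \<comment> \<open>For \<open>g > w\<close> the quotient \<open>D0 / (1 + g)\<close> is at most
    \<open>\<epsilon> / 4\<close>.\<close>
  define w where "w = 4 * D0 / \<epsilon>"
  define c' where "c' = min (c / 2) (1 / (8 * w))"
  \<comment> \<open>Off the bad set the scale is at most \<open>(1 + Q) * s1 * n\<close>; \<eta> is
    the ratio of the Chernoff increment \<open>r\<^sup>2 * n / L\<close> to this bound.\<close>
  define \<eta> where "\<eta> = r\<^sup>2 / (L * s1 * (1 + Q))"
  define G where "G = (\<lambda>n. 2 powr (- 1 / 2) * exp (c' * real n))"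
  define \<kappa> where "\<kappa> = (\<lambda>n. 2 * real n * (1 + \<eta>) powr (- (real n + a) / 2))"
  have r: "r > 0" and \<theta>: "\<theta> > 0" unfolding r_def \<theta>_def using \<epsilon> alpha by auto
  have c: "c > 0" unfolding c_def using \<theta> by simp
  have c_le: "c \<le> \<theta> / 2 * ln (3 / 2)" "c \<le> 1 / 4" unfolding c_def by simp_all
  have Qc: "Q * c \<ge> 4" unfolding Q_def using c by simp
  have Q: "Q > 0" and s1: "s1 > 0" unfolding Q_def s1_def using c C b by auto
  have D0: "D0 > 0" unfolding D0_def using L C by (intro less_max_iff_disj[THEN iffD2] disjI1) simp
  have w: "w > 0" unfolding w_def using D0 \<epsilon> by simp
  have c': "c' > 0" unfolding c'_def using c w by simp
  have \<eta>: "\<eta> > 0" unfolding \<eta>_def using r L s1 Q by (intro divide_pos_pos mult_pos_pos) auto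
  have D1: "D\<^sup>2 \<ge> 4 * L * C" "D * \<epsilon> \<ge> 16 * L * Q * s1" if "D \<ge> D0" for D
  proof -
    have "2 * sqrt (L * C) \<le> D" using that unfolding D0_def by simp
    then have "(2 * sqrt (L * C))\<^sup>2 \<le> D\<^sup>2" using L C by (intro power_mono) auto
    then show "D\<^sup>2 \<ge> 4 * L * C" using L C by (simp add: power_mult_distrib)
    have "16 * L * Q * s1 / \<epsilon> \<le> D" using that unfolding D0_def by simp
    then show "D * \<epsilon> \<ge> 16 * L * Q * s1" using \<epsilon> by (simp add: pos_divide_le_eq)
  qed
  let ?post = "\<lambda>n. posterior_prob a b (X n) (\<gamma> n) (bh n) (s n) {\<beta>. linfnorm (\<beta> - \<beta>0 n) > \<epsilon>}"
  have e1: "\<forall>\<^sub>F n in sequentially. real (p n) / real n < \<alpha> + \<theta> / 2"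
    by (rule order_tendstoD(2)[OF p_ratio]) (use \<theta> in simp)
  have e2: "\<forall>\<^sub>F n in sequentially. real n \<ge> \<bar>a\<bar> + 4 / \<theta> + 1"
    by real_asymp
  \<comment> \<open>With this bound the loss \<open>p n * ln 2 / 2\<close> uses up at most half of
    the gain \<open>n / (4 * w)\<close>.\<close>
  have e3: "\<forall>\<^sub>F n in sequentially. \<alpha> = 0 \<longrightarrow> real (p n) / real n < 1 / (4 * w * ln 2)"
  proof (cases "\<alpha> = 0")
    case True
    then have "\<forall>\<^sub>F n in sequentially. real (p n) / real n < 1 / (4 * w * ln 2)"
      using p_ratio w by (intro order_tendstoD(2)[OF p_ratio]) auto
    then show ?thesis by eventually_elim simp
  qed simp
  have e4: "\<forall>\<^sub>F n in sequentially. \<alpha> = 0 \<or> linfnorm (\<gamma> n - \<beta>0 n) < \<epsilon> / 4 \<or> l2norm (\<gamma> n - \<beta>0 n) > D0"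
  proof (cases "\<alpha> = 0")
    case False
    moreover have "\<epsilon> / 4 > 0" using \<epsilon> by simp
    ultimately have "\<forall>\<^sub>F n in sequentially. linfnorm (\<gamma> n - \<beta>0 n) < \<epsilon> / 4 \<or> l2norm (\<gamma> n - \<beta>0 n) > D0"
      using dichotomy by blast
    then show ?thesis by eventually_elim simp
  qed simp
  have main: "\<forall>\<^sub>F n in sequentially. 0 \<le> ?post n \<and> ?post n \<le> 1 / G n + \<kappa> n"
    using e1 e2 e3 e4 s_pos s_le q_le bh_close
  proof eventually_elim
    case (elim n)
    have "4 / \<theta> > 0" using \<theta> by simp
    then have n': "1 \<le> real n" "\<bar>a\<bar> \<le> real n" "real n + a > 0" "4 / \<theta> \<le> real n"
      using elim(2) by linarith+
    then have n: "1 \<le> n" "\<bar>a\<bar> \<le> real n" "real n > 0" "real n + a > 0" "4 \<le> \<theta> * real n"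
      using \<theta> by (simp_all add: pos_divide_le_eq mult.commute)
    define T where "T = discrepancy (X n) (\<gamma> n) (bh n)"
    define S where "S = s n + b"
    let ?d = "\<lambda>j. vec_index (\<gamma> n) j - vec_index (\<beta>0 n) j"
    let ?linf = "linfnorm (\<gamma> n - \<beta>0 n)" and ?l2 = "l2norm (\<gamma> n - \<beta>0 n)"
    have sc: "data_scale (X n) b (s n) (\<gamma> n) (bh n) g = S + T / (1 + g)" for g
      unfolding data_scale_def S_def T_def ..
    have T: "T \<ge> 0" unfolding T_def discrepancy_def by (rule gform_nonneg)
    have S: "S > 0" unfolding S_def using elim(5) b by simp
    have Sle: "S \<le> s1 * real n"
      using elim(6) mult_left_mono[of 1 "real n" b] n b unfolding S_def s1_def by (simp add: algebra_simps)
    \<comment> \<open>For \<alpha> = 0 the distance of \<open>\<gamma> n\<close> from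
      \<open>\<beta>0 n\<close> may stay bounded without being small in maximum norm. The bias is
      then small only for \<open>g > w\<close>, so \<open>{..w}\<close> is discarded as
      well.\<close>
    define bad where "bad = {g. Q * S \<le> T / (1 + g)} \<union> (if \<alpha> = 0 then {..w} else {})"
    have bad[measurable]: "bad \<in> sets borel" unfolding bad_def by measurable
    have \<theta>n: "\<theta> * real n \<le> real n + a - real (p n)"
    proof -
      have "real (p n) \<le> (\<alpha> + \<theta> / 2) * real n" using elim(1) n by (simp add: pos_divide_less_eq)
      moreover have "-2 \<ge> - \<theta> / 2 * real n" using n by simp
      ultimately have "real n + a - real (p n) \<ge> real n - \<theta> / 2 * real n - (\<alpha> + \<theta> / 2) * real n" using a by linarith
      also have "real n - \<theta> / 2 * real n - (\<alpha> + \<theta> / 2) * real n = \<theta> * real n"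
        unfolding \<theta>_def by (simp add: field_simps)
      finally show ?thesis .
    qed
    have diag: "dual (X n) j j \<le> L / real n" if "j < p n" for j
      using dual_diag_le[OF X[OF n(1)] rank[OF n(1)] _ ev[OF n(1)] that] n by simp
    have sq_le: "(\<Sum>j<p n. (f j)\<^sup>2) \<le> L / real n * gform (X n) f" for f
      using sum_squares_le_gform[OF X[OF n(1)] rank[OF n(1)] _ ev[OF n(1)]] n by simp
    have l2: "?l2\<^sup>2 = (\<Sum>j<p n. (?d j)\<^sup>2)"
      unfolding l2norm_squared using \<gamma>[OF n(1)] \<beta>0[OF n(1)] by simp
    \<comment> \<open>\<open>\<gamma> n - \<beta>0 n\<close> splits at the estimator. The Gram form
      of the estimation error is at most \<open>C * n\<close>, and for \<open>?l2 \<ge> D0\<close>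
      its contribution is absorbed into half of the left side.\<close>
    have Tge: "real n * ?l2\<^sup>2 \<le> 4 * L * T" if "?l2 \<ge> D0"
    proof -
      have "gform (X n) ?d = gform (X n) (\<lambda>j. (vec_index (bh n) j - vec_index (\<beta>0 n) j) + (vec_index (\<gamma> n) j - vec_index (bh n) j))"
        by simp
      also have "\<dots> \<le> 2 * gform (X n) (\<lambda>j. vec_index (bh n) j - vec_index (\<beta>0 n) j)
          + 2 * gform (X n) (\<lambda>j. vec_index (\<gamma> n) j - vec_index (bh n) j)"
        by (rule gform_parallelogram_le)
      also have "gform (X n) (\<lambda>j. vec_index (\<gamma> n) j - vec_index (bh n) j) = T"
        unfolding T_def discrepancy_def gform_def fitted_diff by (simp add: power2_commute)
      finally have "gform (X n) ?d \<le> 2 * (C * real n) + 2 * T" using elim(7) by simp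
      then have "L / real n * gform (X n) ?d \<le> L / real n * (2 * (C * real n) + 2 * T)"
        using L by (intro mult_left_mono) auto
      with sq_le[of ?d] have "?l2\<^sup>2 \<le> L / real n * (2 * (C * real n) + 2 * T)" unfolding l2 by (rule order_trans)
      then have "real n * ?l2\<^sup>2 \<le> 2 * L * C * real n + 2 * L * T" using n by (simp add: field_simps)
      moreover have "4 * L * C * real n \<le> ?l2\<^sup>2 * real n" using D1(1)[OF that] by (intro mult_right_mono) auto
      ultimately show ?thesis by (simp add: algebra_simps)
    qed
    have bias: "\<bar>?d j\<bar> / (1 + g) \<le> \<epsilon> / 4" if g: "g > 0" "g \<notin> bad" and j: "j < p n" for g j
    proof -
      have dj: "\<bar>?d j\<bar> \<le> ?linf"
        using abs_le_linfnorm[of j "\<gamma> n - \<beta>0 n"] j \<gamma>[OF n(1)] \<beta>0[OF n(1)] by simp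
      have dj2: "\<bar>?d j\<bar> \<le> ?l2" using dj linfnorm_le_l2norm order_trans by blast
      consider "?linf < \<epsilon> / 4" | "?l2 \<ge> D0" | "\<alpha> = 0" "?l2 < D0" using elim(4) by linarith
      then show ?thesis
      proof cases
        case 1
        have "\<bar>?d j\<bar> / (1 + g) \<le> \<bar>?d j\<bar>" using g by (simp add: divide_le_eq mult_left_le algebra_simps)
        with dj 1 show ?thesis by linarith
      next
        case 2
        \<comment> \<open>\<open>T\<close> is of order at least \<open>n * ?l2\<^sup>2\<close>,
          while \<open>g \<notin> bad\<close> gives \<open>T < Q * S * (1 + g)\<close>. So
          \<open>1 + g\<close> grows like \<open>?l2\<^sup>2\<close>, faster than the bias
          numerator.\<close>
        have l2pos: "?l2 > 0" using 2 D0 by linarith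
        have "T < Q * S * (1 + g)" using g unfolding bad_def by (auto simp: pos_divide_le_eq not_le field_simps)
        also have "\<dots> \<le> Q * (s1 * real n) * (1 + g)" using Sle Q g by (intro mult_right_mono mult_left_mono) auto
        finally have "4 * L * T \<le> 4 * L * (Q * (s1 * real n) * (1 + g))" using L by (intro mult_left_mono) auto
        with Tge[OF 2] have "real n * ?l2\<^sup>2 \<le> real n * (4 * L * Q * s1 * (1 + g))" by (simp add: mult_ac)
        then have "?l2\<^sup>2 \<le> 4 * L * Q * s1 * (1 + g)" using n by simp
        also have "\<dots> \<le> ?l2 * (\<epsilon> / 4) * (1 + g)"
          using D1(2)[OF 2] g by (intro mult_right_mono) auto
        finally have "?l2 * ?l2 \<le> ?l2 * (\<epsilon> / 4 * (1 + g))" by (simp add: power2_eq_square mult.assoc)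
        then have "?l2 \<le> \<epsilon> / 4 * (1 + g)" using l2pos by simp
        with dj2 g show ?thesis by (simp add: pos_divide_le_eq)
      next
        case 3
        have "g > w" using g 3 unfolding bad_def by auto
        then have "D0 \<le> \<epsilon> / 4 * (1 + g)" using \<epsilon> unfolding w_def by (simp add: field_simps)
        with dj2 3 g show ?thesis by (simp add: pos_divide_le_eq)
      qed
    qed
    have Gpos: "G n > 0" unfolding G_def by simp
    have \<kappa>nn: "\<kappa> n \<ge> 0" unfolding \<kappa>_def using \<eta> by simp
    have rn: "L / real n > 0" using L n by simp
    have bad_le: "G n * g_density n (p n) a (S + T / (1 + g)) g
       \<le> 2 * g_density n (p n) a (S + T / (1 + 2 * g)) (2 * g)" if g: "g > 0" "g \<in> bad" for g
    proof -
      have G_le: "G n * g_density n (p n) a U g \<le> 2 powr (- 1 / 2) * exp (e * real n) * g_density n (p n) a U g"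
        if "c' \<le> e" for e U
        unfolding G_def using that g_density_nonneg by (intro mult_right_mono mult_left_mono) (auto intro: mult_right_mono)
      consider "Q * S \<le> T / (1 + g)" | "\<alpha> = 0" "g \<le> w" using g unfolding bad_def by (auto split: if_splits)
      then show ?thesis
      proof cases
        case 1
        have "c' \<le> c / 2" unfolding c'_def by simp
        moreover have "2 powr (- 1 / 2) * exp (c / 2 * real n) * g_density n (p n) a (S + T / (1 + g)) g
          \<le> 2 * g_density n (p n) a (S + T / (1 + 2 * g)) (2 * g)"
          by (rule gain_large_discrepancy[OF g(1) S T Q 1 less_imp_le[OF \<theta>] \<theta>n n(2) c c_le Qc])
        ultimately show ?thesis using G_le order_trans by blast
      next
        case 2
        have "c' \<le> 1 / (8 * w)" unfolding c'_def by simp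
        moreover have "2 powr (- 1 / 2) * exp (1 / (8 * w) * real n) * g_density n (p n) a (S + T / (1 + g)) g
          \<le> 2 * g_density n (p n) a (S + T / (1 + 2 * g)) (2 * g)"
        proof (rule gain_small_g[OF g(1) S T 2(2)])
          show "real n + a \<ge> 0" using n by simp
          have "real (p n) / real n < 1 / (4 * w * ln 2)" using elim(3) 2 by simp
          then have "real (p n) * (4 * w * ln 2) \<le> real n" using n w by (simp add: field_simps)
          then have "real (p n) * ln 2 / 2 \<le> real n / (8 * w)" using w by (simp add: field_simps)
          then show "real (p n) * ln 2 / 2 + 1 / (8 * w) * real n \<le> real n / (4 * w)" using w by (simp add: field_simps)
        qed
        ultimately show ?thesis using G_le order_trans by blast
      qed
    qed
    have good: "\<exists>j<p n. \<bar>f j - post_mean (\<gamma> n) (bh n) g j\<bar> > r"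
      if g: "g > 0" "g \<notin> bad" and f: "Matrix.vec (p n) f \<in> {\<beta>. linfnorm (\<beta> - \<beta>0 n) > \<epsilon>}" for g f
    proof -
      have "linfnorm (Matrix.vec (p n) f - \<beta>0 n) > \<epsilon>" using f by simp
      then obtain j where "j < dim_vec (Matrix.vec (p n) f - \<beta>0 n)"
        "\<bar>vec_index (Matrix.vec (p n) f - \<beta>0 n) j\<bar> > \<epsilon>" using \<epsilon> by (auto elim: linfnorm_greaterE)
      then have j: "j < p n" "\<bar>f j - vec_index (\<beta>0 n) j\<bar> > \<epsilon>" using \<beta>0[OF n(1)] by auto
      let ?b = "vec_index (bh n) j - vec_index (\<beta>0 n) j"
      \<comment> \<open>A convex combination of estimation error and prior bias, each at most
        \<open>\<epsilon> / 4\<close>. The posterior mean is thus within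
        \<open>\<epsilon> / 2\<close> of the truth, which leaves \<open>r = \<epsilon> / 2\<close>
        for the Gaussian tail.\<close>
      have "post_mean (\<gamma> n) (bh n) g j - vec_index (\<beta>0 n) j = g / (1 + g) * ?b + ?d j / (1 + g)"
      proof -
        have 1: "g / (1 + g) * (x - y) + (t - y) / (1 + g) = (g * (x - y) + (t - y)) / (1 + g)" for x y t
          by (simp add: add_divide_distrib)
        have 2: "(g * x + t) / (1 + g) - y = ((g * x + t) - (1 + g) * y) / (1 + g)" for x y t
          using g by (simp add: diff_divide_distrib)
        have 3: "(g * x + t) - (1 + g) * y = g * (x - y) + (t - y)" for x y t
          by (simp add: algebra_simps)
        show ?thesis unfolding post_mean_def 1 2 3 ..
      qed
      moreover have "\<bar>g / (1 + g) * ?b\<bar> \<le> \<bar>?b\<bar>"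
        unfolding abs_mult using g by (intro mult_left_le_one_le) auto
      moreover have "\<bar>?d j / (1 + g)\<bar> \<le> \<epsilon> / 4" using bias[OF g j(1)] g by simp
      moreover have "\<bar>?b\<bar> \<le> \<epsilon> / 4" using elim(8) j by simp
      moreover have "\<bar>x\<bar> \<le> \<epsilon> / 2" if "x = y + t" "\<bar>y\<bar> \<le> q" "\<bar>t\<bar> \<le> \<epsilon> / 4" "q \<le> \<epsilon> / 4" for x y t q
        using that by linarith
      ultimately have "\<bar>post_mean (\<gamma> n) (bh n) g j - vec_index (\<beta>0 n) j\<bar> \<le> \<epsilon> / 2" by blast
      with j(2) have "\<bar>f j - post_mean (\<gamma> n) (bh n) g j\<bar> > r" unfolding r_def by linarith
      with j(1) show ?thesis by blast
    qed
    have good_le: "2 * real (p n) * g_density n (p n) a (S + T / (1 + g) + r\<^sup>2 / (L / real n)) g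
        \<le> \<kappa> n * g_density n (p n) a (S + T / (1 + g)) g" if g: "g > 0" "g \<notin> bad" for g
    proof -
      let ?U = "S + T / (1 + g)"
      have U: "?U > 0" using S T g by (intro add_pos_nonneg) auto
      have "T / (1 + g) < Q * S" using g unfolding bad_def by auto
      then have "?U \<le> (1 + Q) * S" by (simp add: algebra_simps)
      also have "\<dots> \<le> (1 + Q) * (s1 * real n)" using Sle Q by (intro mult_left_mono) auto
      finally have "\<eta> * ?U \<le> \<eta> * ((1 + Q) * (s1 * real n))" using \<eta> by (intro mult_left_mono) auto
      also have "\<dots> = r\<^sup>2 / (L / real n)"
      proof -
        have "r\<^sup>2 / (L * s1 * q) * (q * (s1 * real n)) = r\<^sup>2 / (L / real n)" if "q > 0" for q
          using L s1 n that by (simp add: field_simps)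
        then show ?thesis unfolding \<eta>_def using Q by simp
      qed
      finally have D: "\<eta> * ?U \<le> r\<^sup>2 / (L / real n)" .
      have "2 * real (p n) * g_density n (p n) a (?U + r\<^sup>2 / (L / real n)) g
        \<le> 2 * real n * ((1 + \<eta>) powr (- (real n + a) / 2) * g_density n (p n) a ?U g)"
        using p_less[OF n(1)] g_density_shift[OF U D \<eta>] n g_density_nonneg
        by (intro mult_mono) auto
      then show ?thesis unfolding \<kappa>_def by (simp only: mult.assoc)
    qed
    note post = posterior_prob_le[OF X[OF n(1)] rank[OF n(1)] p_less[OF n(1)] elim(5) \<gamma>[OF n(1)] bh[OF n(1)] n(4) b
        rn sq_le r diag bad Gpos \<kappa>nn, unfolded sc, OF _ bad_le good good_le]
    show ?case by (intro conjI post) auto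
  qed
  have lim: "(\<lambda>n. 1 / G n + \<kappa> n) \<longlonglongrightarrow> 0"
  proof -
    define l where "l = ln (1 + \<eta>)"
    have l: "l > 0" unfolding l_def using \<eta> by simp
    have \<kappa>_eq: "\<kappa> n = 2 * exp (- a / 2 * l) * (real n * exp (- (l / 2) * real n))" for n
    proof -
      have "(1 + \<eta>) powr (- (real n + a) / 2) = exp (- a / 2 * l + - (l / 2) * real n)"
        unfolding l_def using \<eta> by (simp add: powr_def field_simps)
      then show ?thesis unfolding \<kappa>_def by (simp only: exp_add mult_ac)
    qed
    have "(\<lambda>n. \<kappa> n) \<longlonglongrightarrow> 0" unfolding \<kappa>_eq
    proof (rule tendsto_mult_right_zero)
      have "l / 2 > 0" using l by simp
      then show "(\<lambda>n. real n * exp (- (l / 2) * real n)) \<longlonglongrightarrow> 0" by real_asymp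
    qed
    moreover have "(\<lambda>n. 1 / (q * exp (c' * real n))) \<longlonglongrightarrow> 0" if "q > 0" for q
      using that c' by real_asymp
    from this[of "2 powr (- 1 / 2)"] have "(\<lambda>n. 1 / G n) \<longlonglongrightarrow> 0" unfolding G_def by simp
    ultimately show ?thesis by (intro tendsto_add_zero)
  qed
  show ?thesis
    by (rule tendsto_sandwich[OF _ _ tendsto_const lim]) (use main in \<open>auto elim: eventually_mono\<close>)
qed

lemma borel_cantelli_eventually:
  assumes A: "\<And>n. 1 \<le> n \<Longrightarrow> A n \<in> sets M"
    and le: "\<And>n. 1 \<le> n \<Longrightarrow> emeasure M (A n) \<le> ennreal (f n)"
    and f: "\<And>n. f n \<ge> 0" "summable f"
  shows "AE \<omega> in M. \<forall>\<^sub>F n in sequentially. \<omega> \<notin> A n"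
proof -
  \<comment> \<open>The bounds start at index 1, so the event with index 0 is replaced by the empty
    set.\<close>
  define B where "B = (\<lambda>n. if n = 0 then {} else A n)"
  have B: "B n \<in> sets M" "emeasure M (B n) \<le> ennreal (f n)" for n
    unfolding B_def using A[of n] le[of n] f by auto
  have fin: "emeasure M (B n) < \<infinity>" for n using B(2)[of n] by (auto intro: le_less_trans)
  have "measure M (B n) \<le> f n" for n
    unfolding measure_def using B(2)[of n] f by (intro enn2real_leI) auto
  then have "summable (\<lambda>n. measure M (B n))"
    by (intro summable_comparison_test'[OF f(2), of 0]) auto
  from borel_cantelli_AE1[OF B(1) fin this]
  show ?thesis
  proof eventually_elim
    case (elim \<omega>)
    from elim eventually_ge_at_top[of 1] show ?case
      by eventually_elim (auto simp: B_def)
  qed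
qed

theorem theorem4:
  fixes p :: "nat \<Rightarrow> nat"
    and X :: "nat \<Rightarrow> real Matrix.mat"
    and \<beta>0 \<gamma> :: "nat \<Rightarrow> real Matrix.vec"
    and \<alpha> lmin lmax a b \<sigma>0sq :: real
    and M :: "'w measure"
    and e :: "nat \<Rightarrow> 'w \<Rightarrow> nat \<Rightarrow> real"
    and Y bh :: "nat \<Rightarrow> 'w \<Rightarrow> real Matrix.vec"
    and S :: "nat \<Rightarrow> 'w \<Rightarrow> real"
  assumes p_mono: "\<And>m n. 1 \<le> m \<Longrightarrow> m \<le> n \<Longrightarrow> p m \<le> p n"
    and p_less: "\<And>n. 1 \<le> n \<Longrightarrow> p n < n"
    and p_ratio: "(\<lambda>n. real (p n) / real n) \<longlonglongrightarrow> \<alpha>"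
    and alpha: "0 \<le> \<alpha>" "\<alpha> < 1"
    and X_carrier: "\<And>n. 1 \<le> n \<Longrightarrow> X n \<in> carrier_mat n (p n)"
    and X_rank: "\<And>n. 1 \<le> n \<Longrightarrow> vec_space.rank n (X n) = p n"
    and lmin_pos: "0 < lmin"
    and eigenvalues: "\<And>n l. 1 \<le> n \<Longrightarrow> eigenvalue (real n \<cdot>\<^sub>m minv (gram (X n))) l
          \<Longrightarrow> lmin \<le> l \<and> l \<le> lmax"
    and beta0_carrier: "\<And>n. 1 \<le> n \<Longrightarrow> \<beta>0 n \<in> carrier_vec (p n)"
    and gamma_carrier: "\<And>n. 1 \<le> n \<Longrightarrow> \<gamma> n \<in> carrier_vec (p n)"
    and hyperparameters: "a \<ge> -2" "b \<ge> 0"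
    and sigma0: "\<sigma>0sq > 0"
    and M: "prob_space M"
    and noise: "\<And>n. 1 \<le> n \<Longrightarrow>
          distributed M (\<Pi>\<^sub>M i\<in>{..<n}. lborel) (e n)
            (\<lambda>x. ennreal (mvn_density (0\<^sub>v n) (\<sigma>0sq \<cdot>\<^sub>m 1\<^sub>m n) (Matrix.vec n x)))"
    and Y: "\<And>n \<omega>. 1 \<le> n \<Longrightarrow> Y n \<omega> = X n *\<^sub>v \<beta>0 n + Matrix.vec n (e n \<omega>)"
    and bh: "\<And>n \<omega>. 1 \<le> n \<Longrightarrow> bh n \<omega> = ls_estimator (X n) (Y n \<omega>)"
    and S: "\<And>n \<omega>. 1 \<le> n \<Longrightarrow> S n \<omega> = rss (X n) (Y n \<omega>)"
    and condition: "\<alpha> = 0 \<or>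
          \<not> (\<exists>(k :: nat \<Rightarrow> nat) A. strict_mono k \<and> (\<forall>n. 1 \<le> k n) \<and> 0 < A
               \<and> (\<lambda>n. (l2norm (\<gamma> (k n) - \<beta>0 (k n)))\<^sup>2) \<longlonglongrightarrow> A
               \<and> \<not> (\<lambda>n. linfnorm (\<gamma> (k n) - \<beta>0 (k n))) \<longlonglongrightarrow> 0)"
  shows "\<forall>\<epsilon>>0. AE \<omega> in M.
           (\<lambda>n. posterior_prob a b (X n) (\<gamma> n) (bh n \<omega>) (S n \<omega>)
                  {\<beta>. linfnorm (\<beta> - \<beta>0 n) > \<epsilon>}) \<longlonglongrightarrow> 0"
proof (intro allI impI)
  fix \<epsilon> :: real assume \<epsilon>: "\<epsilon> > 0"
  \<comment> \<open>The maximum secures positivity even if there are no eigenvalues to force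
    \<open>lmax > 0\<close>.\<close>
  define L where "L = max lmax 1"
  \<comment> \<open>Weights of the noise in the \<open>j\<close>-th coordinate of the least squares
    error.\<close>
  define u where "u = (\<lambda>n j. fitted (X n) (dual (X n) j))"
  define C where "C = 4 * \<sigma>0sq"
  define z where "z = (\<lambda>n \<omega>. Matrix.vec n (e n \<omega>))"
  have L: "L > 0" and ev: "\<And>n l. 1 \<le> n \<Longrightarrow> eigenvalue (real n \<cdot>\<^sub>m minv (gram (X n))) l \<Longrightarrow> l \<le> L"
    unfolding L_def using eigenvalues by force+
  have C: "C > 0" unfolding C_def using sigma0 by simp
  have zc: "z n \<omega> \<in> carrier_vec n" for n \<omega> unfolding z_def by simp
  have bh_eq: "bh n \<omega> = \<beta>0 n + ls_estimator (X n) (z n \<omega>)"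
    and S_eq: "S n \<omega> = rss (X n) (z n \<omega>)" if n: "1 \<le> n" for n \<omega>
    using ls_estimator_shift[OF X_carrier[OF n] X_rank[OF n] beta0_carrier[OF n] zc[of n \<omega>]]
      rss_shift[OF X_carrier[OF n] X_rank[OF n] beta0_carrier[OF n] zc[of n \<omega>]]
    by (simp_all add: bh[OF n] S[OF n] Y[OF n] z_def)
  have bh_c: "bh n \<omega> \<in> carrier_vec (p n)" if n: "1 \<le> n" for n \<omega>
    unfolding bh[OF n] by (rule ls_estimator_carrier[OF X_carrier[OF n] X_rank[OF n]])
  have dev: "vec_index (bh n \<omega>) j - vec_index (\<beta>0 n) j = vec_index (ls_estimator (X n) (z n \<omega>)) j"
    if n: "1 \<le> n" and j: "j < p n" for n \<omega> j
    unfolding bh_eq[OF n]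
    using j beta0_carrier[OF n] ls_estimator_carrier[OF X_carrier[OF n] X_rank[OF n], of "z n \<omega>"] by simp
  have pyth: "S n \<omega> + gform (X n) (\<lambda>j. vec_index (bh n \<omega>) j - vec_index (\<beta>0 n) j) = (\<Sum>i<n. (e n \<omega> i)\<^sup>2)"
    if n: "1 \<le> n" for n \<omega>
  proof -
    have "gform (X n) (\<lambda>j. vec_index (bh n \<omega>) j - vec_index (\<beta>0 n) j)
      = gform (X n) (vec_index (ls_estimator (X n) (z n \<omega>)))"
      unfolding gform_def fitted_def using dev[OF n] X_carrier[OF n] by simp
    then show ?thesis
      using rss_pythagoras[OF X_carrier[OF n] X_rank[OF n] zc[of n \<omega>]] S_eq[OF n, of \<omega>]
      by (simp add: z_def)
  qed
  have S_pos: "AE \<omega> in M. \<forall>n\<ge>1. S n \<omega> > 0"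
  proof -
    have "AE \<omega> in M. S n \<omega> > 0" if n: "1 \<le> n" for n
    proof -
      obtain y where y: "y \<in> carrier_vec n" "y \<noteq> 0\<^sub>v n" "transpose_mat (X n) *\<^sub>v y = 0\<^sub>v (p n)"
        using left_kernel_nontrivial[OF X_carrier[OF n] X_rank[OF n] p_less[OF n]] by blast
      obtain i0 where i0: "i0 < n" "vec_index y i0 \<noteq> 0"
      proof (rule ccontr)
        assume "\<not> thesis"
        with that have "vec_index y i = 0" if "i < n" for i using \<open>i < n\<close> by blast
        then have "y = 0\<^sub>v n" using y(1) by (intro eq_vecI) auto
        with y(2) show False by simp
      qed
      have "AE \<omega> in M. (\<Sum>i<n. vec_index y i * e n \<omega> i) \<noteq> 0"
        by (rule noise_hyperplane_null[where u = "vec_index y", OF sigma0 noise[OF n] i0])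
      then show ?thesis
      proof eventually_elim
        case (elim \<omega>)
        have "S n \<omega> \<noteq> 0"
          using rss_zero_orthogonal[OF X_carrier[OF n] X_rank[OF n] zc[of n \<omega>] y(1,3)] S_eq[OF n, of \<omega>] elim
          by (auto simp: z_def)
        moreover have "S n \<omega> \<ge> 0" unfolding S_eq[OF n] by (rule rss_nonneg)
        ultimately show ?case by linarith
      qed
    qed
    then show ?thesis by (subst AE_all_countable) (auto intro: AE_I2)
  qed
  have norm: "AE \<omega> in M. \<forall>\<^sub>F n in sequentially. \<omega> \<notin> {\<omega> \<in> space M. (\<Sum>i<n. (e n \<omega> i)\<^sup>2) \<ge> 4 * \<sigma>0sq * real n}"
  proof (rule borel_cantelli_eventually)
    show "{\<omega> \<in> space M. (\<Sum>i<n. (e n \<omega> i)\<^sup>2) \<ge> 4 * \<sigma>0sq * real n} \<in> sets M" if n: "1 \<le> n" for n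
    proof -
      have [measurable]: "(\<lambda>\<omega>. \<Sum>i<n. (e n \<omega> i)\<^sup>2) \<in> borel_measurable M"
        using noise_component[OF sigma0 noise[OF n]] by (intro borel_measurable_sum borel_measurable_power) auto
      show ?thesis by measurable
    qed
    show "emeasure M {\<omega> \<in> space M. (\<Sum>i<n. (e n \<omega> i)\<^sup>2) \<ge> 4 * \<sigma>0sq * real n} \<le> ennreal ((sqrt 2 / exp 1) ^ n)"
      if n: "1 \<le> n" for n
      by (rule noise_norm_tail[OF sigma0 noise[OF n]])
    \<comment> \<open>The ratio of the geometric series is below 1 because \<open>sqrt 2 < 2\<close>
      and \<open>exp 1\<close> is at least 2.\<close>
    have "sqrt 2 < 2" by (rule real_less_lsqrt) auto
    moreover have "exp 1 \<ge> (2::real)" using exp_ge_add_one_self[of 1] by simp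
    ultimately show "summable (\<lambda>n. (sqrt 2 / exp 1) ^ n :: real)"
      by (intro summable_geometric) (simp add: divide_less_eq)
  qed simp
  have close: "AE \<omega> in M. \<forall>\<^sub>F n in sequentially. \<omega> \<notin> (\<Union>j<p n. {\<omega> \<in> space M. \<bar>\<Sum>i<n. u n j i * e n \<omega> i\<bar> \<ge> \<epsilon> / 4})"
  proof (rule borel_cantelli_eventually)
    \<comment> \<open>For deviation \<open>\<epsilon> / 4\<close> and variance factor
      \<open>L / n\<close> the Gaussian tail exponent is \<open>K * n\<close>, which beats the
      number \<open>p n < n\<close> of coordinates.\<close>
    define K where "K = (\<epsilon> / 4)\<^sup>2 / (2 * \<sigma>0sq * L)"
    have K: "K > 0" unfolding K_def using \<epsilon> sigma0 L by simp
    have ms: "{\<omega> \<in> space M. \<bar>\<Sum>i<n. u n j i * e n \<omega> i\<bar> \<ge> \<epsilon> / 4} \<in> sets M" if n: "1 \<le> n" for n j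
    proof -
      have [measurable]: "(\<lambda>\<omega>. \<Sum>i<n. u n j i * e n \<omega> i) \<in> borel_measurable M"
        using noise_component[OF sigma0 noise[OF n]] by (intro borel_measurable_sum borel_measurable_times) auto
      show ?thesis by measurable
    qed
    show "(\<Union>j<p n. {\<omega> \<in> space M. \<bar>\<Sum>i<n. u n j i * e n \<omega> i\<bar> \<ge> \<epsilon> / 4}) \<in> sets M" if n: "1 \<le> n" for n
      using ms[OF n] by auto
    show "emeasure M (\<Union>j<p n. {\<omega> \<in> space M. \<bar>\<Sum>i<n. u n j i * e n \<omega> i\<bar> \<ge> \<epsilon> / 4})
      \<le> ennreal (real n * (2 * exp (- K * real n)))" if n: "1 \<le> n" for n
    proof -
      have one: "emeasure M {\<omega> \<in> space M. \<bar>\<Sum>i<n. u n j i * e n \<omega> i\<bar> \<ge> \<epsilon> / 4} \<le> ennreal (2 * exp (- K * real n))"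
        if j: "j < p n" for j
      proof -
        \<comment> \<open>The squared weights sum to \<open>gform (X n) (dual (X n) j)\<close>,
          which is the diagonal entry \<open>dual (X n) j j\<close>.\<close>
        have "(\<Sum>i<n. (u n j i)\<^sup>2) \<le> L / real n"
          using gform_dual[OF X_carrier[OF n] X_rank[OF n] j] dual_diag_le[OF X_carrier[OF n] X_rank[OF n] _ ev[OF n] j]
            X_carrier[OF n] n unfolding u_def gform_def by simp
        then have "emeasure M {\<omega> \<in> space M. \<bar>\<Sum>i<n. u n j i * e n \<omega> i\<bar> \<ge> \<epsilon> / 4}
          \<le> ennreal (2 * exp (- (\<epsilon> / 4)\<^sup>2 / (2 * \<sigma>0sq * (L / real n))))"
          using n L \<epsilon> by (intro noise_linear_tail[OF sigma0 noise[OF n]]) auto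
        also have "- (\<epsilon> / 4)\<^sup>2 / (2 * \<sigma>0sq * (L / real n)) = - K * real n"
          unfolding K_def using n L sigma0 by (simp add: field_simps)
        finally show ?thesis .
      qed
      have "emeasure M (\<Union>j<p n. {\<omega> \<in> space M. \<bar>\<Sum>i<n. u n j i * e n \<omega> i\<bar> \<ge> \<epsilon> / 4})
        \<le> (\<Sum>j<p n. emeasure M {\<omega> \<in> space M. \<bar>\<Sum>i<n. u n j i * e n \<omega> i\<bar> \<ge> \<epsilon> / 4})"
        using ms[OF n] by (intro emeasure_subadditive_finite) auto
      also have "\<dots> \<le> (\<Sum>j<p n. ennreal (2 * exp (- K * real n)))"
        by (intro sum_mono one) auto
      also have "\<dots> = ennreal (real (p n) * (2 * exp (- K * real n)))"
        by (simp add: ennreal_mult' ennreal_of_nat_eq_real_of_nat)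
      also have "\<dots> \<le> ennreal (real n * (2 * exp (- K * real n)))"
        using p_less[OF n] by (intro ennreal_leI mult_right_mono) auto
      finally show ?thesis .
    qed
    show "summable (\<lambda>n. real n * (2 * exp (- K * real n)))"
    proof (rule summable_comparison_test_bigo)
      show "summable (\<lambda>n. norm (inverse (real n ^ 2)))"
        using inverse_power_summable[of 2, where 'a = real] by simp
      show "(\<lambda>n. real n * (2 * exp (- K * real n))) \<in> O(\<lambda>n. inverse (real n ^ 2))"
        using K by real_asymp
    qed
  qed simp
  have dich: "\<alpha> = 0 \<or> (\<forall>\<eta>>0. \<forall>D. \<forall>\<^sub>F n in sequentially.
           linfnorm (\<gamma> n - \<beta>0 n) < \<eta> \<or> l2norm (\<gamma> n - \<beta>0 n) > D)"
    using condition
  proof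
    assume no: "\<not> (\<exists>(k :: nat \<Rightarrow> nat) A. strict_mono k \<and> (\<forall>n. 1 \<le> k n) \<and> 0 < A
               \<and> (\<lambda>n. (l2norm (\<gamma> (k n) - \<beta>0 (k n)))\<^sup>2) \<longlonglongrightarrow> A
               \<and> \<not> (\<lambda>n. linfnorm (\<gamma> (k n) - \<beta>0 (k n))) \<longlonglongrightarrow> 0)"
    have "\<forall>\<^sub>F n in sequentially. linfnorm (\<gamma> n - \<beta>0 n) < \<eta> \<or> l2norm (\<gamma> n - \<beta>0 n) > D"
      if "\<eta> > 0" for \<eta> D
      by (rule no_intermediate_subsequence[OF no linfnorm_le_l2norm that])
    then show ?thesis by blast
  qed simp
  show "AE \<omega> in M. (\<lambda>n. posterior_prob a b (X n) (\<gamma> n) (bh n \<omega>) (S n \<omega>)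
                  {\<beta>. linfnorm (\<beta> - \<beta>0 n) > \<epsilon>}) \<longlonglongrightarrow> 0"
    using S_pos norm close AE_space
  proof eventually_elim
    case (elim \<omega>)
    have ge1: "\<forall>\<^sub>F n in sequentially. 1 \<le> (n::nat)" by (rule eventually_ge_at_top)
    have small: "\<forall>\<^sub>F n in sequentially. (\<Sum>i<n. (e n \<omega> i)\<^sup>2) \<le> C * real n"
      using elim(2) by eventually_elim (use elim(4) in \<open>auto simp: C_def\<close>)
    show ?case
    proof (rule posterior_consistency_deterministic[OF p_less p_ratio alpha(2) X_carrier X_rank L ev
          beta0_carrier gamma_carrier bh_c hyperparameters C \<epsilon> _ _ _ _ dich])
      show "\<forall>\<^sub>F n in sequentially. S n \<omega> > 0" using ge1 by eventually_elim (use elim(1) in auto)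
      show "\<forall>\<^sub>F n in sequentially. S n \<omega> \<le> C * real n"
        using small ge1
      proof eventually_elim
        case (elim n)
        then show ?case using pyth[of n \<omega>] gform_nonneg[of "X n"] by (smt (verit))
      qed
      show "\<forall>\<^sub>F n in sequentially. gform (X n) (\<lambda>j. vec_index (bh n \<omega>) j - vec_index (\<beta>0 n) j) \<le> C * real n"
        using small ge1
      proof eventually_elim
        case (elim n)
        have "S n \<omega> \<ge> 0" unfolding S_eq[OF elim(2)] by (rule rss_nonneg)
        then show ?case using pyth[OF elim(2), of \<omega>] elim(1) by linarith
      qed
      show "\<forall>\<^sub>F n in sequentially. \<forall>j<p n. \<bar>vec_index (bh n \<omega>) j - vec_index (\<beta>0 n) j\<bar> \<le> \<epsilon> / 4"
        using elim(3) ge1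
      proof eventually_elim
        case (elim n)
        show ?case
        proof (intro allI impI)
          fix j assume j: "j < p n"
          have "vec_index (ls_estimator (X n) (z n \<omega>)) j = (\<Sum>i<n. u n j i * e n \<omega> i)"
            using ls_estimator_index[OF X_carrier[OF elim(2)] X_rank[OF elim(2)] zc j] by (simp add: z_def u_def)
          moreover have "\<not> \<epsilon> / 4 \<le> \<bar>\<Sum>i<n. u n j i * e n \<omega> i\<bar>"
            using elim(1) j \<open>\<omega> \<in> space M\<close> by blast
          ultimately show "\<bar>vec_index (bh n \<omega>) j - vec_index (\<beta>0 n) j\<bar> \<le> \<epsilon> / 4"
            unfolding dev[OF elim(2) j] by linarith
        qed
      qed
    qed
  qed
qed

end
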